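(* Let $\tau=(\tau^{(1)},\dots,\tau^{(N)})$ be the absorption times of $N$ i.i.d. copies of a time-inhomogeneous Markov jump process on $E=\{1,\dots,p,p+1\}$ with absorbing state $p+1$, and suppose that the sub-intensity matrix function is piecewise constant, $\mathbf{T}(s;\theta)=\mathbf{T}_k(\theta)=\{\mu_{ij}^k(\theta)\}_{i,j=1,\dots,p}$ for $s\in(s_{k-1},s_k]$, $k=1,\dots,K$, on a grid $0=s_0<s_1<\dots<s_{K-1}<s_K=\infty$. Then the conditional expected sufficient statistics $\bar{B}_i^{(m)}=\mathbb{E}_{(\pi^{(m)},\theta^{(m)})}[B_i\mid\tau]$, $\bar{E}_i^{(m)}(k)=\mathbb{E}_{(\pi^{(m)},\theta^{(m)})}[E_i(k)\mid\tau]$, $\bar{O}_{ij}^{(m)}(k)=\mathbb{E}_{(\pi^{(m)},\theta^{(m)})}[O_{ij}(k)\mid\tau]$ are given by, for $i,j\in\{1,\dots,p\}$, $j\ne i$, and $k=1,\dots,K$, $$\bar{B}_i^{(m)}=\sum_{n=1}^N\frac{\pi_i^{(m)}e_i'\bar{\mathbf{P}}(0,\tau^{(n)};\theta^{(m)})\,\mathbf{t}_{k^{(n)}}(\theta^{(m)})}{f(\tau^{(n)};\pi^{(m)},\theta^{(m)})},$$ $$\bar{E}_i^{(m)}(k)=\sum_{n=1}^N\frac{\displaystyle\int_{s_{k-1}\wedge\tau^{(n)}}^{s_k\wedge\tau^{(n)}}\pi^{(m)}\bar{\mathbf{P}}(0,u;\theta^{(m)})\,e_ie_i'\,\bar{\mathbf{P}}(u,\tau^{(n)};\theta^{(m)})\,\mathbf{t}_{k^{(n)}}(\theta^{(m)})\,du}{f(\tau^{(n)};\pi^{(m)},\theta^{(m)})},$$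 $$\bar{O}_{ij}^{(m)}(k)=\sum_{n=1}^N\frac{\displaystyle\int_{s_{k-1}\wedge\tau^{(n)}}^{s_k\wedge\tau^{(n)}}\pi^{(m)}\bar{\mathbf{P}}(0,u;\theta^{(m)})\,e_i\,\mu_{ij}^k(\theta^{(m)})\,e_j'\,\bar{\mathbf{P}}(u,\tau^{(n)};\theta^{(m)})\,\mathbf{t}_{k^{(n)}}(\theta^{(m)})\,du}{f(\tau^{(n)};\pi^{(m)},\theta^{(m)})},$$ $$\bar{O}_{i,p+1}^{(m)}(k)=\sum_{n=1}^N\mathbf{1}_{(\tau^{(n)}\in(s_{k-1},s_k])}\frac{\pi^{(m)}\bar{\mathbf{P}}(0,\tau^{(n)};\theta^{(m)})\,e_ie_i'\,\mathbf{t}_{k^{(n)}}(\theta^{(m)})}{f(\tau^{(n)};\pi^{(m)},\theta^{(m)})},$$ where, with $k(x)$ the unique $k$ such that $x\in(s_{k-1},s_k]$ (and $k(0)=1$) and $k^{(n)}=k(\tau^{(n)})$, $$\bar{\mathbf{P}}(s,t;\theta)=e^{\mathbf{T}_{k(s)}(\theta)(s_{k(s)}-s)}\,\mathbf{A}(k(s)+1,k(t)-1;\theta)\,e^{\mathbf{T}_{k(t)}(\theta)(t-s_{k(t)-1})}\quad\text{if }k(s)<k(t),$$ $$\bar{\mathbf{P}}(s,t;\theta)=e^{\mathbf{T}_{k(t)}(\theta)(t-s)}\quad\text{if }k(s)=k(t),$$ $$f(x;\pi,\theta)=\pi\,\mathbf{A}(1,k(x)-1;\theta)\,e^{\mathbf{T}_{k(x)}(\theta)(x-s_{k(x)-1})}\,\mathbf{t}_{k(x)}(\theta),$$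 and $\mathbf{A}(k_1,k_2;\theta)=\prod_{\ell=k_1}^{k_2}e^{\mathbf{T}_\ell(\theta)(s_\ell-s_{\ell-1})}$ (ordered product, $\ell$ increasing from left to right; the empty product is the identity matrix).
   Context: Let $X^{(1)},\dots,X^{(N)}$ be the i.i.d. processes, with transient states $1,\dots,p$, initial distribution $(\pi,0)$, $\pi=(\pi_1,\dots,\pi_p)$ a row vector, and intensity matrix function $\begin{pmatrix}\mathbf{T}(t;\theta)&\mathbf{t}(t;\theta)\\0&0\end{pmatrix}$, $\mathbf{t}(t;\theta)=-\mathbf{T}(t;\theta)\mathbf{e}$, $\mathbf{e}=(1,\dots,1)'$, $\theta\in\Theta$, a finite-dimensional parameter space with non-empty interior. In the piecewise constant case $\mathbf{t}(s;\theta)=\mathbf{t}_k(\theta)=-\mathbf{T}_k(\theta)\mathbf{e}$ for $s\in(s_{k-1},s_k]$. $e_i$ is the $i$-th standard column unit vector of $\mathbb{R}^p$, $'$ denotes transpose, and $a\wedge b=\min(a,b)$. Absorption times $\tau^{(n)}=\inf\{t\ge0:X^{(n)}(t)=p+1\}$ are a.s. finite. Complete-data statistics: $I_i^{(n)}(s)=\mathbf{1}_{(X^{(n)}(s)=i)}$; $N_{ij}^{(n)}(t)=\#\{s\in(0,t]:X^{(n)}(s-)=i,X^{(n)}(s)=j\}$; $B_i=\sum_{n=1}^NI_i^{(n)}(0)$ (number of starts in state $i$); $O_{ij}(k)=\sum_{n=1}^N\int_{(s_{k-1},s_k]}dN_{ij}^{(n)}(t)$ (number of transitions from $i$ to $j$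 in $(s_{k-1},s_k]$); $E_i(k)=\sum_{n=1}^N\int_{s_{k-1}}^{s_k}I_i^{(n)}(t)\,dt$ (total time spent in state $i$ during $(s_{k-1},s_k]$). $\mathbb{E}_{(\pi,\theta)}$ denotes expectation when the processes have initial distribution $\pi$ and sub-intensity matrix function $\mathbf{T}(\cdot\,;\theta)$; $(\pi^{(m)},\theta^{(m)})$, $m\in\mathbb{N}_0$, is any current parameter value. Identities between conditional expectations hold almost surely under $(\pi^{(m)},\theta^{(m)})$. *)

theory Defs
  imports "HOL-Probability.Probability"
begin

section \<open>Sub-intensity matrices\<close>

text \<open>The transient states \<open>1, \<dots>, p\<close> are the elements of a finite type \<open>'p\<close>, and the
  state space \<open>E = {1, \<dots>, p, p + 1}\<close> is \<open>'p option\<close>, with \<^term>\<open>None\<close> as the absorbing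
  state \<open>p + 1\<close>.\<close>

definition sub_intensity_matrix :: "real ^ 'p::finite ^ 'p \<Rightarrow> bool" where
  "sub_intensity_matrix A \<longleftrightarrow>
     (\<forall>i j. i \<noteq> j \<longrightarrow> 0 \<le> A $ i $ j) \<and> (\<forall>i. (\<Sum>j\<in>UNIV. A $ i $ j) \<le> 0)"

definition exit_rates :: "real ^ 'p::finite ^ 'p \<Rightarrow> real ^ 'p" where
  "exit_rates A = - (A *v (\<chi> i. 1))"

definition intensity_matrix :: "real ^ 'p::finite ^ 'p \<Rightarrow> real ^ 'p option ^ 'p option" where
  "intensity_matrix A = (\<chi> a b.
     case a of None \<Rightarrow> 0
     | Some i \<Rightarrow> (case b of None \<Rightarrow> exit_rates A $ i | Some j \<Rightarrow> A $ i $ j))"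

definition initial_vector :: "real ^ 'p::finite \<Rightarrow> real ^ 'p option" where
  "initial_vector \<pi> = (\<chi> a. case a of None \<Rightarrow> 0 | Some i \<Rightarrow> \<pi> $ i)"

definition probability_vector :: "real ^ 'p::finite \<Rightarrow> bool" where
  "probability_vector \<pi> \<longleftrightarrow> (\<forall>i. 0 \<le> \<pi> $ i) \<and> (\<Sum>i\<in>UNIV. \<pi> $ i) = 1"


section \<open>Time-inhomogeneous Markov jump processes\<close>

text \<open>\<open>P s t\<close> is the product integral of \<open>I + \<Lambda> u du\<close> over \<open>(s, t]\<close>, i.e. the solution of
  Kolmogorov's forward equation \<open>\<partial>P(s, t)/\<partial>t = P(s, t) \<Lambda>(t)\<close>, \<open>P(s, s) = I\<close>. The
  equation is required in integrated form because \<open>\<Lambda>\<close> may jump, at which points \<open>P s\<close> has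
  no two-sided derivative; \<open>s = t\<close> yields \<open>P s s = I\<close>.\<close>

definition forward_solution ::
    "(real \<Rightarrow> real ^ 's::finite ^ 's) \<Rightarrow> (real \<Rightarrow> real \<Rightarrow> real ^ 's ^ 's) \<Rightarrow> bool" where
  "forward_solution \<Lambda> P \<longleftrightarrow>
     (\<forall>s t. 0 \<le> s \<and> s \<le> t \<longrightarrow>
        ((\<lambda>u. P s u ** \<Lambda> u) has_integral (P s t - mat 1)) {s..t})"

text \<open>Right-continuity and left limits in the discrete topology; such a path has finitely
  many jumps in every compact time interval.\<close>

definition jump_path :: "(real \<Rightarrow> 's) \<Rightarrow> bool" where
  "jump_path x \<longleftrightarrow>
     (\<forall>t\<ge>0. eventually (\<lambda>u. x u = x t) (at_right t)) \<and>
     (\<forall>t>0. \<exists>i. eventually (\<lambda>u. x u = i) (at_left t))"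

text \<open>In the Markov property, \<open>F\<close> is the finite set of past observation times, \<open>s\<close> the
  present time, and \<open>y\<close> prescribes the states observed at these times.\<close>

definition markov_jump_process ::
    "'w measure \<Rightarrow> real ^ 's::finite \<Rightarrow> (real \<Rightarrow> real ^ 's ^ 's) \<Rightarrow>
     (real \<Rightarrow> 'w \<Rightarrow> 's) \<Rightarrow> bool" where
  "markov_jump_process M \<alpha> \<Lambda> X \<longleftrightarrow>
     (\<forall>t\<ge>0. X t \<in> measurable M (count_space UNIV)) \<and>
     (\<forall>\<omega>\<in>space M. jump_path (\<lambda>t. X t \<omega>)) \<and>
     (\<forall>a. \<P>(\<omega> in M. X 0 \<omega> = a) = \<alpha> $ a) \<and>
     (\<exists>P. forward_solution \<Lambda> P \<and>
        (\<forall>s t F y b. 0 \<le> s \<longrightarrow> s \<le> t \<longrightarrow> finite F \<longrightarrow> F \<subseteq> {0..<s} \<longrightarrow>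
           0 < \<P>(\<omega> in M. \<forall>r\<in>insert s F. X r \<omega> = y r) \<longrightarrow>
           \<P>(\<omega> in M. X t \<omega> = b \<bar> \<forall>r\<in>insert s F. X r \<omega> = y r) = P s t $ y s $ b))"


section \<open>Path functionals and sufficient statistics\<close>

definition absorption_time :: "(real \<Rightarrow> 'p option) \<Rightarrow> real" where
  "absorption_time x = Inf {t. 0 \<le> t \<and> x t = None}"

definition sojourn_time :: "(real \<Rightarrow> 's) \<Rightarrow> 's \<Rightarrow> real set \<Rightarrow> real" where
  "sojourn_time x a S = (LINT t:S|lborel. of_bool (x t = a))"

text \<open>The increment over \<open>S\<close> of the counting process \<open>N\<^sub>a\<^sub>b\<close>; the left limit \<open>x (t-)\<close>
  equals \<open>a\<close> iff \<open>x\<close> is eventually \<open>a\<close> to the left of \<open>t\<close>.\<close>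

definition jump_count :: "(real \<Rightarrow> 's) \<Rightarrow> 's \<Rightarrow> 's \<Rightarrow> real set \<Rightarrow> nat" where
  "jump_count x a b S = card {t \<in> S. eventually (\<lambda>u. x u = a) (at_left t) \<and> x t = b}"

text \<open>The grid \<open>0 = s 0 < \<dots> < s K = \<infinity>\<close> takes extended real values, and \<open>cell s k\<close> is the
  set of real numbers in \<open>(s (k - 1), s k]\<close>.\<close>

definition grid :: "nat \<Rightarrow> (nat \<Rightarrow> ereal) \<Rightarrow> bool" where
  "grid K s \<longleftrightarrow> s 0 = 0 \<and> s K = \<infinity> \<and> strict_mono_on {0..K} s"

definition cell :: "(nat \<Rightarrow> ereal) \<Rightarrow> nat \<Rightarrow> real set" where
  "cell s k = {x. s (k - 1) < ereal x \<and> ereal x \<le> s k}"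

definition stat_B :: "nat \<Rightarrow> (nat \<Rightarrow> real \<Rightarrow> 'w \<Rightarrow> 'p option) \<Rightarrow> 'p \<Rightarrow> 'w \<Rightarrow> real" where
  "stat_B N X i \<omega> = (\<Sum>n=1..N. of_bool (X n 0 \<omega> = Some i))"

definition stat_E ::
    "nat \<Rightarrow> (nat \<Rightarrow> real \<Rightarrow> 'w \<Rightarrow> 'p option) \<Rightarrow> (nat \<Rightarrow> ereal) \<Rightarrow> 'p \<Rightarrow> nat \<Rightarrow> 'w \<Rightarrow> real" where
  "stat_E N X s i k \<omega> = (\<Sum>n=1..N. sojourn_time (\<lambda>t. X n t \<omega>) (Some i) (cell s k))"

definition stat_O ::
    "nat \<Rightarrow> (nat \<Rightarrow> real \<Rightarrow> 'w \<Rightarrow> 'p option) \<Rightarrow> (nat \<Rightarrow> ereal) \<Rightarrow>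
     'p \<Rightarrow> 'p option \<Rightarrow> nat \<Rightarrow> 'w \<Rightarrow> real" where
  "stat_O N X s i b k \<omega> = (\<Sum>n=1..N. real (jump_count (\<lambda>t. X n t \<omega>) (Some i) b (cell s k)))"

definition sigma_absorption ::
    "'w measure \<Rightarrow> nat \<Rightarrow> (nat \<Rightarrow> real \<Rightarrow> 'w \<Rightarrow> 'p option) \<Rightarrow> 'w measure" where
  "sigma_absorption M N X =
     vimage_algebra (space M) (\<lambda>\<omega>. \<lambda>n\<in>{1..N}. absorption_time (\<lambda>t. X n t \<omega>))
       (\<Pi>\<^sub>M n\<in>{1..N}. borel)"


section \<open>Closed-form expressions on the grid\<close>

definition mat_exp :: "real ^ 'p::finite ^ 'p \<Rightarrow> real ^ 'p ^ 'p" where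
  "mat_exp A = (\<Sum>m. (((**) A) ^^ m) (mat 1) /\<^sub>R fact m)"

definition cell_index :: "nat \<Rightarrow> (nat \<Rightarrow> ereal) \<Rightarrow> real \<Rightarrow> nat" where
  "cell_index K s x = (if x = 0 then 1 else THE k. k \<in> {1..K} \<and> x \<in> cell s k)"

text \<open>In the following, \<open>T k\<close> is the value of the sub-intensity matrix function on \<open>cell s k\<close>.
  Only finite grid points enter through \<^term>\<open>real_of_ereal\<close>: \<open>A_prod\<close> is used with
  \<open>k2 < K\<close> only. The factors are ordered with the index increasing from left to right.\<close>

definition A_prod ::
    "(nat \<Rightarrow> ereal) \<Rightarrow> (nat \<Rightarrow> real ^ 'p::finite ^ 'p) \<Rightarrow> nat \<Rightarrow> nat \<Rightarrow> real ^ 'p ^ 'p" where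
  "A_prod s T k1 k2 =
     foldr (\<lambda>l B. mat_exp (real_of_ereal (s l - s (l - 1)) *\<^sub>R T l) ** B) [k1..<Suc k2] (mat 1)"

definition P_bar ::
    "nat \<Rightarrow> (nat \<Rightarrow> ereal) \<Rightarrow> (nat \<Rightarrow> real ^ 'p::finite ^ 'p) \<Rightarrow> real \<Rightarrow> real \<Rightarrow> real ^ 'p ^ 'p" where
  "P_bar K s T u t =
     (let ku = cell_index K s u; kt = cell_index K s t in
      if ku < kt then
        mat_exp ((real_of_ereal (s ku) - u) *\<^sub>R T ku) **
        A_prod s T (ku + 1) (kt - 1) **
        mat_exp ((t - real_of_ereal (s (kt - 1))) *\<^sub>R T kt)
      else mat_exp ((t - u) *\<^sub>R T kt))"

definition absorption_density ::
    "nat \<Rightarrow> (nat \<Rightarrow> ereal) \<Rightarrow> (nat \<Rightarrow> real ^ 'p::finite ^ 'p) \<Rightarrow> real ^ 'p \<Rightarrow> real \<Rightarrow> real" where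
  "absorption_density K s T \<pi> x =
     (let k = cell_index K s x in
      (\<pi> v* (A_prod s T 1 (k - 1) ** mat_exp ((x - real_of_ereal (s (k - 1))) *\<^sub>R T k)))
        \<bullet> exit_rates (T k))"

end

theory Submission
  imports Defs
begin

text \<open>
  Since the statistics are nonnegative functions of single paths, their conditional expectations are
  determined by the integrals \<open>E[S(X); \<tau> \<in> A]\<close> for one path, and the claim says that each of these
  equals the integral over \<open>A\<close> of the numerator in the formula: the numerator is the density of
  the measure \<open>A \<mapsto> E[S(X); \<tau> \<in> A]\<close>, while \<open>f\<close> is the density of \<open>\<tau>\<close> itself. Their quotient is the
  conditional expectation given \<open>\<tau>\<close> (\<open>absorption_ratio\<close>), and by independence the other
  absorption times may be added to the condition (\<open>nn_cond_exp_sum_indep\<close>).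

  The densities come from Kolmogorov's forward equation for a transition function \<open>P\<close> on all states.
  On every cell its block of transient states satisfies a linear differential equation with constant
  coefficients, hence it is the product of exponentials \<open>P_bar\<close> (\<open>forward_equation_unique\<close>,
  \<open>P_Some_Some\<close>). The column of the absorbing state says that a path in state \<open>j\<close> at time \<open>v\<close> is
  absorbed with density \<open>e\<^sub>j' P_bar(v, x) t(x)\<close> at \<open>x > v\<close>; with the Markov property this gives the
  joint law of \<open>\<tau>\<close> and the states at one or two earlier times (\<open>cylinder_absorption\<close>).

  For the starts this is already the claim, and for the sojourn times Tonelli's theorem suffices
  (\<open>expected_sojourn\<close>). The number of transitions from \<open>a\<close> to \<open>b\<close> in a bounded interval is, for
  all sufficiently small \<open>h\<close>, the length of the set of times \<open>u\<close> with \<open>X(u) = a\<close> and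
  \<open>X(u + h) = b\<close>, divided by \<open>h\<close> (\<open>increment_rate_eventually\<close>). The expectation of this quotient
  is an integral of two-time probabilities, whose first-order expansion in \<open>h\<close> is given by the
  forward equation. The quotients are dominated by the total number of jumps, which has finite
  expectation by Fatou's lemma, so dominated convergence turns the expansion into the expected number
  of transitions (\<open>expected_jump_number\<close>). It is applied on the event \<open>\<tau> \<in> A\<close> to transitions
  between transient states (\<open>expected_transitions\<close>), and without restriction to the jumps into the
  absorbing state (\<open>expected_exits\<close>), which can only
  happen at \<open>\<tau>\<close>.
\<close>


section \<open>The matrix exponential\<close>

abbreviation mat_power :: "real ^ 'p::finite ^ 'p \<Rightarrow> nat \<Rightarrow> real ^ 'p ^ 'p" where
  "mat_power A m \<equiv> (((**) A) ^^ m) (mat 1)"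

lemma mat_power_commute: "A ** mat_power A m = mat_power A m ** A"
proof (induction m)
  case (Suc m)
  have "A ** (A ** mat_power A m) = A ** (mat_power A m ** A)" by (simp only: Suc)
  then show ?case by (simp add: matrix_mul_assoc)
qed simp

lemma mat_power_bound:
  fixes A :: "real ^ 'p::finite ^ 'p"
  defines "c \<equiv> (\<Sum>i\<in>UNIV. \<Sum>j\<in>UNIV. \<bar>A $ i $ j\<bar>)"
  shows "\<bar>mat_power A m $ i $ j\<bar> \<le> c ^ m"
proof (induction m arbitrary: i j)
  case 0
  then show ?case by (simp add: mat_def)
next
  case (Suc m)
  have c0: "0 \<le> c" unfolding c_def by (intro sum_nonneg) auto
  have "\<bar>mat_power A (Suc m) $ i $ j\<bar> = \<bar>\<Sum>k\<in>UNIV. A $ i $ k * mat_power A m $ k $ j\<bar>"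
    by (simp add: matrix_matrix_mult_def)
  also have "\<dots> \<le> (\<Sum>k\<in>UNIV. \<bar>A $ i $ k * mat_power A m $ k $ j\<bar>)" by (rule sum_abs)
  also have "\<dots> \<le> (\<Sum>k\<in>UNIV. \<bar>A $ i $ k\<bar> * c ^ m)"
    using Suc by (intro sum_mono) (simp add: abs_mult mult_left_mono)
  also have "\<dots> = (\<Sum>k\<in>UNIV. \<bar>A $ i $ k\<bar>) * c ^ m" by (simp add: sum_distrib_right)
  also have "\<dots> \<le> c * c ^ m"
  proof (rule mult_right_mono)
    show "(\<Sum>k\<in>UNIV. \<bar>A $ i $ k\<bar>) \<le> c"
      unfolding c_def by (rule member_le_sum[of i UNIV "\<lambda>i. \<Sum>j\<in>UNIV. \<bar>A $ i $ j\<bar>"]) (auto intro: sum_nonneg)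
  qed (use c0 in simp)
  finally show ?case by simp
qed

lemma mat_exp_summable:
  fixes A :: "real ^ 'p::finite ^ 'p"
  shows "summable (\<lambda>m. mat_power A m $ i $ j / fact m * z ^ m)"
proof -
  define c where "c = (\<Sum>i\<in>UNIV. \<Sum>j\<in>UNIV. \<bar>A $ i $ j\<bar>)"
  have "summable (\<lambda>m. (c * \<bar>z\<bar>) ^ m /\<^sub>R fact m)" by (rule summable_exp_generic)
  then show ?thesis
  proof (rule summable_comparison_test'[where N = 0])
    fix m :: nat
    have "\<bar>mat_power A m $ i $ j\<bar> * \<bar>z\<bar> ^ m \<le> c ^ m * \<bar>z\<bar> ^ m"
      unfolding c_def by (intro mult_right_mono mat_power_bound) auto
    then show "norm (mat_power A m $ i $ j / fact m * z ^ m) \<le> (c * \<bar>z\<bar>) ^ m /\<^sub>R fact m"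
      by (simp add: abs_mult power_abs power_mult_distrib divide_simps)
  qed
qed

lemma mat_power_scaleR: "mat_power (z *\<^sub>R A) m = z ^ m *\<^sub>R mat_power A m"
  by (induction m) (simp_all add: vec_eq_iff matrix_matrix_mult_def sum_distrib_left mult_ac)

text \<open>Along a ray the exponential can be differentiated entry by entry, as a scalar power series.\<close>

lemma mat_exp_scaleR_entry:
  "mat_exp (z *\<^sub>R A) $ i $ j = (\<Sum>m. mat_power A m $ i $ j / fact m * z ^ m)"
proof -
  have "(\<lambda>m. mat_power (z *\<^sub>R A) m /\<^sub>R fact m) sums
      (\<chi> i j. \<Sum>m. mat_power A m $ i $ j / fact m * z ^ m)"
    unfolding sums_def
  proof (intro vec_tendstoI)
    fix i j
    have *: "(\<Sum>m<n. mat_power (z *\<^sub>R A) m /\<^sub>R fact m) $ i $ j =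
        (\<Sum>m<n. mat_power A m $ i $ j / fact m * z ^ m)" for n
      by (simp add: sum_component mat_power_scaleR divide_simps mult_ac)
    show "(\<lambda>n. (\<Sum>m<n. mat_power (z *\<^sub>R A) m /\<^sub>R fact m) $ i $ j)
        \<longlonglongrightarrow> (\<chi> i j. \<Sum>m. mat_power A m $ i $ j / fact m * z ^ m) $ i $ j"
      unfolding * using summable_LIMSEQ[OF mat_exp_summable] by simp
  qed
  then show ?thesis unfolding mat_exp_def by (simp add: sums_iff)
qed

lemma mat_exp_zero: "mat_exp 0 = (mat 1 :: real ^ 'p::finite ^ 'p)"
proof -
  let ?A = "0 :: real ^ 'p ^ 'p"
  have "(\<Sum>m. mat_power ?A m $ i $ j / fact m * 0 ^ m) = mat 1 $ i $ j" for i j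
    using suminf_finite[of "{0}" "\<lambda>m. mat_power ?A m $ i $ j / fact m * 0 ^ m"] by simp
  then have "mat_exp (0 *\<^sub>R ?A) = mat 1" by (simp only: vec_eq_iff mat_exp_scaleR_entry) simp
  then show ?thesis by simp
qed

lemma mat_exp_DERIV:
  "((\<lambda>z. mat_exp (z *\<^sub>R A) $ i $ j) has_real_derivative (A ** mat_exp (z *\<^sub>R A)) $ i $ j) (at z)"
proof -
  have "((\<lambda>z. \<Sum>m. mat_power A m $ i $ j / fact m * z ^ m) has_real_derivative
      (\<Sum>m. diffs (\<lambda>m. mat_power A m $ i $ j / fact m) m * z ^ m)) (at z)"
    by (rule termdiffs_strong_converges_everywhere) (rule mat_exp_summable)
  moreover have "(\<Sum>m. diffs (\<lambda>m. mat_power A m $ i $ j / fact m) m * z ^ m) =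
     (\<Sum>m. \<Sum>k\<in>UNIV. A $ i $ k * (mat_power A m $ k $ j / fact m * z ^ m))"
  proof (intro suminf_cong)
    fix m
    have "diffs (\<lambda>m. mat_power A m $ i $ j / fact m) m = mat_power A (Suc m) $ i $ j / fact m"
      by (simp add: diffs_def divide_simps)
    also have "\<dots> = (\<Sum>k\<in>UNIV. A $ i $ k * mat_power A m $ k $ j) / fact m"
      by (simp add: matrix_matrix_mult_def)
    finally show "diffs (\<lambda>m. mat_power A m $ i $ j / fact m) m * z ^ m =
        (\<Sum>k\<in>UNIV. A $ i $ k * (mat_power A m $ k $ j / fact m * z ^ m))"
      by (simp add: sum_distrib_left sum_distrib_right sum_divide_distrib mult_ac)
  qed
  moreover have "\<dots> = (\<Sum>k\<in>UNIV. \<Sum>m. A $ i $ k * (mat_power A m $ k $ j / fact m * z ^ m))"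
    by (rule suminf_sum) (intro summable_mult mat_exp_summable)
  moreover have "\<dots> = (A ** mat_exp (z *\<^sub>R A)) $ i $ j"
    by (simp add: matrix_matrix_mult_def mat_exp_scaleR_entry suminf_mult[OF mat_exp_summable]
        del: times_divide_eq_left times_divide_eq_right)
  ultimately show ?thesis by (simp add: mat_exp_scaleR_entry)
qed

lemma mat_exp_commute: "A ** mat_exp (z *\<^sub>R A) = mat_exp (z *\<^sub>R A) ** A"
proof (simp add: vec_eq_iff, intro allI)
  fix i j
  let ?e = "\<lambda>i j m. mat_power A m $ i $ j / fact m * z ^ m"
  have "(A ** mat_exp (z *\<^sub>R A)) $ i $ j = (\<Sum>k\<in>UNIV. \<Sum>m. A $ i $ k * ?e k j m)"
    by (simp add: matrix_matrix_mult_def mat_exp_scaleR_entry suminf_mult[OF mat_exp_summable]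
        del: times_divide_eq_left times_divide_eq_right)
  also have "\<dots> = (\<Sum>m. \<Sum>k\<in>UNIV. A $ i $ k * ?e k j m)"
    by (rule suminf_sum[symmetric]) (intro summable_mult mat_exp_summable)
  also have "\<dots> = (\<Sum>m. \<Sum>k\<in>UNIV. ?e i k m * A $ k $ j)"
  proof (intro suminf_cong)
    fix m
    have "(\<Sum>k\<in>UNIV. A $ i $ k * mat_power A m $ k $ j) = (\<Sum>k\<in>UNIV. mat_power A m $ i $ k * A $ k $ j)"
      using mat_power_commute[of A m] by (simp add: vec_eq_iff matrix_matrix_mult_def)
    then have "(\<Sum>k\<in>UNIV. A $ i $ k * mat_power A m $ k $ j) * (z ^ m / fact m) =
       (\<Sum>k\<in>UNIV. mat_power A m $ i $ k * A $ k $ j) * (z ^ m / fact m)" by simp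
    then show "(\<Sum>k\<in>UNIV. A $ i $ k * ?e k j m) = (\<Sum>k\<in>UNIV. ?e i k m * A $ k $ j)"
      unfolding sum_distrib_right by (simp only: mult_ac times_divide_eq_left times_divide_eq_right)
  qed
  also have "\<dots> = (\<Sum>k\<in>UNIV. \<Sum>m. ?e i k m * A $ k $ j)"
    by (rule suminf_sum) (intro summable_mult2 mat_exp_summable)
  also have "\<dots> = (mat_exp (z *\<^sub>R A) ** A) $ i $ j"
    by (simp add: matrix_matrix_mult_def mat_exp_scaleR_entry suminf_mult2[OF mat_exp_summable]
        del: times_divide_eq_left times_divide_eq_right)
  finally show "(A ** mat_exp (z *\<^sub>R A)) $ i $ j = (mat_exp (z *\<^sub>R A) ** A) $ i $ j" .
qed

lemma mat_exp_entry_continuous: "continuous_on S (\<lambda>z. mat_exp (z *\<^sub>R A) $ i $ j)"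
  using DERIV_isCont[OF mat_exp_DERIV] by (intro continuous_at_imp_continuous_on ballI)

lemma mat_exp_entry_measurable [measurable]:
  "(\<lambda>z. mat_exp (z *\<^sub>R A) $ i $ j) \<in> borel_measurable borel"
  by (intro borel_measurable_continuous_onI mat_exp_entry_continuous)

text \<open>The function \<open>w \<mapsto> v w * exp ((b - w) A)\<close> has derivative zero. The equation is in integrated form
  because the rates may jump at the ends of the interval.\<close>

lemma linear_ode_unique:
  fixes v :: "real \<Rightarrow> 'p::finite \<Rightarrow> real"
  assumes ab: "a \<le> b"
    and v: "\<And>t i. t \<in> {a..b} \<Longrightarrow>
      ((\<lambda>w. \<Sum>k\<in>UNIV. v w k * A $ k $ i) has_integral (v t i - v a i)) {a..t}"
  shows "v b j = (\<Sum>i\<in>UNIV. v a i * mat_exp ((b - a) *\<^sub>R A) $ i $ j)"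
proof -
  let ?g = "\<lambda>w i. \<Sum>k\<in>UNIV. v w k * A $ k $ i"
  let ?E = "\<lambda>w. mat_exp ((b - w) *\<^sub>R A)"
  have int: "integral {a..t} (\<lambda>w. ?g w i) = v t i - v a i" if "t \<in> {a..b}" for t i
    using v[OF that] by (rule integral_unique)
  have cont: "continuous_on {a..b} (\<lambda>t. v t i)" for i
  proof -
    have "continuous_on {a..b} (\<lambda>t. integral {a..t} (\<lambda>w. ?g w i))"
      using v[of b i] ab by (intro indefinite_integral_continuous_1) (auto simp: integrable_on_def)
    then have "continuous_on {a..b} (\<lambda>t. integral {a..t} (\<lambda>w. ?g w i) + v a i)"
      by (intro continuous_intros)
    then show ?thesis by (rule continuous_on_eq) (simp add: int)
  qed
  have contg: "continuous_on {a..b} (\<lambda>w. ?g w i)" for i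
    by (intro continuous_intros cont)
  have der: "((\<lambda>t. v t i) has_real_derivative ?g t i) (at t within {a..b})" if t: "t \<in> {a..b}" for t i
  proof -
    have "((\<lambda>t. integral {a..t} (\<lambda>w. ?g w i)) has_vector_derivative ?g t i) (at t within {a..b})"
      by (rule integral_has_vector_derivative[OF contg t])
    then have "((\<lambda>t. integral {a..t} (\<lambda>w. ?g w i) + v a i) has_real_derivative ?g t i + 0) (at t within {a..b})"
      by (intro DERIV_add DERIV_const) (simp add: has_real_derivative_iff_has_vector_derivative)
    then have "((\<lambda>t. integral {a..t} (\<lambda>w. ?g w i) + v a i) has_real_derivative ?g t i) (at t within {a..b})"
      by simp
    then show ?thesis
      by (rule has_field_derivative_transform_within[OF _ zero_less_one t]) (simp add: int)
  qed
  let ?z = "\<lambda>w. \<Sum>i\<in>UNIV. v w i * ?E w $ i $ j"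
  have derE: "((\<lambda>w. ?E w $ i $ j) has_real_derivative - (A ** ?E w) $ i $ j) (at w within {a..b})" for i w
  proof -
    have "((\<lambda>w. b - w) has_real_derivative -1) (at w within {a..b})"
      by (auto intro!: derivative_eq_intros)
    from DERIV_chain2[OF mat_exp_DERIV this, of A i j] show ?thesis by simp
  qed
  have "(?z has_real_derivative (\<Sum>i\<in>UNIV. ?g w i * ?E w $ i $ j - v w i * (A ** ?E w) $ i $ j)) (at w within {a..b})"
    if "w \<in> {a..b}" for w
    by (rule derivative_eq_intros refl der[OF that] derE)+ (simp add: algebra_simps)
  moreover have "(\<Sum>i\<in>UNIV. ?g w i * ?E w $ i $ j - v w i * (A ** ?E w) $ i $ j) = 0" for w
  proof -
    have "(\<Sum>i\<in>UNIV. ?g w i * ?E w $ i $ j) = (\<Sum>i\<in>UNIV. \<Sum>k\<in>UNIV. v w k * A $ k $ i * ?E w $ i $ j)"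
      by (simp add: sum_distrib_right)
    also have "\<dots> = (\<Sum>k\<in>UNIV. \<Sum>i\<in>UNIV. v w k * A $ k $ i * ?E w $ i $ j)" by (rule sum.swap)
    also have "\<dots> = (\<Sum>k\<in>UNIV. v w k * (A ** ?E w) $ k $ j)"
      by (simp add: matrix_matrix_mult_def sum_distrib_left mult_ac)
    finally show ?thesis by (simp add: sum_subtractf)
  qed
  ultimately have "\<And>w. w \<in> {a..b} \<Longrightarrow> (?z has_real_derivative 0) (at w within {a..b})" by simp
  then obtain c where c: "\<And>w. w \<in> {a..b} \<Longrightarrow> ?z w = c"
    using has_field_derivative_zero_constant[of "{a..b}" ?z] by auto
  have "?z a = ?z b" using c[of a] c[of b] ab by simp
  moreover have "?z b = v b j"
    by (simp add: mat_exp_zero mat_def if_distrib sum.delta cong: if_cong)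
  ultimately show ?thesis by simp
qed

lemma mat_power_nonneg:
  assumes "\<And>i j. 0 \<le> A $ i $ j"
  shows "0 \<le> mat_power A m $ i $ j"
  using assms by (induction m arbitrary: i j) (auto simp: mat_def matrix_matrix_mult_def intro!: sum_nonneg)

text \<open>Adding a large multiple \<open>c\<close> of the identity makes all entries of \<open>A\<close> nonnegative and multiplies the
  exponential by the positive factor \<open>exp (c z)\<close>.\<close>

lemma mat_exp_nonneg:
  fixes A :: "real ^ 'p::finite ^ 'p"
  assumes A: "\<And>i j. i \<noteq> j \<Longrightarrow> 0 \<le> A $ i $ j" and z: "0 \<le> z"
  shows "0 \<le> mat_exp (z *\<^sub>R A) $ i $ j"
proof -
  define c where "c = (\<Sum>i\<in>UNIV. \<bar>A $ i $ i\<bar>)"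
  define B where "B = A + mat c"
  have B: "0 \<le> B $ i $ j" for i j
  proof (cases "i = j")
    case True
    have "\<bar>A $ i $ i\<bar> \<le> c" unfolding c_def by (rule member_le_sum) auto
    then show ?thesis using True by (simp add: B_def mat_def)
  qed (simp add: A B_def mat_def)
  have E: "0 \<le> mat_exp (z *\<^sub>R B) $ i $ j" for i j
    unfolding mat_exp_scaleR_entry
    using z by (intro suminf_nonneg mat_exp_summable mult_nonneg_nonneg divide_nonneg_nonneg
        mat_power_nonneg B) auto
  define v where "v w k = exp (- c * w) * mat_exp (w *\<^sub>R B) $ i $ k" for w k
  have der: "((\<lambda>w. v w k) has_real_derivative (\<Sum>l\<in>UNIV. v w l * A $ l $ k)) (at w within S)" for w k S
  proof -
    have "(B ** mat_exp (w *\<^sub>R B)) $ i $ k = (mat_exp (w *\<^sub>R B) ** A) $ i $ k + c * mat_exp (w *\<^sub>R B) $ i $ k"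
    proof -
      let ?F = "mat_exp (w *\<^sub>R B)"
      have "(?F ** B) $ i $ k = (\<Sum>l\<in>UNIV. ?F $ i $ l * A $ l $ k + (if l = k then ?F $ i $ l * c else 0))"
        by (auto simp: B_def matrix_matrix_mult_def mat_def ring_distribs intro!: sum.cong)
      also have "\<dots> = (\<Sum>l\<in>UNIV. ?F $ i $ l * A $ l $ k) + c * ?F $ i $ k"
        by (simp add: sum.distrib)
      finally show ?thesis by (simp only: mat_exp_commute[of B]) (simp only: matrix_matrix_mult_def vec_lambda_beta)
    qed
    moreover have "((\<lambda>w. v w k) has_real_derivative
        exp (- c * w) * (B ** mat_exp (w *\<^sub>R B)) $ i $ k - c * exp (- c * w) * mat_exp (w *\<^sub>R B) $ i $ k)
        (at w within S)"
      unfolding v_def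
      by (rule derivative_eq_intros refl DERIV_subset[OF mat_exp_DERIV] | simp)+
    ultimately show ?thesis
      by (simp add: v_def matrix_matrix_mult_def sum_distrib_left algebra_simps)
  qed
  have "((\<lambda>w. \<Sum>l\<in>UNIV. v w l * A $ l $ k) has_integral (v t k - v 0 k)) {0..t}"
    if "t \<in> {0..z}" for t k
    using that der
    by (intro fundamental_theorem_of_calculus) (auto simp: has_real_derivative_iff_has_vector_derivative)
  from linear_ode_unique[OF z this, where j = j]
  have "v z j = (\<Sum>k\<in>UNIV. v 0 k * mat_exp (z *\<^sub>R A) $ k $ j)" by simp
  also have "\<dots> = mat_exp (z *\<^sub>R A) $ i $ j"
  proof -
    have "(\<Sum>k\<in>UNIV. v 0 k * mat_exp (z *\<^sub>R A) $ k $ j) =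
        (\<Sum>k\<in>UNIV. if i = k then mat_exp (z *\<^sub>R A) $ k $ j else 0)"
      by (intro sum.cong) (auto simp: v_def mat_exp_zero mat_def)
    then show ?thesis by simp
  qed
  finally have "mat_exp (z *\<^sub>R A) $ i $ j = exp (- c * z) * mat_exp (z *\<^sub>R B) $ i $ j"
    by (simp add: v_def)
  then show ?thesis using E[of i j] by simp
qed

section \<open>Transition matrices on the grid\<close>

locale time_grid =
  fixes K :: nat and s :: "nat \<Rightarrow> ereal"
  assumes grid: "grid K s"
begin

text \<open>This is a grid point for \<open>k < K\<close> only: the infinite point \<open>s K\<close> is mapped to \<open>0\<close>.\<close>

abbreviation pt :: "nat \<Rightarrow> real" where "pt k \<equiv> real_of_ereal (s k)"

lemma s_less: "a < b \<Longrightarrow> b \<le> K \<Longrightarrow> s a < s b"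
  using grid by (auto simp: grid_def strict_mono_on_def)

lemma s_le: "a \<le> b \<Longrightarrow> b \<le> K \<Longrightarrow> s a \<le> s b"
  using s_less[of a b] by (cases "a = b") auto

lemma s_0 [simp]: "s 0 = 0" and s_K [simp]: "s K = \<infinity>"
  using grid by (auto simp: grid_def)

lemma K_pos: "0 < K"
  using s_0 s_K by (cases K) auto

lemma s_pt: "k < K \<Longrightarrow> s k = ereal (pt k)"
proof -
  assume k: "k < K"
  then have "s k < \<infinity>" "0 \<le> s k" using s_less[of k K] s_le[of 0 k] by auto
  then show ?thesis by (cases "s k") auto
qed

lemma s_less_ereal: "k < K \<Longrightarrow> s k < ereal x \<longleftrightarrow> pt k < x"
proof -
  assume "k < K"
  then obtain a where a: "s k = ereal a" using s_pt by blast
  then show ?thesis by simp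
qed

lemma ereal_le_s: "k < K \<Longrightarrow> ereal x \<le> s k \<longleftrightarrow> x \<le> pt k"
  using s_less_ereal[of k x] unfolding not_less[symmetric] by simp

lemma pt_less: "a < b \<Longrightarrow> b < K \<Longrightarrow> pt a < pt b"
proof -
  assume ab: "a < b" "b < K"
  then obtain c where "s b = ereal c" using s_pt by blast
  then show ?thesis using s_less[of a b] s_less_ereal[of a c] ab by simp
qed

lemma pt_nonneg: "k < K \<Longrightarrow> 0 \<le> pt k"
  using s_le[of 0 k] by (simp add: real_of_ereal_pos)

lemma cell_iff: "k \<in> {1..K} \<Longrightarrow> x \<in> cell s k \<longleftrightarrow> pt (k - 1) < x \<and> (k < K \<longrightarrow> x \<le> pt k)"
  using s_less_ereal[of "k - 1" x] ereal_le_s[of k x] unfolding cell_def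
  by (cases "k = K") auto

lemma cell_pos: "k \<in> {1..K} \<Longrightarrow> x \<in> cell s k \<Longrightarrow> 0 < x"
proof -
  assume "k \<in> {1..K}" "x \<in> cell s k"
  then have "pt (k - 1) < x" "k - 1 < K" by (auto simp: cell_iff)
  then show ?thesis using pt_nonneg[of "k - 1"] by linarith
qed

lemma pt_mem_cell: "k \<in> {1..<K} \<Longrightarrow> pt k \<in> cell s k"
  using pt_less[of "k - 1" k] by (auto simp: cell_iff)

lemma cell_mono:
  assumes "k \<in> {1..K}" "l \<in> {1..K}" "x \<in> cell s k" "y \<in> cell s l" "x \<le> y"
  shows "k \<le> l"
proof (rule ccontr)
  assume "\<not> k \<le> l"
  then have "ereal y \<le> s l" "s l \<le> s (k - 1)" "s (k - 1) < ereal x"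
    using assms by (auto simp: cell_def intro!: s_le)
  then have "ereal y < ereal x" by (meson le_less_trans)
  then show False using assms(5) by simp
qed

lemma cell_unique: "k \<in> {1..K} \<Longrightarrow> l \<in> {1..K} \<Longrightarrow> x \<in> cell s k \<Longrightarrow> x \<in> cell s l \<Longrightarrow> k = l"
  using cell_mono[of k l x x] cell_mono[of l k x x] by (meson antisym order_refl)

lemma cell_exists:
  assumes "0 < x" obtains k where "k \<in> {1..K}" "x \<in> cell s k"
proof -
  define k where "k = (LEAST k. ereal x \<le> s k)"
  have le: "ereal x \<le> s k" unfolding k_def by (rule LeastI[of _ K]) simp
  have "k \<le> K" unfolding k_def by (rule Least_le) simp
  moreover have "k \<noteq> 0" proof
    assume "k = 0" then show False using le assms by simp
  qed
  moreover have "s (k - 1) < ereal x"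
    using not_less_Least[of "k - 1" "\<lambda>k. ereal x \<le> s k"] \<open>k \<noteq> 0\<close> by (auto simp: k_def[symmetric])
  ultimately show ?thesis using le by (intro that[of k]) (auto simp: cell_def)
qed

lemma cell_index_eq: "k \<in> {1..K} \<Longrightarrow> x \<in> cell s k \<Longrightarrow> cell_index K s x = k"
proof -
  assume k: "k \<in> {1..K}" "x \<in> cell s k"
  then have "x \<noteq> 0" using cell_pos by blast
  moreover have "(THE k. k \<in> {1..K} \<and> x \<in> cell s k) = k"
    using k cell_unique by (intro the_equality) blast+
  ultimately show ?thesis by (simp only: cell_index_def if_False)
qed

lemma cell_index_0 [simp]: "cell_index K s 0 = 1"
  by (simp add: cell_index_def)

lemma cell_index_mem: "0 \<le> x \<Longrightarrow> cell_index K s x \<in> {1..K}"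
proof (cases "x = 0")
  case False
  assume "0 \<le> x"
  with False obtain k where "k \<in> {1..K}" "x \<in> cell s k" using cell_exists[of x] by auto
  then show ?thesis using cell_index_eq[of k x] by simp
qed (use K_pos in simp)

lemma cell_index_cell: "0 < x \<Longrightarrow> x \<in> cell s (cell_index K s x)"
proof -
  assume "0 < x"
  then obtain k where "k \<in> {1..K}" "x \<in> cell s k" using cell_exists[of x] by auto
  then show ?thesis using cell_index_eq[of k x] by simp
qed

lemma A_prod_last: "k1 \<le> k2 \<Longrightarrow> 0 < k2 \<Longrightarrow>
  A_prod s T k1 k2 = A_prod s T k1 (k2 - 1) ** mat_exp (real_of_ereal (s k2 - s (k2 - 1)) *\<^sub>R T k2)"
proof -
  assume "k1 \<le> k2" "0 < k2"
  then have *: "[k1..<Suc k2] = [k1..<Suc (k2 - 1)] @ [k2]" by simp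
  have "foldr (\<lambda>l B. F l ** B) xs (C ** D) = foldr (\<lambda>l B. F l ** B) xs C ** D"
    for F :: "nat \<Rightarrow> real ^ 'p::finite ^ 'p" and xs C D
    by (induction xs) (simp_all add: matrix_mul_assoc)
  from this[of "\<lambda>l. mat_exp (real_of_ereal (s l - s (l - 1)) *\<^sub>R T l)" "[k1..<Suc (k2 - 1)]" "mat 1"
      "mat_exp (real_of_ereal (s k2 - s (k2 - 1)) *\<^sub>R T k2)"]
  show ?thesis unfolding A_prod_def * by (simp del: upt_Suc)
qed

lemma A_prod_empty: "k2 < k1 \<Longrightarrow> A_prod s T k1 k2 = mat 1"
  by (simp add: A_prod_def)

lemma pt_diff: "k \<in> {1..<K} \<Longrightarrow> real_of_ereal (s k - s (k - 1)) = pt k - pt (k - 1)"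
proof -
  assume "k \<in> {1..<K}"
  then have "k < K" "k - 1 < K" by auto
  then obtain a b where "s k = ereal a" "s (k - 1) = ereal b" using s_pt by blast
  then show ?thesis by simp
qed

text \<open>The left end point of any cell but the first belongs to the preceding cell, so that the case
  distinction in \<open>P_bar\<close> sends it to the product formula; there the first factor and the empty product are the identity.\<close>

lemma P_bar_same_cell:
  assumes "k \<in> {1..K}" "t \<in> cell s k" "pt (k - 1) \<le> u" "u \<le> t"
  shows "P_bar K s T u t = mat_exp ((t - u) *\<^sub>R T k)"
proof -
  have t: "cell_index K s t = k" using assms cell_index_eq by blast
  show ?thesis
  proof (cases "u = pt (k - 1)")
    case False
    then have "u \<in> cell s k" using assms by (auto simp: cell_iff)
    then have "cell_index K s u = k" using assms cell_index_eq by blast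
    then show ?thesis by (simp add: P_bar_def t)
  next
    case u: True
    show ?thesis
    proof (cases "k = 1")
      case True then show ?thesis using u by (simp add: P_bar_def t)
    next
      case False
      then obtain l where l: "k = Suc l" "l \<in> {1..<K}" using assms by (cases k) auto
      have "cell_index K s u = l"
        using pt_mem_cell[OF l(2)] l by (intro cell_index_eq) (auto simp: u)
      then show ?thesis using l u by (simp add: P_bar_def Let_def t A_prod_empty mat_exp_zero)
    qed
  qed
qed

text \<open>This recursion over the cells between \<open>u\<close> and \<open>t\<close> replaces the product formula in the inductions below.\<close>

lemma P_bar_step:
  assumes "k \<in> {1..K}" "t \<in> cell s k" "0 \<le> u" "u < pt (k - 1)"
  shows "P_bar K s T u t = P_bar K s T u (pt (k - 1)) ** mat_exp ((t - pt (k - 1)) *\<^sub>R T k)"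
proof -
  have t: "cell_index K s t = k" using assms cell_index_eq by blast
  have k: "k - 1 \<in> {1..<K}" using assms by (cases "k = 1") auto
  have r: "cell_index K s (pt (k - 1)) = k - 1" using pt_mem_cell[OF k] k by (intro cell_index_eq) auto
  define ku where "ku = cell_index K s u"
  have ku: "1 \<le> ku" "ku \<le> k - 1"
  proof -
    show "1 \<le> ku" using cell_index_mem[OF \<open>0 \<le> u\<close>] by (simp add: ku_def)
    show "ku \<le> k - 1"
    proof (cases "u = 0")
      case False
      then show ?thesis
        unfolding ku_def using assms k cell_index_cell[of u] cell_index_mem[of u] pt_mem_cell[OF k]
        by (intro cell_mono[of _ _ u "pt (k - 1)"]) auto
    qed (use k in \<open>simp add: ku_def\<close>)
  qed
  show ?thesis
  proof (cases "ku = k - 1")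
    case True
    obtain l where l: "k = Suc l" using assms by (cases k) auto
    then show ?thesis using r True by (simp add: P_bar_def Let_def ku_def[symmetric] t A_prod_empty)
  next
    case False
    then have "ku < k - 1" "ku < k" using ku by auto
    moreover have "A_prod s T (ku + 1) (k - 1) =
        A_prod s T (ku + 1) (k - 1 - 1) ** mat_exp ((pt (k - 1) - pt (k - 1 - 1)) *\<^sub>R T (k - 1))"
      using \<open>ku < k - 1\<close> k pt_diff[OF k] by (subst A_prod_last) auto
    moreover obtain l where l: "k = Suc l" using assms by (cases k) auto
    ultimately show ?thesis
      using r by (simp add: P_bar_def Let_def ku_def[symmetric] t matrix_mul_assoc)
  qed
qed

lemma P_bar_refl: "P_bar K s T u u = mat 1"
  by (simp add: P_bar_def mat_exp_zero)

text \<open>The integral equation determines its solution cell after cell, starting from time \<open>u\<close>.\<close>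

lemma forward_equation_unique:
  fixes v :: "real \<Rightarrow> 'p::finite \<Rightarrow> real"
  assumes u: "0 \<le> u" "u \<le> t"
    and T: "\<And>k t. k \<in> {1..K} \<Longrightarrow> t \<in> cell s k \<Longrightarrow> T t = Tk k"
    and v: "\<And>t j. u \<le> t \<Longrightarrow> ((\<lambda>w. \<Sum>k\<in>UNIV. v w k * T w $ k $ j) has_integral (v t j - v u j)) {u..t}"
  shows "v t j = (\<Sum>i\<in>UNIV. v u i * P_bar K s Tk u t $ i $ j)"
proof (cases "t = 0")
  case True
  then have "u = t" using u by simp
  then show ?thesis using u by (simp add: P_bar_refl mat_def if_distrib cong: if_cong)
next
  case False
  have sub: "v t j = (\<Sum>i\<in>UNIV. v r i * mat_exp ((t - r) *\<^sub>R Tk k) $ i $ j)"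
    if k: "k \<in> {1..K}" "t \<in> cell s k" and r: "u \<le> r" "pt (k - 1) \<le> r" "r \<le> t" for k r t j
  proof (rule linear_ode_unique[OF r(3)])
    fix w i assume w: "w \<in> {r..t}"
    let ?g = "\<lambda>x. \<Sum>l\<in>UNIV. v x l * T x $ l $ i"
    have 1: "(?g has_integral (v w i - v u i)) {u..w}" "(?g has_integral (v r i - v u i)) {u..r}"
      using v w r by auto
    have "?g integrable_on {r..w}"
      by (rule integrable_on_subinterval[of _ "{u..w}"]) (use 1 w r in \<open>auto simp: integrable_on_def\<close>)
    then obtain I where I: "(?g has_integral I) {r..w}" by (auto simp: integrable_on_def)
    from has_integral_combine[OF _ _ 1(2) this] w r(1)
    have "(?g has_integral (v r i - v u i + I)) {u..w}" by auto
    with 1(1) have "v w i - v u i = v r i - v u i + I" by (rule has_integral_unique)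
    then have "(?g has_integral (v w i - v r i)) {r..w}" using I by simp
    note int = this
    have eq: "(\<Sum>l\<in>UNIV. v x l * Tk k $ l $ i) = ?g x" if "x \<in> {r..w} - {r}" for x
    proof -
      have "x \<in> cell s k" using that w r k(2) unfolding cell_iff[OF k(1)] by auto
      then show ?thesis using T[OF k(1)] by simp
    qed
    show "((\<lambda>x. \<Sum>l\<in>UNIV. v x l * Tk k $ l $ i) has_integral (v w i - v r i)) {r..w}"
      by (rule has_integral_spike_finite[OF _ _ int, of "{r}"]) (use eq in blast)+
  qed
  have "\<forall>t j. t \<in> cell s k \<longrightarrow> u \<le> t \<longrightarrow> v t j = (\<Sum>i\<in>UNIV. v u i * P_bar K s Tk u t $ i $ j)"
    if "k \<in> {1..K}" for k
    using that
  proof (induction k rule: less_induct)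
    case (less k)
    show ?case
    proof (intro allI impI)
      fix t j assume t: "t \<in> cell s k" "u \<le> t"
      show "v t j = (\<Sum>i\<in>UNIV. v u i * P_bar K s Tk u t $ i $ j)"
      proof (cases "u < pt (k - 1)")
        case False
        then have "pt (k - 1) \<le> u" by simp
        from sub[OF less.prems t(1) order_refl this t(2)] show ?thesis
          by (simp add: P_bar_same_cell[OF less.prems t(1) \<open>pt (k - 1) \<le> u\<close> t(2)])
      next
        case True
        let ?r = "pt (k - 1)"
        have k: "k - 1 \<in> {1..<K}" using less.prems u True by (cases "k = 1") auto
        have IH: "v ?r i = (\<Sum>l\<in>UNIV. v u l * P_bar K s Tk u ?r $ l $ i)" for i
          using less.IH[of "k - 1"] k pt_mem_cell[OF k] True by auto
        have "?r \<le> t" using t less.prems by (auto simp: cell_iff)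
        have "v t j = (\<Sum>i\<in>UNIV. v ?r i * mat_exp ((t - ?r) *\<^sub>R Tk k) $ i $ j)"
          using True \<open>?r \<le> t\<close> by (intro sub less.prems t) auto
        also have "\<dots> = (\<Sum>i\<in>UNIV. \<Sum>l\<in>UNIV. v u l * P_bar K s Tk u ?r $ l $ i * mat_exp ((t - ?r) *\<^sub>R Tk k) $ i $ j)"
          by (simp only: IH sum_distrib_right)
        also have "\<dots> = (\<Sum>l\<in>UNIV. \<Sum>i\<in>UNIV. v u l * P_bar K s Tk u ?r $ l $ i * mat_exp ((t - ?r) *\<^sub>R Tk k) $ i $ j)"
          by (rule sum.swap)
        also have "\<dots> = (\<Sum>l\<in>UNIV. v u l * P_bar K s Tk u t $ l $ j)"
          by (simp only: P_bar_step[OF less.prems t(1) u(1) True] matrix_matrix_mult_def vec_lambda_beta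
              sum_distrib_left mult.assoc)
        finally show ?thesis .
      qed
    qed
  qed
  moreover have "0 < t" using False u by simp
  ultimately show ?thesis using u cell_index_mem[of t] cell_index_cell[of t] by auto
qed

lemma P_bar_nonneg:
  assumes T: "\<And>k. k \<in> {1..K} \<Longrightarrow> sub_intensity_matrix (T k)" and u: "0 \<le> u" "u \<le> t"
  shows "0 \<le> P_bar K s T u t $ i $ j"
proof -
  have exp: "0 \<le> mat_exp (z *\<^sub>R T k) $ i $ j" if "k \<in> {1..K}" "0 \<le> z" for z k i j
    using T[OF that(1)] that(2) by (intro mat_exp_nonneg) (auto simp: sub_intensity_matrix_def)
  have "\<forall>t i j. t \<in> cell s k \<longrightarrow> u \<le> t \<longrightarrow> 0 \<le> P_bar K s T u t $ i $ j" if "k \<in> {1..K}" for k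
    using that
  proof (induction k rule: less_induct)
    case (less k)
    show ?case
    proof (intro allI impI)
      fix t i j assume t: "t \<in> cell s k" "u \<le> t"
      show "0 \<le> P_bar K s T u t $ i $ j"
      proof (cases "u < pt (k - 1)")
        case False
        then have "pt (k - 1) \<le> u" by simp
        then show ?thesis using t less.prems exp by (simp add: P_bar_same_cell[OF less.prems t(1) _ t(2)])
      next
        case True
        have k: "k - 1 \<in> {1..<K}" using less.prems u True by (cases "k = 1") auto
        have "0 \<le> P_bar K s T u (pt (k - 1)) $ i $ l" for l
          using less.IH[of "k - 1"] k pt_mem_cell[OF k] True by auto
        moreover have "pt (k - 1) \<le> t" using t less.prems by (auto simp: cell_iff)
        ultimately show ?thesis
          unfolding P_bar_step[OF less.prems t(1) u(1) True]
          using exp[OF less.prems] by (auto simp: matrix_matrix_mult_def intro!: sum_nonneg)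
      qed
    qed
  qed
  then show ?thesis
    using u cell_index_mem[of t] cell_index_cell[of t]
    by (cases "t = 0") (auto simp: P_bar_refl mat_def)
qed

lemma cell_measurable [measurable]: "cell s k \<in> sets borel"
  unfolding cell_def by measurable

lemma cell_index_measurable [measurable]: "cell_index K s \<in> measurable borel (count_space UNIV)"
proof -
  have neg: "cell_index K s x = cell_index K s (-1)" if "x < 0" for x
  proof -
    have "(\<lambda>k. k \<in> {1..K} \<and> y \<in> cell s k) = (\<lambda>_. False)" if "y < 0" for y
      using cell_pos[of _ y] that by fastforce
    from this[OF that] this[of "-1"] show ?thesis using that by (simp add: cell_index_def del: atLeastAtMost_iff)
  qed
  have "{x. cell_index K s x = n} \<in> sets borel" for n
  proof -
    have pos: "cell_index K s x = n \<longleftrightarrow> n \<in> {1..K} \<and> x \<in> cell s n" if "0 < x" for x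
      using cell_index_eq[of n x] cell_index_mem[of x] cell_index_cell[of x] that by force
    have "{x. cell_index K s x = n} = (if n = 1 then {0} else {}) \<union>
        (if n \<in> {1..K} then cell s n \<inter> {0<..} else {}) \<union> (if n = cell_index K s (-1) then {..<0} else {})"
      (is "?L = ?R")
    proof (rule set_eqI)
      fix x :: real
      consider "x = 0" | "0 < x" | "x < 0" by linarith
      then show "x \<in> ?L \<longleftrightarrow> x \<in> ?R"
      proof cases
        case 1
        have "0 \<notin> cell s n" if "n \<in> {1..K}" using cell_pos[OF that, of 0] by auto
        then show ?thesis using 1 by auto
      next
        case 2
        then show ?thesis using pos[OF 2] by auto
      next
        case 3
        have "x \<notin> cell s n" if "n \<in> {1..K}" using cell_pos[OF that, of x] 3 by auto
        then show ?thesis using neg[OF 3] 3 by auto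
      qed
    qed
    also have "\<dots> \<in> sets borel" by (intro sets.Un) auto
    finally show ?thesis .
  qed
  then show ?thesis by (simp add: measurable_count_space_eq2_countable vimage_def)
qed

lemma mat_mult_entry_measurable:
  assumes "\<And>i j. (\<lambda>x. A x $ i $ j) \<in> borel_measurable M" "\<And>i j. (\<lambda>x. B x $ i $ j) \<in> borel_measurable M"
  shows "(\<lambda>x. (A x ** B x :: real ^ 'p::finite ^ 'p) $ i $ j) \<in> borel_measurable M"
  using assms by (simp add: matrix_matrix_mult_def)

lemma cell_index_measurable2: "f \<in> borel_measurable M \<Longrightarrow> (\<lambda>x. cell_index K s (f x)) \<in> measurable M (count_space UNIV)"
  by (rule measurable_compose[OF _ cell_index_measurable])

lemma P_bar_measurable [measurable (raw)]:
  assumes f: "f \<in> borel_measurable M" and g: "g \<in> borel_measurable M"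
  shows "(\<lambda>x. P_bar K s T (f x) (g x) $ i $ j) \<in> borel_measurable M"
proof -
  let ?F = "\<lambda>a b x. (if a < b then mat_exp ((pt a - f x) *\<^sub>R T a) ** A_prod s T (a + 1) (b - 1) **
      mat_exp ((g x - pt (b - 1)) *\<^sub>R T b) else mat_exp ((g x - f x) *\<^sub>R T b)) $ i $ j"
  have e: "(\<lambda>x. mat_exp (h x *\<^sub>R T a) $ i $ j) \<in> borel_measurable M" if "h \<in> borel_measurable M" for h a i j
    using that by (rule measurable_compose[OF _ mat_exp_entry_measurable])
  have "?F a b \<in> borel_measurable M" for a b
  proof (cases "a < b")
    case True
    have "(\<lambda>x. (mat_exp ((pt a - f x) *\<^sub>R T a) ** A_prod s T (a + 1) (b - 1) **
      mat_exp ((g x - pt (b - 1)) *\<^sub>R T b)) $ i $ j) \<in> borel_measurable M"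
      by (rule mat_mult_entry_measurable mat_mult_entry_measurable e borel_measurable_diff f g borel_measurable_const)+
    then show ?thesis using True by simp
  next
    case False
    have "(\<lambda>x. mat_exp ((g x - f x) *\<^sub>R T b) $ i $ j) \<in> borel_measurable M"
      by (intro e borel_measurable_diff f g)
    then show ?thesis using False by simp
  qed
  then have "(\<lambda>x. ?F (cell_index K s (f x)) b x) \<in> borel_measurable M" for b
    by (rule measurable_compose_countable[where f = "\<lambda>a. ?F a b", OF _ cell_index_measurable2[OF f]])
  then have "(\<lambda>x. ?F (cell_index K s (f x)) (cell_index K s (g x)) x) \<in> borel_measurable M"
    by (rule measurable_compose_countable[where f = "\<lambda>b x. ?F (cell_index K s (f x)) b x",
          OF _ cell_index_measurable2[OF g]])
  then show ?thesis by (simp only: P_bar_def Let_def)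
qed

lemma exit_rates_measurable [measurable (raw)]:
  assumes f: "f \<in> borel_measurable M"
  shows "(\<lambda>x. exit_rates (T (cell_index K s (f x))) $ i) \<in> borel_measurable M"
  by (rule measurable_compose_countable[where f = "\<lambda>k x. exit_rates (T k) $ i",
        OF _ cell_index_measurable2[OF f]]) simp

end

section \<open>Jumps of a path\<close>

text \<open>The relation \<open>R\<close> between the state before and the state after the jump makes the same lemmas
  available for the transitions between two given states and for all jumps, \<open>R = (\<noteq>)\<close>. Counting in
  the extended reals makes the number of jumps monotone in \<open>C\<close>, whereas the cardinality of an
  infinite set is \<open>0\<close>.\<close>

definition jumps :: "(real \<Rightarrow> 's) \<Rightarrow> ('s \<Rightarrow> 's \<Rightarrow> bool) \<Rightarrow> real set \<Rightarrow> real set" where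
  "jumps x R C = {t \<in> C. \<exists>l. eventually (\<lambda>u. x u = l) (at_left t) \<and> R l (x t)}"

definition jump_number :: "(real \<Rightarrow> 's) \<Rightarrow> ('s \<Rightarrow> 's \<Rightarrow> bool) \<Rightarrow> real set \<Rightarrow> ennreal" where
  "jump_number x R C = emeasure (count_space UNIV) (jumps x R C)"

lemma jump_count_conv:
  "real (jump_count x a b C) = enn2real (jump_number x (\<lambda>l y. l = a \<and> y = b) C)"
proof -
  have "jumps x (\<lambda>l y. l = a \<and> y = b) C = {t \<in> C. eventually (\<lambda>u. x u = a) (at_left t) \<and> x t = b}"
    by (auto simp: jumps_def)
  then show ?thesis
    by (simp add: jump_count_def jump_number_def emeasure_count_space)
qed

lemma jumps_mono: "(\<And>l y. R l y \<Longrightarrow> R' l y) \<Longrightarrow> C \<subseteq> C' \<Longrightarrow> jumps x R C \<subseteq> jumps x R' C'"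
  by (auto simp: jumps_def)

lemma jump_path_rightE:
  assumes "jump_path x" "0 \<le> t"
  obtains e where "0 < e" "\<And>u. t \<le> u \<Longrightarrow> u < t + e \<Longrightarrow> x u = x t"
proof -
  have "eventually (\<lambda>u. x u = x t) (at_right t)" using assms by (auto simp: jump_path_def)
  then obtain b where b: "t < b" "\<And>u. t < u \<Longrightarrow> u < b \<Longrightarrow> x u = x t"
    unfolding eventually_at_right_field by auto
  show ?thesis
  proof (rule that[of "b - t"])
    fix u assume "t \<le> u" "u < t + (b - t)"
    then show "x u = x t" using b by (cases "u = t") auto
  qed (use b in simp)
qed

lemma jump_path_leftE:
  assumes "jump_path x" "0 < t"
  obtains e l where "0 < e" "\<And>u. t - e < u \<Longrightarrow> u < t \<Longrightarrow> x u = l"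
proof -
  obtain l where "eventually (\<lambda>u. x u = l) (at_left t)" using assms by (auto simp: jump_path_def)
  then obtain b where b: "b < t" "\<And>u. b < u \<Longrightarrow> u < t \<Longrightarrow> x u = l"
    unfolding eventually_at_left_field by auto
  show ?thesis by (rule that[of "t - b" l]) (use b in auto)
qed

text \<open>Every time has one-sided neighbourhoods on which the path is constant, so jumps do not accumulate.\<close>

lemma finite_jumps:
  assumes x: "jump_path x" and R: "irreflp R" and C: "C \<subseteq> {0<..c}"
  shows "finite (jumps x R C)"
proof (rule ccontr)
  assume inf: "infinite (jumps x R C)"
  have sub: "jumps x R C \<subseteq> {0..c}" using C by (force simp: jumps_def)
  obtain z where z: "z \<in> {0..c}" "z islimpt jumps x R C"
    using Heine_Borel_imp_Bolzano_Weierstrass[OF compact_Icc inf sub] by blast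
  obtain e1 where e1: "0 < e1" "\<And>u. z \<le> u \<Longrightarrow> u < z + e1 \<Longrightarrow> x u = x z"
    using jump_path_rightE[OF x, of z] z by auto
  obtain e2 l where e2: "0 < e2" "\<And>u. 0 < u \<Longrightarrow> z - e2 < u \<Longrightarrow> u < z \<Longrightarrow> x u = l"
  proof (cases "0 < z")
    case True then show ?thesis using jump_path_leftE[OF x True] that by metis
  next
    case False then show ?thesis using that[of 1] by auto
  qed
  obtain t where t: "t \<in> jumps x R C" "t \<noteq> z" "\<bar>t - z\<bar> < min e1 e2"
    using z(2) e1(1) e2(1) unfolding islimpt_approachable
    by (metis dist_real_def min_less_iff_conj)
  obtain l' where l': "eventually (\<lambda>u. x u = l') (at_left t)" "R l' (x t)"
    using t(1) by (auto simp: jumps_def)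
  have "0 < t" using t(1) C by (auto simp: jumps_def)
  have "eventually (\<lambda>u. x u = x t) (at_left t)"
  proof (cases "z < t")
    case True
    have "x u = x t" if "z < u" "u < t" for u using that e1(2)[of u] e1(2)[of t] t(3) by auto
    then show ?thesis using True unfolding eventually_at_left_field by blast
  next
    case False
    have "x u = x t" if "max 0 (z - e2) < u" "u < t" for u
      using that e2(2)[of u] e2(2)[of t] t(2,3) False \<open>0 < t\<close> by auto
    moreover have "max 0 (z - e2) < t" using t(3) \<open>0 < t\<close> by auto
    ultimately show ?thesis unfolding eventually_at_left_field by blast
  qed
  with l'(1) have "eventually (\<lambda>u. l' = x t) (at_left t)" by eventually_elim auto
  then have "l' = x t" by simp
  then show False using l'(2) R by (auto dest: irreflpD)
qed

text \<open>Without jumps the path is locally constant on an interval, and intervals are connected.\<close>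

lemma const_if_no_jumps:
  assumes x: "jump_path x" and uv: "0 \<le> u" "u \<le> v" and J: "jumps x (\<noteq>) {u<..v} = {}"
  shows "x v = x u"
proof (rule connected_local_const[of "{u..v}" v u x])
  show "\<forall>w\<in>{u..v}. eventually (\<lambda>b. x w = x b) (at w within {u..v})"
  proof
    fix w assume w: "w \<in> {u..v}"
    have r: "eventually (\<lambda>b. x w = x b) (at_right w)"
    proof -
      have "eventually (\<lambda>b. x b = x w) (at_right w)" using x w uv by (auto simp: jump_path_def)
      then show ?thesis by eventually_elim simp
    qed
    show "eventually (\<lambda>b. x w = x b) (at w within {u..v})"
    proof (cases "w = u")
      case True
      show ?thesis using r unfolding eventually_at_filter by eventually_elim (auto simp: True)
    next
      case False
      have "0 < w" using w uv False by auto
      then obtain l where l: "eventually (\<lambda>b. x b = l) (at_left w)"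
        using x unfolding jump_path_def by blast
      have "w \<in> {u<..v}" using w False by auto
      then have "l = x w" using J l by (auto simp: jumps_def)
      then have "eventually (\<lambda>b. x w = x b) (at_left w)" using l by (auto elim: eventually_mono)
      then have "eventually (\<lambda>b. x w = x b) (at w)" using r by (simp add: eventually_at_split)
      then show ?thesis by (rule filter_leD[OF at_le, rotated]) simp
    qed
  qed
qed (use uv in auto)

lemma finite_separated:
  fixes S :: "real set"
  assumes "finite S"
  obtains d where "0 < d" "\<And>p q. p \<in> S \<Longrightarrow> q \<in> S \<Longrightarrow> p \<noteq> q \<Longrightarrow> d \<le> \<bar>p - q\<bar>"
proof -
  let ?D = "insert 1 ((\<lambda>(p, q). \<bar>p - q\<bar>) ` {(p, q). p \<in> S \<and> q \<in> S \<and> p \<noteq> q})"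
  have "finite {(p, q). p \<in> S \<and> q \<in> S \<and> p \<noteq> q}"
    by (rule finite_subset[of _ "S \<times> S"]) (use assms in auto)
  then have f: "finite ?D" by simp
  show ?thesis
  proof (rule that[of "Min ?D"])
    show "0 < Min ?D" using f by (subst Min_gr_iff) auto
    show "Min ?D \<le> \<bar>p - q\<bar>" if "p \<in> S" "q \<in> S" "p \<noteq> q" for p q
      using f that by (intro Min_le) (auto simp: image_iff)
  qed
qed

text \<open>Once \<open>h\<close> is smaller than all distances between jumps, the window \<open>(u, u + h]\<close> contains at most
  one jump, and the windows containing a given jump at \<open>r\<close> start in \<open>[r - h, r)\<close>.\<close>

lemma increment_times_eq:
  assumes x: "jump_path x" and R: "irreflp R" and ac: "0 \<le> a" "a \<le> c"
  shows "\<exists>d>0. \<forall>h. 0 < h \<and> h < d \<longrightarrow>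
     {u \<in> {a<..c}. R (x u) (x (u + h))} = (\<Union>r\<in>jumps x R {a<..c}. {r - h..<r}) \<and>
     disjoint_family_on (\<lambda>r. {r - h..<r}) (jumps x R {a<..c})"
proof -
  let ?F = "jumps x (\<noteq>) {0<..c + 1}"
  have irr: "\<not> R a a" for a using R by (auto dest: irreflpD)
  have fin: "finite ({a, c} \<union> ?F)"
    using finite_jumps[OF x, of "(\<noteq>)" "{0<..c + 1}"] by (auto intro: irreflpI)
  obtain d where d: "0 < d" "\<And>p q. p \<in> {a, c} \<union> ?F \<Longrightarrow> q \<in> {a, c} \<union> ?F \<Longrightarrow> p \<noteq> q \<Longrightarrow> d \<le> \<bar>p - q\<bar>"
    using finite_separated[OF fin] by metis
  show ?thesis
  proof (intro exI[of _ "min d 1"] conjI allI impI; (elim conjE)?)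
    show "0 < min d 1" using d(1) by simp
  next
    fix h :: real assume h: "0 < h" "h < min d 1"
    have F: "p = q" if "p \<in> {a, c} \<union> ?F" "q \<in> {a, c} \<union> ?F" "\<bar>p - q\<bar> \<le> h" for p q
      using d(2)[OF that(1,2)] that(3) h by force
    have JF: "r \<in> ?F" if "r \<in> jumps x R {a<..c}" for r
      using that ac irr by (force simp: jumps_def)
    have const: "x w = x u" "x (u + h) = x r" if "r \<in> ?F" "a < u" "u \<le> w" "w < r" "r \<le> u + h" "u \<le> c" for u w r
    proof -
      have *: "q \<notin> jumps x (\<noteq>) S" if "q \<noteq> r" "u < q" "q \<le> u + h" for q S
      proof
        assume "q \<in> jumps x (\<noteq>) S"
        then have "q \<in> ?F" using that \<open>a < u\<close> \<open>u \<le> c\<close> ac h by (auto simp: jumps_def)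
        moreover have "\<bar>q - r\<bar> \<le> h" using that \<open>w < r\<close> \<open>u \<le> w\<close> \<open>r \<le> u + h\<close> by linarith
        ultimately show False using F[of q r] \<open>r \<in> ?F\<close> \<open>q \<noteq> r\<close> by blast
      qed
      have "q \<notin> jumps x (\<noteq>) {u<..w}" for q using *[of q "{u<..w}"] that by (auto simp: jumps_def)
      then show "x w = x u" using that ac by (intro const_if_no_jumps[OF x]) auto
      have "q \<notin> jumps x (\<noteq>) {r<..u + h}" for q using *[of q "{r<..u + h}"] that by (auto simp: jumps_def)
      then show "x (u + h) = x r" using that ac by (intro const_if_no_jumps[OF x]) auto
    qed
    have "u \<in> (\<Union>r\<in>jumps x R {a<..c}. {r - h..<r})" if u: "u \<in> {a<..c}" "R (x u) (x (u + h))" for u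
    proof -
      have "x (u + h) \<noteq> x u" using u irr by metis
      then have "jumps x (\<noteq>) {u<..u + h} \<noteq> {}"
        using const_if_no_jumps[OF x, of u "u + h"] u ac h by auto
      then obtain r where r: "r \<in> jumps x (\<noteq>) {u<..u + h}" by auto
      then have ur: "u < r" "r \<le> u + h" by (auto simp: jumps_def)
      have rF: "r \<in> ?F" using r u ac h by (auto simp: jumps_def)
      have "r \<le> c" using F[of r c] rF ur u by force
      have "x w = x u" if "u < w" "w < r" for w using const(1)[OF rF _ _ that(2) ur(2)] that u by auto
      then have "eventually (\<lambda>w. x w = x u) (at_left r)"
        using ur unfolding eventually_at_left_field by blast
      moreover have "x (u + h) = x r" using const(2)[OF rF, of u u] ur u by auto
      ultimately have "r \<in> jumps x R {a<..c}" using u ur \<open>r \<le> c\<close> by (auto simp: jumps_def)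
      moreover have "u \<in> {r - h..<r}" using ur by auto
      ultimately show ?thesis by blast
    qed
    moreover have "u \<in> {a<..c} \<and> R (x u) (x (u + h))"
      if r: "r \<in> jumps x R {a<..c}" and u: "r - h \<le> u" "u < r" for u r
    proof -
      have rac: "a < r" "r \<le> c" using r by (auto simp: jumps_def)
      have "a < u" using F[of r a] JF[OF r] rac u by force
      have uc: "u \<le> c" using u rac by auto
      obtain l where l: "eventually (\<lambda>w. x w = l) (at_left r)" "R l (x r)" using r by (auto simp: jumps_def)
      obtain b where b: "b < r" "\<And>w. b < w \<Longrightarrow> w < r \<Longrightarrow> x w = l"
        using l(1) unfolding eventually_at_left_field by auto
      obtain w where w: "max b u < w" "w < r" using b(1) u(2) dense[of "max b u" r] by auto
      have "x w = x u" "x (u + h) = x r"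
        using const[OF JF[OF r] \<open>a < u\<close> _ w(2) _ uc] w u by auto
      then show ?thesis using b(2)[of w] w l(2) \<open>a < u\<close> uc by auto
    qed
    ultimately show "{u \<in> {a<..c}. R (x u) (x (u + h))} = (\<Union>r\<in>jumps x R {a<..c}. {r - h..<r})"
      by (intro set_eqI iffI) (force, fastforce)
    show "disjoint_family_on (\<lambda>r. {r - h..<r}) (jumps x R {a<..c})"
      unfolding disjoint_family_on_def
    proof (intro ballI impI)
      fix p q assume pq: "p \<in> jumps x R {a<..c}" "q \<in> jumps x R {a<..c}" "p \<noteq> q"
      then have "h < \<bar>p - q\<bar>" using F[of p q] JF by force
      then show "{p - h..<p} \<inter> {q - h..<q} = {}" by auto
    qed
  qed
qed

text \<open>A difference quotient with step \<open>1 / Suc m\<close> that eventually equals the number of jumps in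
  \<open>(a, c]\<close> but, unlike the latter, involves the path at pairs of fixed times only.\<close>

definition increment_rate :: "(real \<Rightarrow> 's) \<Rightarrow> ('s \<Rightarrow> 's \<Rightarrow> bool) \<Rightarrow> real \<Rightarrow> real \<Rightarrow> nat \<Rightarrow> ennreal" where
  "increment_rate x R a c m =
     of_nat (Suc m) * emeasure lborel {u \<in> {a<..c}. R (x u) (x (u + 1 / Suc m))}"

lemma increment_rate_eventually:
  assumes x: "jump_path x" and R: "irreflp R" and ac: "0 \<le> a" "a \<le> c"
  shows "eventually (\<lambda>m. increment_rate x R a c m = jump_number x R {a<..c}) sequentially"
proof -
  from increment_times_eq[where R = R, OF x R ac]
  obtain d where d: "0 < d" "\<And>h. 0 < h \<and> h < d \<longrightarrow>
     {u \<in> {a<..c}. R (x u) (x (u + h))} = (\<Union>r\<in>jumps x R {a<..c}. {r - h..<r}) \<and>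
     disjoint_family_on (\<lambda>r. {r - h..<r}) (jumps x R {a<..c})"
    by (elim exE conjE) blast
  have fin: "finite (jumps x R {a<..c})"
    by (rule finite_jumps[where R = R, OF x R, of _ c]) (use ac in auto)
  have "eventually (\<lambda>m. 1 / real (Suc m) < d) sequentially"
    using LIMSEQ_inverse_real_of_nat d(1) by (simp add: order_tendstoD(2) inverse_eq_divide)
  then show ?thesis
  proof eventually_elim
    fix m assume m: "1 / real (Suc m) < d"
    define h where "h = 1 / real (Suc m)"
    have hd: "h < d" "0 < h" using m by (auto simp: h_def)
    have "emeasure lborel {u \<in> {a<..c}. R (x u) (x (u + h))} = (\<Sum>r\<in>jumps x R {a<..c}. emeasure lborel {r - h..<r})"
      using d(2)[rule_format, OF conjI[OF hd(2,1)]] fin by (simp add: sum_emeasure image_subset_iff)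
    also have "\<dots> = of_nat (card (jumps x R {a<..c})) * ennreal h" using hd by simp
    finally have "increment_rate x R a c m =
        of_nat (card (jumps x R {a<..c})) * (of_nat (Suc m) * ennreal h)"
      by (simp only: increment_rate_def h_def[symmetric] mult_ac)
    also have "of_nat (Suc m) * ennreal h = 1"
      by (simp add: h_def ennreal_of_nat_eq_real_of_nat ennreal_mult[symmetric] del: of_nat_Suc)
    finally show "increment_rate x R a c m = jump_number x R {a<..c}"
      using fin by (simp add: jump_number_def emeasure_count_space)
  qed
qed

text \<open>Every time counted by the difference quotient is at distance at most \<open>1\<close> before some jump. The bound
  is uniform in the step, as required for dominated convergence.\<close>

lemma increment_rate_le:
  assumes x: "jump_path x" and R: "irreflp R" and ac: "0 \<le> a" "a \<le> c"
  shows "increment_rate x R a c m \<le> jump_number x (\<noteq>) {a<..c + 1}"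
proof -
  let ?J = "jumps x (\<noteq>) {a<..c + 1}"
  define h where "h = 1 / real (Suc m)"
  have h: "0 < h" "h \<le> 1" by (auto simp: h_def)
  have fin: "finite ?J"
    by (rule finite_jumps[OF x, of _ _ "c + 1"]) (use ac in \<open>auto intro: irreflpI\<close>)
  have "{u \<in> {a<..c}. R (x u) (x (u + h))} \<subseteq> (\<Union>r\<in>?J. {r - h..<r})"
  proof
    fix u assume u: "u \<in> {u \<in> {a<..c}. R (x u) (x (u + h))}"
    then have "x (u + h) \<noteq> x u" using irreflpD[OF R, of "x u"] by auto
    then have "jumps x (\<noteq>) {u<..u + h} \<noteq> {}"
      using const_if_no_jumps[OF x, of u "u + h"] u ac h by auto
    then obtain r where "r \<in> jumps x (\<noteq>) {u<..u + h}" by auto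
    moreover have "a < u" "u + h \<le> c + 1" using u h(2) by auto
    ultimately have "r \<in> ?J" "u \<in> {r - h..<r}" unfolding jumps_def by auto
    then show "u \<in> (\<Union>r\<in>?J. {r - h..<r})" by blast
  qed
  then have "emeasure lborel {u \<in> {a<..c}. R (x u) (x (u + h))} \<le> emeasure lborel (\<Union>r\<in>?J. {r - h..<r})"
    using fin by (intro emeasure_mono) auto
  also have "\<dots> \<le> (\<Sum>r\<in>?J. emeasure lborel {r - h..<r})"
    using fin by (intro emeasure_subadditive_finite) auto
  also have "\<dots> = of_nat (card ?J) * ennreal h" using h by simp
  finally have "increment_rate x R a c m \<le> of_nat (Suc m) * (of_nat (card ?J) * ennreal h)"
    unfolding increment_rate_def h_def[symmetric] by (rule mult_left_mono) simp
  also have "\<dots> = of_nat (card ?J) * (of_nat (Suc m) * ennreal h)" by (simp only: mult_ac)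
  also have "of_nat (Suc m) * ennreal h = 1"
    by (simp add: h_def ennreal_of_nat_eq_real_of_nat ennreal_mult[symmetric] del: of_nat_Suc)
  finally show ?thesis using fin by (simp add: jump_number_def emeasure_count_space)
qed

lemma jump_number_SUP:
  assumes "incseq C" "(\<Union>n::nat. C n) = D"
  shows "jump_number x R D = (SUP n. jump_number x R (C n))"
proof -
  have "jumps x R D = (\<Union>n. jumps x R (C n))" using assms(2) by (auto simp: jumps_def)
  moreover have "incseq (\<lambda>n. jumps x R (C n))"
    using assms(1) by (fastforce simp: incseq_def jumps_def)
  ultimately show ?thesis unfolding jump_number_def by (simp add: SUP_emeasure_incseq)
qed

section \<open>Measurability of path functionals\<close>

locale path_process =
  fixes F :: "'w measure" and X :: "real \<Rightarrow> 'w \<Rightarrow> 's::finite"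
  assumes X_measurable: "0 \<le> t \<Longrightarrow> X t \<in> measurable F (count_space UNIV)"
    and X_path: "\<omega> \<in> space F \<Longrightarrow> jump_path (\<lambda>t. X t \<omega>)"
begin

text \<open>By right-continuity, the state at time \<open>t\<close> is the eventual state along the times
  \<open>(\<lfloor>t m\<rfloor> + 1) / m\<close>, and each of these takes only countably many values.\<close>

lemma X_random_time_measurable:
  assumes f: "f \<in> borel_measurable N" and g: "g \<in> measurable N F"
    and pos: "\<And>z. z \<in> space N \<Longrightarrow> 0 \<le> f z"
  shows "(\<lambda>z. X (f z) (g z)) \<in> measurable N (count_space UNIV)"
proof -
  define t where "t m z = (real (nat \<lfloor>f z * real (Suc m)\<rfloor>) + 1) / real (Suc m)" for m z
  have meas: "(\<lambda>z. X (t m z) (g z)) \<in> measurable N (count_space UNIV)" for m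
  proof -
    have "(\<lambda>z. X ((real (n::nat) + 1) / real (Suc m)) (g z)) \<in> measurable N (count_space UNIV)" for n
      by (rule measurable_compose[OF g X_measurable]) simp
    moreover have "(\<lambda>z. nat \<lfloor>f z * real (Suc m)\<rfloor>) \<in> measurable N (count_space UNIV)"
      using f by measurable
    ultimately show ?thesis unfolding t_def
      by (rule measurable_compose_countable[where f = "\<lambda>n z. X ((real n + 1) / real (Suc m)) (g z)"])
  qed
  have lim: "eventually (\<lambda>m. X (t m z) (g z) = X (f z) (g z)) sequentially" if z: "z \<in> space N" for z
  proof -
    have "g z \<in> space F" using measurable_space[OF g z] .
    then obtain e where e: "0 < e" "\<And>u. f z \<le> u \<Longrightarrow> u < f z + e \<Longrightarrow> X u (g z) = X (f z) (g z)"
      using jump_path_rightE[OF X_path pos[OF z]] by metis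
    have "eventually (\<lambda>m. 1 / real (Suc m) < e) sequentially"
      using LIMSEQ_inverse_real_of_nat e(1) by (simp add: order_tendstoD(2) inverse_eq_divide)
    then show ?thesis
    proof eventually_elim
      fix m assume m: "1 / real (Suc m) < e"
      define S n where "S = real (Suc m)" and "n = real (nat \<lfloor>f z * S\<rfloor>)"
      have S: "0 < S" by (simp add: S_def)
      then have "n = of_int \<lfloor>f z * S\<rfloor>" using pos[OF z] by (simp add: n_def)
      then have n: "f z * S < n + 1" "n + 1 \<le> f z * S + 1" by linarith+
      have "f z < (n + 1) / S" using n(1) S by (simp only: pos_less_divide_eq)
      moreover have "(n + 1) / S \<le> (f z * S + 1) / S" using n(2) S by (intro divide_right_mono) auto
      moreover have "(f z * S + 1) / S = f z + 1 / S" using S by (simp add: add_divide_distrib)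
      moreover have "(n + 1) / S = t m z" by (simp only: t_def n_def S_def)
      moreover have "1 / S < e" using m by (simp only: S_def)
      ultimately show "X (t m z) (g z) = X (f z) (g z)" using e(2)[of "t m z"] by linarith
    qed
  qed
  have "(\<lambda>z. X (f z) (g z)) -` {a} \<inter> space N \<in> sets N" for a
  proof -
    have "X (f z) (g z) = a \<longleftrightarrow> eventually (\<lambda>m. X (t m z) (g z) = a) sequentially" if z: "z \<in> space N" for z
    proof
      assume "X (f z) (g z) = a"
      then show "eventually (\<lambda>m. X (t m z) (g z) = a) sequentially" using lim[OF z] by simp
    next
      assume "eventually (\<lambda>m. X (t m z) (g z) = a) sequentially"
      with lim[OF z] have "eventually (\<lambda>m::nat. X (f z) (g z) = a) sequentially" by eventually_elim simp
      then show "X (f z) (g z) = a" by simp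
    qed
    then have "(\<lambda>z. X (f z) (g z)) -` {a} \<inter> space N =
        {z \<in> space N. eventually (\<lambda>m. X (t m z) (g z) = a) sequentially}" by auto
    also have "\<dots> \<in> sets N"
    proof (rule sets_Collect_eventually_sequentially)
      fix m
      have "{z \<in> space N. X (t m z) (g z) = a} = (\<lambda>z. X (t m z) (g z)) -` {a} \<inter> space N" by auto
      then show "{z \<in> space N. X (t m z) (g z) = a} \<in> sets N" using measurable_sets[OF meas[of m], of "{a}"] by simp
    qed
    finally show ?thesis .
  qed
  then show ?thesis by (subst measurable_count_space_eq2) auto
qed

lemma X_pair_measurable:
  assumes "f \<in> borel_measurable borel" "\<And>u. 0 \<le> f u"
  shows "(\<lambda>(\<omega>, u). X (f u) \<omega>) \<in> measurable (F \<Otimes>\<^sub>M lborel) (count_space UNIV)"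
  using X_random_time_measurable[of "\<lambda>z. f (snd z)" "F \<Otimes>\<^sub>M lborel" fst] assms
  by (simp add: case_prod_beta')

lemma increment_event_measurable:
  assumes h: "0 \<le> h"
  shows "(\<lambda>(\<omega>, u). indicator {a<..c} u * (of_bool (R (X (max 0 u) \<omega>) (X (max 0 u + h) \<omega>)) :: ennreal))
    \<in> borel_measurable (F \<Otimes>\<^sub>M lborel)"
proof -
  have 1: "(\<lambda>z. X (max 0 (snd z)) (fst z)) \<in> measurable (F \<Otimes>\<^sub>M lborel) (count_space UNIV)"
    using X_pair_measurable[of "\<lambda>u. max 0 u"] by (simp add: case_prod_beta')
  have 2: "(\<lambda>z. X (max 0 (snd z) + h) (fst z)) \<in> measurable (F \<Otimes>\<^sub>M lborel) (count_space UNIV)"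
    using X_pair_measurable[of "\<lambda>u. max 0 u + h"] h by (simp add: case_prod_beta')
  have "(\<lambda>z. (of_bool (R p (X (max 0 (snd z) + h) (fst z))) :: ennreal)) \<in> borel_measurable (F \<Otimes>\<^sub>M lborel)" for p
    by (rule measurable_compose[OF 2]) simp
  from measurable_compose_countable[OF this 1]
  have "(\<lambda>z. (of_bool (R (X (max 0 (snd z)) (fst z)) (X (max 0 (snd z) + h) (fst z))) :: ennreal))
      \<in> borel_measurable (F \<Otimes>\<^sub>M lborel)" .
  then show ?thesis by (simp add: case_prod_beta')
qed

lemma emeasure_increment_times:
  assumes "\<omega> \<in> space F" "0 \<le> a" "0 \<le> h"
  shows "emeasure lborel {u \<in> {a<..c}. R (X u \<omega>) (X (u + h) \<omega>)} =
    (\<integral>\<^sup>+u. indicator {a<..c} u * of_bool (R (X (max 0 u) \<omega>) (X (max 0 u + h) \<omega>)) \<partial>lborel)"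
    (is "emeasure _ ?A = _")
proof -
  have eq: "indicator {a<..c} u * of_bool (R (X (max 0 u) \<omega>) (X (max 0 u + h) \<omega>)) = (indicator ?A u :: ennreal)" for u
    using assms(2) by (auto simp: indicator_def)
  have "(\<lambda>u. indicator {a<..c} u * (of_bool (R (X (max 0 u) \<omega>) (X (max 0 u + h) \<omega>)) :: ennreal)) \<in> borel_measurable lborel"
    using measurable_Pair2[OF increment_event_measurable[OF assms(3)] assms(1), of a c R] by simp
  then have "(indicator ?A :: real \<Rightarrow> ennreal) \<in> borel_measurable lborel" unfolding eq .
  then have "?A \<in> sets lborel" by (simp add: borel_measurable_indicator_iff)
  then show ?thesis unfolding eq by (simp add: nn_integral_indicator)
qed

lemma increment_rate_measurable:
  assumes "0 \<le> a"
  shows "(\<lambda>\<omega>. increment_rate (\<lambda>t. X t \<omega>) R a c m) \<in> borel_measurable F"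
proof -
  have "(\<lambda>\<omega>. of_nat (Suc m) * (\<integral>\<^sup>+u. indicator {a<..c} u * of_bool (R (X (max 0 u) \<omega>) (X (max 0 u + 1 / Suc m) \<omega>)) \<partial>lborel))
      \<in> borel_measurable F"
    using lborel.borel_measurable_nn_integral[OF increment_event_measurable[of "1 / Suc m" a c R]]
    by simp
  then show ?thesis
  proof (rule subst[OF measurable_cong, rotated])
    fix \<omega> assume "\<omega> \<in> space F"
    from emeasure_increment_times[OF this assms, of "1 / Suc m" c R]
    show "of_nat (Suc m) * (\<integral>\<^sup>+u. indicator {a<..c} u * of_bool (R (X (max 0 u) \<omega>) (X (max 0 u + 1 / Suc m) \<omega>)) \<partial>lborel)
        = increment_rate (\<lambda>t. X t \<omega>) R a c m"
      unfolding increment_rate_def by (simp del: of_nat_Suc)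
  qed
qed

lemma jump_number_measurable:
  assumes R: "irreflp R" and ac: "0 \<le> a" "a \<le> c"
  shows "(\<lambda>\<omega>. jump_number (\<lambda>t. X t \<omega>) R {a<..c}) \<in> borel_measurable F"
proof -
  have "(\<lambda>\<omega>. liminf (\<lambda>m. increment_rate (\<lambda>t. X t \<omega>) R a c m)) \<in> borel_measurable F"
    by (intro borel_measurable_liminf increment_rate_measurable ac)
  then show ?thesis
  proof (rule subst[OF measurable_cong, rotated])
    fix \<omega> assume "\<omega> \<in> space F"
    then have "(\<lambda>m. increment_rate (\<lambda>t. X t \<omega>) R a c m) \<longlonglongrightarrow> jump_number (\<lambda>t. X t \<omega>) R {a<..c}"
      by (intro tendsto_eventually increment_rate_eventually X_path R ac)
    then show "liminf (\<lambda>m. increment_rate (\<lambda>t. X t \<omega>) R a c m) = jump_number (\<lambda>t. X t \<omega>) R {a<..c}"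
      by (rule lim_imp_Liminf[OF trivial_limit_sequentially])
  qed
qed

lemma sojourn_time_measurable:
  assumes S: "S \<in> sets borel" "S \<subseteq> {0..}"
  shows "(\<lambda>\<omega>. sojourn_time (\<lambda>t. X t \<omega>) a S) \<in> borel_measurable F"
proof -
  have "(\<lambda>(\<omega>, u). X (max 0 u) \<omega>) \<in> measurable (F \<Otimes>\<^sub>M lborel) (count_space UNIV)"
    by (rule X_pair_measurable) auto
  from measurable_compose[OF this, of "\<lambda>b. of_bool (b = a) :: real" borel]
  have [measurable]: "(\<lambda>z. of_bool (X (max 0 (snd z)) (fst z) = a) :: real) \<in> borel_measurable (F \<Otimes>\<^sub>M lborel)"
    by (simp add: case_prod_beta')
  have "(\<lambda>\<omega>. LINT u|lborel. indicator S u * of_bool (X (max 0 u) \<omega> = a) :: real) \<in> borel_measurable F"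
  proof -
    have "(\<lambda>z. indicator S (snd z) * of_bool (X (max 0 (snd z)) (fst z) = a) :: real) \<in> borel_measurable (F \<Otimes>\<^sub>M lborel)"
      using S(1) by measurable
    then show ?thesis
      using lborel.borel_measurable_lebesgue_integral[of "\<lambda>\<omega> u. indicator S u * of_bool (X (max 0 u) \<omega> = a) :: real" F]
      by (simp add: case_prod_beta')
  qed
  moreover have "indicator S u * of_bool (X (max 0 u) \<omega> = a) = (indicator S u *\<^sub>R of_bool (X u \<omega> = a) :: real)" for u \<omega>
    using S(2) by (auto simp: indicator_def max_def)
  ultimately show ?thesis by (simp add: sojourn_time_def set_lebesgue_integral_def)
qed

end

section \<open>Expected numbers of jumps\<close>

text \<open>The transition function \<open>P\<close> is a parameter because a Markov jump process only asserts the existence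
  of one. Piecewise constant rates on finitely many cells are bounded.\<close>

locale markov_rates = prob_space M + path_process M X
  for M :: "'w measure" and X :: "real \<Rightarrow> 'w \<Rightarrow> 's::finite" +
  fixes \<Lambda> :: "real \<Rightarrow> real ^ 's ^ 's" and P :: "real \<Rightarrow> real \<Rightarrow> real ^ 's ^ 's" and L :: real
  assumes forward: "forward_solution \<Lambda> P"
    and markov: "\<And>s t F y b. 0 \<le> s \<Longrightarrow> s \<le> t \<Longrightarrow> finite F \<Longrightarrow> F \<subseteq> {0..<s} \<Longrightarrow>
      0 < \<P>(\<omega> in M. \<forall>r\<in>insert s F. X r \<omega> = y r) \<Longrightarrow>
      \<P>(\<omega> in M. X t \<omega> = b \<bar> \<forall>r\<in>insert s F. X r \<omega> = y r) = P s t $ y s $ b"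
    and rate_bound: "\<And>t a b. 0 \<le> t \<Longrightarrow> \<bar>\<Lambda> t $ a $ b\<bar> \<le> L"
begin

definition occ :: "'s \<Rightarrow> real \<Rightarrow> real" where
  "occ a u = \<P>(\<omega> in M. X u \<omega> = a)"

definition joint :: "'s \<Rightarrow> 's \<Rightarrow> real \<Rightarrow> real \<Rightarrow> real" where
  "joint a b u v = \<P>(\<omega> in M. X u \<omega> = a \<and> X v \<omega> = b)"

lemma state_event: "0 \<le> t \<Longrightarrow> {\<omega> \<in> space M. X t \<omega> = a} \<in> sets M"
  using measurable_sets[OF X_measurable[of t], of "{a}"] by (simp add: vimage_def Int_def conj_commute)

lemma state_event2: "0 \<le> u \<Longrightarrow> 0 \<le> v \<Longrightarrow> {\<omega> \<in> space M. Q (X u \<omega>) (X v \<omega>)} \<in> sets M"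
proof -
  assume uv: "0 \<le> u" "0 \<le> v"
  have "{\<omega> \<in> space M. Q (X u \<omega>) (X v \<omega>)} =
      (\<Union>(a, b)\<in>{(a, b). Q a b}. {\<omega> \<in> space M. X u \<omega> = a} \<inter> {\<omega> \<in> space M. X v \<omega> = b})" by auto
  also have "\<dots> \<in> sets M"
    by (intro sets.finite_UN) (auto intro!: sets.Int state_event uv simp: prod.split)
  finally show ?thesis .
qed

lemma cylinder_event:
  "finite F \<Longrightarrow> F \<subseteq> {0..} \<Longrightarrow> {\<omega> \<in> space M. \<forall>r\<in>F. X r \<omega> = y r} \<in> sets M"
proof (induction F rule: finite_induct)
  case (insert t F)
  have "{\<omega> \<in> space M. \<forall>r\<in>insert t F. X r \<omega> = y r} =
      {\<omega> \<in> space M. X t \<omega> = y t} \<inter> {\<omega> \<in> space M. \<forall>r\<in>F. X r \<omega> = y r}" by auto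
  then show ?case using insert state_event[of t "y t"] by auto
qed simp

text \<open>In product form the Markov property also holds for cylinders of probability zero.\<close>

lemma cylinder_transition:
  assumes uv: "0 \<le> u" "u \<le> v" and F: "finite F" "F \<subseteq> {0..<u}"
  shows "\<P>(\<omega> in M. (\<forall>r\<in>insert u F. X r \<omega> = y r) \<and> X v \<omega> = b) =
    \<P>(\<omega> in M. \<forall>r\<in>insert u F. X r \<omega> = y r) * P u v $ y u $ b"
proof -
  let ?H = "{\<omega> \<in> space M. \<forall>r\<in>insert u F. X r \<omega> = y r}"
  let ?HX = "{\<omega> \<in> space M. (\<forall>r\<in>insert u F. X r \<omega> = y r) \<and> X v \<omega> = b}"
  have H: "?H \<in> sets M" by (rule cylinder_event) (use F uv in force)+
  show ?thesis
  proof (cases "prob ?H = 0")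
    case True
    have "prob ?HX \<le> prob ?H" by (intro finite_measure_mono H) auto
    then show ?thesis using True by (simp add: measure_le_0_iff)
  next
    case False
    then have "0 < prob ?H" by (simp add: zero_less_measure_iff)
    from markov[OF uv F this, of b]
    have "prob {\<omega> \<in> space M. X v \<omega> = b \<and> (\<forall>r\<in>insert u F. X r \<omega> = y r)} / prob ?H = P u v $ y u $ b"
      by (simp only: cond_prob_def)
    moreover have "{\<omega> \<in> space M. X v \<omega> = b \<and> (\<forall>r\<in>insert u F. X r \<omega> = y r)} = ?HX" by auto
    ultimately show ?thesis using False by (simp only: nonzero_divide_eq_eq[OF False] mult.commute)
  qed
qed

lemma joint_eq: "0 \<le> u \<Longrightarrow> u \<le> v \<Longrightarrow> joint a b u v = occ a u * P u v $ a $ b"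
  using cylinder_transition[of u v "{}" "\<lambda>_. a" b] by (simp add: joint_def occ_def)

lemma joint_nonneg: "0 \<le> joint a b u v"
  by (simp add: joint_def)

lemma joint_le_1: "joint a b u v \<le> 1"
  by (simp add: joint_def)

text \<open>The forward equation, multiplied by the probability of the state at time \<open>u\<close>.\<close>

lemma joint_integral:
  assumes uv: "0 \<le> u" "u \<le> v"
  shows "((\<lambda>w. \<Sum>c\<in>UNIV. joint a c u w * \<Lambda> w $ c $ b) has_integral
    (joint a b u v - (if a = b then occ a u else 0))) {u..v}"
proof -
  have "((\<lambda>w. P u w ** \<Lambda> w) has_integral (P u v - mat 1)) {u..v}"
    using forward uv by (simp add: forward_solution_def)
  from has_integral_linear[OF this bounded_linear_compose[OF bounded_linear_vec_nth bounded_linear_vec_nth], of a b]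
  have "((\<lambda>w. (P u w ** \<Lambda> w) $ a $ b) has_integral (P u v - mat 1) $ a $ b) {u..v}"
    by (simp add: o_def)
  from has_integral_mult_right[OF this, of "occ a u"]
  have int: "((\<lambda>w. occ a u * (P u w ** \<Lambda> w) $ a $ b) has_integral occ a u * (P u v - mat 1) $ a $ b) {u..v}" .
  have val: "occ a u * (P u v - mat 1) $ a $ b = joint a b u v - (if a = b then occ a u else 0)"
    using uv by (simp add: joint_eq mat_def algebra_simps)
  have eq: "occ a u * (P u w ** \<Lambda> w) $ a $ b = (\<Sum>c\<in>UNIV. joint a c u w * \<Lambda> w $ c $ b)"
    if "w \<in> {u..v}" for w
    using that uv by (simp add: joint_eq matrix_matrix_mult_def sum_distrib_left mult_ac)
  show ?thesis using has_integral_eq[OF eq int] by (simp only: val)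
qed

lemma rate_bound_nonneg: "0 \<le> L"
  using rate_bound[of 0 undefined undefined] by linarith

text \<open>A bound on the rate at which the state changes: each of at most \<open>CARD('s)\<^sup>2\<close> pairs of different
  states contributes at most \<open>CARD('s) * L\<close>.\<close>

definition change_rate :: real where "change_rate = real (CARD('s) ^ 3) * L"

lemma change_rate_nonneg: "0 \<le> change_rate"
  using rate_bound_nonneg by (simp add: change_rate_def)

lemma joint_le:
  assumes uv: "0 \<le> u" "u \<le> v" and ab: "a \<noteq> b"
  shows "joint a b u v \<le> CARD('s) * L * (v - u)"
proof -
  have bound: "norm (\<Sum>c\<in>UNIV. joint a c u w * \<Lambda> w $ c $ b) \<le> CARD('s) * L" if "w \<in> {u..v}" for w
  proof -
    have "norm (joint a c u w * \<Lambda> w $ c $ b) \<le> 1 * L" for c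
      unfolding real_norm_def abs_mult
      using joint_le_1[of a c u w] joint_nonneg[of a c u w] rate_bound[of w c b] that uv
      by (intro mult_mono) auto
    then have "norm (\<Sum>c\<in>UNIV. joint a c u w * \<Lambda> w $ c $ b) \<le> (\<Sum>c\<in>(UNIV :: 's set). 1 * L)"
      by (intro sum_norm_le) auto
    then show ?thesis by simp
  qed
  have "norm (joint a b u v - (if a = b then occ a u else 0)) \<le>
      CARD('s) * L * Henstock_Kurzweil_Integration.content {u..v}"
    by (rule has_integral_bound_real[OF _ finite.emptyI joint_integral[OF uv]])
      (use bound rate_bound_nonneg in simp_all)
  then show ?thesis using uv ab joint_nonneg[of a b u v] by simp
qed

lemma change_prob_le:
  assumes uv: "0 \<le> u" "u \<le> v"
  shows "\<P>(\<omega> in M. X u \<omega> \<noteq> X v \<omega>) \<le> change_rate * (v - u)"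
proof -
  let ?S = "{q :: 's \<times> 's. fst q \<noteq> snd q}"
  let ?B = "\<lambda>q. {\<omega> \<in> space M. X u \<omega> = fst q \<and> X v \<omega> = snd q}"
  have B: "?B q \<in> sets M" for q using uv by (intro state_event2) auto
  have "{\<omega> \<in> space M. X u \<omega> \<noteq> X v \<omega>} \<subseteq> \<Union> (?B ` ?S)"
  proof
    fix \<omega> assume "\<omega> \<in> {\<omega> \<in> space M. X u \<omega> \<noteq> X v \<omega>}"
    then have "(X u \<omega>, X v \<omega>) \<in> ?S" "\<omega> \<in> ?B (X u \<omega>, X v \<omega>)" by auto
    then show "\<omega> \<in> \<Union> (?B ` ?S)" by (rule UN_I)
  qed
  then have "\<P>(\<omega> in M. X u \<omega> \<noteq> X v \<omega>) \<le> prob (\<Union> (?B ` ?S))"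
    using B by (intro finite_measure_mono sets.finite_UN) auto
  also have "\<dots> \<le> (\<Sum>q\<in>?S. joint (fst q) (snd q) u v)"
    unfolding joint_def using B by (intro finite_measure_subadditive_finite) auto
  also have "\<dots> \<le> (\<Sum>q\<in>?S. CARD('s) * L * (v - u))"
    using joint_le[OF uv] by (intro sum_mono) auto
  also have "\<dots> \<le> (\<Sum>q\<in>(UNIV :: ('s \<times> 's) set). CARD('s) * L * (v - u))"
    using uv rate_bound_nonneg by (intro sum_mono2) auto
  also have "\<dots> = change_rate * (v - u)" by (simp only: sum_constant card_prod change_rate_def power3_eq_cube of_nat_mult mult_ac)
  finally show ?thesis .
qed

lemma joint_stay:
  assumes uv: "0 \<le> u" "u \<le> v"
  shows "\<bar>joint a c u v - (if a = c then occ a u else 0)\<bar> \<le> change_rate * (v - u)"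
proof (cases "a = c")
  case True
  have "occ a u = joint a a u v + \<P>(\<omega> in M. X u \<omega> = a \<and> X v \<omega> \<noteq> a)"
  proof -
    let ?A = "{\<omega> \<in> space M. X u \<omega> = a \<and> X v \<omega> = a}" and ?B = "{\<omega> \<in> space M. X u \<omega> = a \<and> X v \<omega> \<noteq> a}"
    have "?A \<in> sets M" "?B \<in> sets M"
      using uv state_event2[of u v "\<lambda>x y. x = a \<and> y = a"] state_event2[of u v "\<lambda>x y. x = a \<and> y \<noteq> a"]
      by linarith+
    then have "prob (?A \<union> ?B) = prob ?A + prob ?B" by (rule finite_measure_Union) blast
    moreover have "?A \<union> ?B = {\<omega> \<in> space M. X u \<omega> = a}" by blast
    ultimately show ?thesis by (simp only: occ_def joint_def)
  qed
  moreover have "\<P>(\<omega> in M. X u \<omega> = a \<and> X v \<omega> \<noteq> a) \<le> \<P>(\<omega> in M. X u \<omega> \<noteq> X v \<omega>)"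
    using uv by (intro finite_measure_mono state_event2) auto
  ultimately show ?thesis using True change_prob_le[OF uv] by simp
next
  case False
  have "joint a c u v \<le> \<P>(\<omega> in M. X u \<omega> \<noteq> X v \<omega>)"
    unfolding joint_def using uv False by (intro finite_measure_mono state_event2) auto
  then show ?thesis using False change_prob_le[OF uv] joint_nonneg[of a c u v] by simp
qed

lemma occ_lipschitz:
  assumes uv: "0 \<le> u" "u \<le> v"
  shows "\<bar>occ a u - occ a v\<bar> \<le> change_rate * (v - u)"
proof -
  let ?C = "\<P>(\<omega> in M. X u \<omega> \<noteq> X v \<omega>)"
  have C: "{\<omega> \<in> space M. X u \<omega> \<noteq> X v \<omega>} \<in> sets M" using uv by (intro state_event2) auto
  have "occ a u \<le> prob ({\<omega> \<in> space M. X v \<omega> = a} \<union> {\<omega> \<in> space M. X u \<omega> \<noteq> X v \<omega>})"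
    unfolding occ_def using uv by (intro finite_measure_mono sets.Un C state_event) auto
  also have "\<dots> \<le> occ a v + ?C"
    unfolding occ_def using C uv by (intro measure_Un_le state_event) auto
  finally have "occ a u \<le> occ a v + ?C" .
  moreover have "occ a v \<le> prob ({\<omega> \<in> space M. X u \<omega> = a} \<union> {\<omega> \<in> space M. X u \<omega> \<noteq> X v \<omega>})"
    unfolding occ_def using uv by (intro finite_measure_mono sets.Un C state_event) auto
  moreover have "\<dots> \<le> occ a u + ?C"
    unfolding occ_def using C uv by (intro measure_Un_le state_event) auto
  ultimately show ?thesis using change_prob_le[OF uv] by linarith
qed

text \<open>The first-order expansion of the two-time probabilities: in the integrand of the forward
  equation the probabilities differ from their values at time \<open>u\<close> by at most \<open>change_rate * (v - u)\<close>.\<close>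

lemma joint_second_order:
  assumes uv: "0 \<le> u" "u \<le> v" and ab: "a \<noteq> b" and A: "\<And>w. u < w \<Longrightarrow> w \<le> v \<Longrightarrow> \<Lambda> w = A"
  shows "\<bar>joint a b u v - (v - u) * (occ a u * A $ a $ b)\<bar> \<le> CARD('s) * (change_rate * (v - u) * L) * (v - u)"
proof (cases "u = v")
  case True
  then show ?thesis using joint_le[OF uv ab] joint_nonneg[of a b u v] by simp
next
  case False
  have "((\<lambda>w. \<Sum>c\<in>UNIV. joint a c u w * A $ c $ b) has_integral (joint a b u v - (if a = b then occ a u else 0))) {u..v}"
    by (rule has_integral_spike_finite[OF _ _ joint_integral[OF uv], of "{u}"]) (auto simp: A)
  then have int: "((\<lambda>w. (\<Sum>c\<in>UNIV. joint a c u w * A $ c $ b) - occ a u * A $ a $ b) has_integral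
      (joint a b u v - (v - u) * (occ a u * A $ a $ b))) {u..v}"
    using has_integral_diff[OF _ has_integral_const_real[of "occ a u * A $ a $ b" u v]] uv ab by fastforce
  have A_le: "\<bar>A $ c $ b\<bar> \<le> L" for c
    using rate_bound[of v c b] A[of v] uv False by simp
  have "norm ((\<Sum>c\<in>UNIV. joint a c u w * A $ c $ b) - occ a u * A $ a $ b) \<le> CARD('s) * (change_rate * (v - u) * L)"
    if w: "w \<in> {u..v}" for w
  proof -
    have "(\<Sum>c\<in>UNIV. joint a c u w * A $ c $ b) - occ a u * A $ a $ b =
        (\<Sum>c\<in>UNIV. (joint a c u w - (if a = c then occ a u else 0)) * A $ c $ b)"
      by (simp add: left_diff_distrib sum_subtractf if_distrib[of "\<lambda>x. x * _"] cong: if_cong)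
    also have "norm \<dots> \<le> (\<Sum>c\<in>(UNIV :: 's set). change_rate * (v - u) * L)"
    proof (rule sum_norm_le)
      fix c
      have "\<bar>joint a c u w - (if a = c then occ a u else 0)\<bar> \<le> change_rate * (w - u)"
        using w uv by (intro joint_stay) auto
      also have "\<dots> \<le> change_rate * (v - u)" using w change_rate_nonneg by (intro mult_left_mono) auto
      finally show "norm ((joint a c u w - (if a = c then occ a u else 0)) * A $ c $ b) \<le> change_rate * (v - u) * L"
        unfolding real_norm_def abs_mult using A_le change_rate_nonneg uv by (intro mult_mono) auto
    qed
    finally show ?thesis by simp
  qed
  note bound = this
  have "norm (joint a b u v - (v - u) * (occ a u * A $ a $ b)) \<le>
      CARD('s) * (change_rate * (v - u) * L) * Henstock_Kurzweil_Integration.content {u..v}"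
    by (rule has_integral_bound_real[OF _ finite.emptyI int])
      (use bound uv change_rate_nonneg rate_bound_nonneg in simp_all)
  then show ?thesis using uv by simp
qed

lemma joint_rate_tendsto:
  assumes v: "\<alpha> < v" "v \<le> \<gamma>" "0 \<le> \<alpha>" and ab: "a \<noteq> b"
    and A: "\<And>w. \<alpha> < w \<Longrightarrow> w \<le> \<gamma> \<Longrightarrow> \<Lambda> w = A"
  shows "(\<lambda>m. real (Suc m) * joint a b (v - 1 / Suc m) v) \<longlonglongrightarrow> occ a v * A $ a $ b"
proof -
  define h where "h m = 1 / real (Suc m)" for m
  have h: "0 < h m" "real (Suc m) * h m = 1" for m by (auto simp: h_def simp del: of_nat_Suc)
  have h0: "h \<longlonglongrightarrow> 0" unfolding h_def using LIMSEQ_inverse_real_of_nat by (simp add: inverse_eq_divide)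
  then have small: "eventually (\<lambda>m. h m < v - \<alpha>) sequentially" using v by (simp add: order_tendstoD(2))
  have "(\<lambda>m. occ a (v - h m)) \<longlonglongrightarrow> occ a v"
  proof (rule Lim_null_comparison[THEN LIM_zero_cancel])
    show "eventually (\<lambda>m. norm (occ a (v - h m) - occ a v) \<le> change_rate * h m) sequentially"
      using small
    proof eventually_elim
      case (elim m)
      then show ?case using occ_lipschitz[of "v - h m" v a] v h(1)[of m] by simp
    qed
    show "(\<lambda>m. change_rate * h m) \<longlonglongrightarrow> 0" using tendsto_mult_left[OF h0, of change_rate] by simp
  qed
  then have occ_lim: "(\<lambda>m. occ a (v - h m) * A $ a $ b) \<longlonglongrightarrow> occ a v * A $ a $ b"
    by (intro tendsto_intros)
  have "(\<lambda>m. real (Suc m) * joint a b (v - h m) v - occ a (v - h m) * A $ a $ b) \<longlonglongrightarrow> 0"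
  proof (rule Lim_null_comparison)
    show "eventually (\<lambda>m. norm (real (Suc m) * joint a b (v - h m) v - occ a (v - h m) * A $ a $ b)
        \<le> CARD('s) * (change_rate * L) * h m) sequentially"
      using small
    proof eventually_elim
      case (elim m)
      let ?j = "joint a b (v - h m) v" and ?q = "occ a (v - h m) * A $ a $ b"
      have "\<bar>?j - h m * ?q\<bar> \<le> CARD('s) * (change_rate * h m * L) * h m"
        using joint_second_order[of "v - h m" v a b A] elim v h(1)[of m] ab A by simp
      then have "real (Suc m) * \<bar>?j - h m * ?q\<bar> \<le> real (Suc m) * (CARD('s) * (change_rate * h m * L) * h m)"
        by (rule mult_left_mono) simp
      moreover have "real (Suc m) * \<bar>?j - h m * ?q\<bar> = \<bar>real (Suc m) * ?j - (real (Suc m) * h m) * ?q\<bar>"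
      proof -
        have "real (Suc m) * (?j - h m * ?q) = real (Suc m) * ?j - (real (Suc m) * h m) * ?q"
          by (simp only: right_diff_distrib mult.assoc)
        then show ?thesis by (simp only: abs_mult[of "real (Suc m)" "?j - h m * ?q", symmetric, simplified abs_of_nat])
      qed
      moreover have "real (Suc m) * (CARD('s) * (change_rate * h m * L) * h m) = (real (Suc m) * h m) * (CARD('s) * (change_rate * L) * h m)"
        by (simp only: mult_ac)
      ultimately show ?case by (simp only: h(2) mult_1_left real_norm_def)
    qed
    show "(\<lambda>m. CARD('s) * (change_rate * L) * h m) \<longlonglongrightarrow> 0"
      using tendsto_mult_left[OF h0, of "CARD('s) * (change_rate * L)"] by simp
  qed
  from tendsto_add[OF this occ_lim] show ?thesis by (simp add: h_def)
qed

text \<open>By Tonelli's theorem, the expected rate of increments is an average of two-time probabilities.\<close>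

lemma increment_rate_expectation:
  assumes a: "0 \<le> a" and D: "D \<in> sets M"
  shows "(\<integral>\<^sup>+\<omega>. increment_rate (\<lambda>t. X t \<omega>) R a c m * indicator D \<omega> \<partial>M) =
    of_nat (Suc m) * (\<integral>\<^sup>+u. indicator {a<..c} u *
      emeasure M {\<omega> \<in> space M. R (X (max 0 u) \<omega>) (X (max 0 u + 1 / Suc m) \<omega>) \<and> \<omega> \<in> D} \<partial>lborel)"
    (is "_ = _ * (\<integral>\<^sup>+u. _ * emeasure M (?E u) \<partial>lborel)")
proof -
  interpret pair_sigma_finite M lborel ..
  define h where "h = 1 / real (Suc m)"
  have h: "0 \<le> h" by (simp add: h_def)
  let ?f = "\<lambda>\<omega> u. indicator {a<..c} u * (of_bool (R (X (max 0 u) \<omega>) (X (max 0 u + h) \<omega>)) :: ennreal)"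
  have meas: "(\<lambda>(\<omega>, u). ?f \<omega> u * indicator D \<omega>) \<in> borel_measurable (M \<Otimes>\<^sub>M lborel)"
    using increment_event_measurable[OF h, of a c R] D by (simp add: case_prod_beta')
  have meas1: "?f \<omega> \<in> borel_measurable lborel" if "\<omega> \<in> space M" for \<omega>
    using measurable_Pair2[OF increment_event_measurable[OF h] that, of a c R] by simp
  have "(\<integral>\<^sup>+\<omega>. increment_rate (\<lambda>t. X t \<omega>) R a c m * indicator D \<omega> \<partial>M) =
      (\<integral>\<^sup>+\<omega>. of_nat (Suc m) * (\<integral>\<^sup>+u. ?f \<omega> u * indicator D \<omega> \<partial>lborel) \<partial>M)"
    unfolding increment_rate_def h_def[symmetric]
  proof (intro nn_integral_cong)
    fix \<omega> assume \<omega>: "\<omega> \<in> space M"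
    have "(\<integral>\<^sup>+u. ?f \<omega> u * indicator D \<omega> \<partial>lborel) = (\<integral>\<^sup>+u. ?f \<omega> u \<partial>lborel) * indicator D \<omega>"
      by (rule nn_integral_multc[OF meas1[OF \<omega>]])
    then show "of_nat (Suc m) * emeasure lborel {u \<in> {a<..c}. R (X u \<omega>) (X (u + h) \<omega>)} * indicator D \<omega> =
        of_nat (Suc m) * (\<integral>\<^sup>+u. ?f \<omega> u * indicator D \<omega> \<partial>lborel)"
      by (simp only: emeasure_increment_times[OF \<omega> a h] mult.assoc)
  qed
  also have "\<dots> = of_nat (Suc m) * (\<integral>\<^sup>+\<omega>. \<integral>\<^sup>+u. ?f \<omega> u * indicator D \<omega> \<partial>lborel \<partial>M)"
    using meas by (intro nn_integral_cmult lborel.borel_measurable_nn_integral)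
  also have "(\<integral>\<^sup>+\<omega>. \<integral>\<^sup>+u. ?f \<omega> u * indicator D \<omega> \<partial>lborel \<partial>M) =
      (\<integral>\<^sup>+u. \<integral>\<^sup>+\<omega>. ?f \<omega> u * indicator D \<omega> \<partial>M \<partial>lborel)"
    by (rule Fubini'[OF meas, symmetric])
  also have "\<dots> = (\<integral>\<^sup>+u. indicator {a<..c} u * emeasure M (?E u) \<partial>lborel)"
  proof (intro nn_integral_cong)
    fix u
    have E: "?E u \<in> sets M"
    proof -
      have "?E u = {\<omega> \<in> space M. R (X (max 0 u) \<omega>) (X (max 0 u + h) \<omega>)} \<inter> D"
        using sets.sets_into_space[OF D] by (auto simp: h_def)
      then show ?thesis using D h by (auto intro!: sets.Int state_event2)
    qed
    have "(\<integral>\<^sup>+\<omega>. ?f \<omega> u * indicator D \<omega> \<partial>M) = (\<integral>\<^sup>+\<omega>. indicator {a<..c} u * indicator (?E u) \<omega> \<partial>M)"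
      by (intro nn_integral_cong) (auto simp: indicator_def h_def)
    also have "\<dots> = indicator {a<..c} u * emeasure M (?E u)"
      using E by (simp add: nn_integral_cmult)
    finally show "(\<integral>\<^sup>+\<omega>. ?f \<omega> u * indicator D \<omega> \<partial>M) = indicator {a<..c} u * emeasure M (?E u)" .
  qed
  finally show ?thesis .
qed

text \<open>By Fatou's lemma, since the state changes within time \<open>h\<close> with probability at most \<open>change_rate * h\<close>.\<close>

lemma expected_total_jumps_finite:
  assumes ac: "0 \<le> a" "a \<le> c"
  shows "(\<integral>\<^sup>+\<omega>. jump_number (\<lambda>t. X t \<omega>) (\<noteq>) {a<..c} \<partial>M) < \<infinity>"
proof -
  have irr: "irreflp ((\<noteq>) :: 's \<Rightarrow> 's \<Rightarrow> bool)" by (auto intro: irreflpI)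
  have "(\<integral>\<^sup>+\<omega>. jump_number (\<lambda>t. X t \<omega>) (\<noteq>) {a<..c} \<partial>M) =
      (\<integral>\<^sup>+\<omega>. liminf (\<lambda>m. increment_rate (\<lambda>t. X t \<omega>) (\<noteq>) a c m) \<partial>M)"
  proof (intro nn_integral_cong)
    fix \<omega> assume "\<omega> \<in> space M"
    then have "(\<lambda>m. increment_rate (\<lambda>t. X t \<omega>) (\<noteq>) a c m) \<longlonglongrightarrow> jump_number (\<lambda>t. X t \<omega>) (\<noteq>) {a<..c}"
      by (intro tendsto_eventually increment_rate_eventually X_path irr ac)
    then show "jump_number (\<lambda>t. X t \<omega>) (\<noteq>) {a<..c} = liminf (\<lambda>m. increment_rate (\<lambda>t. X t \<omega>) (\<noteq>) a c m)"
      by (rule lim_imp_Liminf[OF trivial_limit_sequentially, symmetric])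
  qed
  also have "\<dots> \<le> liminf (\<lambda>m. \<integral>\<^sup>+\<omega>. increment_rate (\<lambda>t. X t \<omega>) (\<noteq>) a c m \<partial>M)"
    by (intro nn_integral_liminf increment_rate_measurable ac)
  also have "\<dots> \<le> liminf (\<lambda>m::nat. ennreal (change_rate * (c - a)))"
  proof (intro Liminf_mono always_eventually allI)
    fix m
    define h where "h = 1 / real (Suc m)"
    have h: "0 \<le> h" "real (Suc m) * h = 1" by (auto simp: h_def simp del: of_nat_Suc)
    have "(\<integral>\<^sup>+\<omega>. increment_rate (\<lambda>t. X t \<omega>) (\<noteq>) a c m \<partial>M) =
        (\<integral>\<^sup>+\<omega>. increment_rate (\<lambda>t. X t \<omega>) (\<noteq>) a c m * indicator (space M) \<omega> \<partial>M)"
      by (intro nn_integral_cong) simp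
    also have "\<dots> = of_nat (Suc m) * (\<integral>\<^sup>+u. indicator {a<..c} u *
        emeasure M {\<omega> \<in> space M. X (max 0 u) \<omega> \<noteq> X (max 0 u + h) \<omega> \<and> \<omega> \<in> space M} \<partial>lborel)"
      unfolding h_def by (rule increment_rate_expectation) (use ac in auto)
    also have "\<dots> \<le> of_nat (Suc m) * (\<integral>\<^sup>+u. indicator {a<..c} u * ennreal (change_rate * h) \<partial>lborel)"
    proof (intro mult_left_mono nn_integral_mono)
      fix u :: real
      have "{\<omega> \<in> space M. X (max 0 u) \<omega> \<noteq> X (max 0 u + h) \<omega> \<and> \<omega> \<in> space M} =
          {\<omega> \<in> space M. X (max 0 u) \<omega> \<noteq> X (max 0 u + h) \<omega>}" by auto
      then show "emeasure M {\<omega> \<in> space M. X (max 0 u) \<omega> \<noteq> X (max 0 u + h) \<omega> \<and> \<omega> \<in> space M} \<le> ennreal (change_rate * h)"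
        using change_prob_le[of "max 0 u" "max 0 u + h"] h(1) by (simp add: emeasure_eq_measure ennreal_leI)
    qed auto
    also have "\<dots> = of_nat (Suc m) * (ennreal (change_rate * h) * ennreal (c - a))"
      using ac by (simp add: nn_integral_multc mult.commute)
    also have "\<dots> = ennreal ((real (Suc m) * h) * (change_rate * (c - a)))"
      unfolding ennreal_of_nat_eq_real_of_nat using change_rate_nonneg h(1) ac
      by (simp add: ennreal_mult[symmetric] mult_ac del: of_nat_Suc)
    finally show "(\<integral>\<^sup>+\<omega>. increment_rate (\<lambda>t. X t \<omega>) (\<noteq>) a c m \<partial>M) \<le> ennreal (change_rate * (c - a))"
      unfolding h(2) by simp
  qed
  also have "\<dots> = ennreal (change_rate * (c - a))" by (simp add: Liminf_const)
  finally show ?thesis by (rule le_less_trans) simp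
qed

text \<open>The factor \<open>G v\<close> is the conditional probability of \<open>D\<close> given state \<open>a\<close> at time \<open>u\<close> and state \<open>b\<close> at
  time \<open>v\<close>. After the substitution \<open>v = u + h\<close> it no longer depends on the step \<open>h\<close>, so the limit
  \<open>h \<rightarrow> 0\<close> concerns the two-time probabilities alone and \<open>G\<close> need only be measurable.\<close>

lemma expected_jump_number:
  fixes G :: "real \<Rightarrow> ennreal"
  assumes ab: "a \<noteq> b" and ag: "0 \<le> \<alpha>" "\<alpha> \<le> \<gamma>" and A: "\<And>w. \<alpha> < w \<Longrightarrow> w \<le> \<gamma> \<Longrightarrow> \<Lambda> w = A"
    and D: "D \<in> sets M" and G: "G \<in> borel_measurable borel" "\<And>v. G v \<le> 1"
    and split: "\<And>u v. 0 \<le> u \<Longrightarrow> u < v \<Longrightarrow>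
      emeasure M {\<omega> \<in> space M. X u \<omega> = a \<and> X v \<omega> = b \<and> \<omega> \<in> D} = ennreal (joint a b u v) * G v"
  shows "(\<integral>\<^sup>+\<omega>. jump_number (\<lambda>t. X t \<omega>) (\<lambda>l y. l = a \<and> y = b) {\<alpha><..\<gamma>} * indicator D \<omega> \<partial>M) =
    (\<integral>\<^sup>+v. indicator {\<alpha><..\<gamma>} v * (ennreal (occ a v * A $ a $ b) * G v) \<partial>lborel)"
proof -
  let ?R = "\<lambda>l y. l = a \<and> y = b"
  define h where "h m = 1 / real (Suc m)" for m
  have h: "0 < h m" "h m \<le> 1" "real (Suc m) * h m = 1" for m by (auto simp: h_def simp del: of_nat_Suc)
  have h0: "h \<longlonglongrightarrow> 0" unfolding h_def using LIMSEQ_inverse_real_of_nat by (simp add: inverse_eq_divide)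
  have irr: "irreflp ?R" using ab by (auto intro: irreflpI)
  define K where "K m u = indicator {\<alpha><..\<gamma>} u * ennreal (joint a b (max 0 u) (max 0 u + h m))" for m u
  have K_meas: "K m \<in> borel_measurable borel" for m
  proof -
    have "(\<lambda>(u, \<omega>). indicator {\<alpha><..\<gamma>} u * (of_bool (X (max 0 u) \<omega> = a \<and> X (max 0 u + h m) \<omega> = b) :: ennreal))
        \<in> borel_measurable (lborel \<Otimes>\<^sub>M M)"
      using measurable_pair_swap[OF increment_event_measurable[of "h m" \<alpha> \<gamma> ?R]] h(1)[of m]
      by (simp add: case_prod_beta' less_imp_le)
    from borel_measurable_nn_integral[OF this]
    have "(\<lambda>u. \<integral>\<^sup>+\<omega>. indicator {\<alpha><..\<gamma>} u * (of_bool (X (max 0 u) \<omega> = a \<and> X (max 0 u + h m) \<omega> = b) :: ennreal) \<partial>M)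
        \<in> borel_measurable borel" by simp
    moreover have "(\<integral>\<^sup>+\<omega>. indicator {\<alpha><..\<gamma>} u * (of_bool (X (max 0 u) \<omega> = a \<and> X (max 0 u + h m) \<omega> = b) :: ennreal) \<partial>M) = K m u" for u
    proof -
      let ?E = "{\<omega> \<in> space M. X (max 0 u) \<omega> = a \<and> X (max 0 u + h m) \<omega> = b}"
      have E: "?E \<in> sets M" using h(1)[of m] by (intro state_event2) auto
      have "(\<integral>\<^sup>+\<omega>. indicator {\<alpha><..\<gamma>} u * (of_bool (X (max 0 u) \<omega> = a \<and> X (max 0 u + h m) \<omega> = b) :: ennreal) \<partial>M)
        = (\<integral>\<^sup>+\<omega>. indicator {\<alpha><..\<gamma>} u * indicator ?E \<omega> \<partial>M)"
        by (intro nn_integral_cong) (auto simp: indicator_def)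
      also have "\<dots> = K m u" using E by (simp add: nn_integral_cmult K_def joint_def emeasure_eq_measure)
      finally show ?thesis .
    qed
    ultimately show ?thesis by simp
  qed
  have K_shift: "(\<lambda>v. K m (v - h m)) \<in> borel_measurable borel" for m
    by (rule measurable_compose[OF _ K_meas]) simp
  define \<phi> where "\<phi> m v = of_nat (Suc m) * (K m (v - h m) * G v)" for m v
  have \<phi>_meas: "\<phi> m \<in> borel_measurable lborel" for m
    using K_shift[of m] G(1) unfolding \<phi>_def by simp
  have expect: "(\<integral>\<^sup>+\<omega>. increment_rate (\<lambda>t. X t \<omega>) ?R \<alpha> \<gamma> m * indicator D \<omega> \<partial>M) = (\<integral>\<^sup>+v. \<phi> m v \<partial>lborel)" for m
  proof -
    have "(\<integral>\<^sup>+\<omega>. increment_rate (\<lambda>t. X t \<omega>) ?R \<alpha> \<gamma> m * indicator D \<omega> \<partial>M) =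
        of_nat (Suc m) * (\<integral>\<^sup>+u. indicator {\<alpha><..\<gamma>} u *
          emeasure M {\<omega> \<in> space M. (X (max 0 u) \<omega> = a \<and> X (max 0 u + h m) \<omega> = b) \<and> \<omega> \<in> D} \<partial>lborel)"
      unfolding h_def by (rule increment_rate_expectation[OF ag(1) D])
    also have "(\<integral>\<^sup>+u. indicator {\<alpha><..\<gamma>} u *
          emeasure M {\<omega> \<in> space M. (X (max 0 u) \<omega> = a \<and> X (max 0 u + h m) \<omega> = b) \<and> \<omega> \<in> D} \<partial>lborel) =
        (\<integral>\<^sup>+u. K m u * G (u + h m) \<partial>lborel)"
    proof (intro nn_integral_cong)
      fix u :: real
      show "indicator {\<alpha><..\<gamma>} u *
          emeasure M {\<omega> \<in> space M. (X (max 0 u) \<omega> = a \<and> X (max 0 u + h m) \<omega> = b) \<and> \<omega> \<in> D} = K m u * G (u + h m)"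
      proof (cases "u \<in> {\<alpha><..\<gamma>}")
        case True
        then have "max 0 u = u" "0 \<le> u" using ag by auto
        then show ?thesis using True split[of u "u + h m"] h(1)[of m] by (simp add: K_def conj_assoc)
      qed (simp add: K_def)
    qed
    also have "\<dots> = (\<integral>\<^sup>+v. K m (v - h m) * G v \<partial>lborel)"
    proof -
      have "(\<lambda>u. K m u * G (u + h m)) \<in> borel_measurable borel"
        using K_meas[of m] measurable_compose[OF _ G(1), of "\<lambda>u. u + h m" borel] by measurable
      from nn_integral_real_affine[OF this, of 1 "- h m"] show ?thesis by simp
    qed
    also have "of_nat (Suc m) * \<dots> = (\<integral>\<^sup>+v. \<phi> m v \<partial>lborel)"
      unfolding \<phi>_def using K_shift[of m] G(1)
      by (intro nn_integral_cmult[symmetric]) simp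
    finally show ?thesis .
  qed
  have "(\<lambda>m. \<integral>\<^sup>+\<omega>. increment_rate (\<lambda>t. X t \<omega>) ?R \<alpha> \<gamma> m * indicator D \<omega> \<partial>M)
      \<longlonglongrightarrow> (\<integral>\<^sup>+\<omega>. jump_number (\<lambda>t. X t \<omega>) ?R {\<alpha><..\<gamma>} * indicator D \<omega> \<partial>M)"
  proof (rule nn_integral_dominated_convergence)
    show "(\<lambda>\<omega>. increment_rate (\<lambda>t. X t \<omega>) ?R \<alpha> \<gamma> m * indicator D \<omega>) \<in> borel_measurable M" for m
      using increment_rate_measurable[OF ag(1), of ?R \<gamma> m] D by measurable
    show "(\<lambda>\<omega>. jump_number (\<lambda>t. X t \<omega>) ?R {\<alpha><..\<gamma>} * indicator D \<omega>) \<in> borel_measurable M"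
      using jump_number_measurable[OF irr ag] D by measurable
    show "(\<lambda>\<omega>. jump_number (\<lambda>t. X t \<omega>) (\<noteq>) {\<alpha><..\<gamma> + 1}) \<in> borel_measurable M"
      using ag by (intro jump_number_measurable) (auto intro: irreflpI)
    show "(\<integral>\<^sup>+\<omega>. jump_number (\<lambda>t. X t \<omega>) (\<noteq>) {\<alpha><..\<gamma> + 1} \<partial>M) < \<infinity>"
      using ag by (intro expected_total_jumps_finite) auto
    show "AE \<omega> in M. increment_rate (\<lambda>t. X t \<omega>) ?R \<alpha> \<gamma> m * indicator D \<omega> \<le>
        jump_number (\<lambda>t. X t \<omega>) (\<noteq>) {\<alpha><..\<gamma> + 1}" for m
    proof (rule AE_I2)
      fix \<omega> assume "\<omega> \<in> space M"
      from increment_rate_le[where R = ?R, OF X_path[OF this] irr ag, of m]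
      show "increment_rate (\<lambda>t. X t \<omega>) ?R \<alpha> \<gamma> m * indicator D \<omega> \<le> jump_number (\<lambda>t. X t \<omega>) (\<noteq>) {\<alpha><..\<gamma> + 1}"
        by (auto simp: indicator_def)
    qed
    show "AE \<omega> in M. (\<lambda>m. increment_rate (\<lambda>t. X t \<omega>) ?R \<alpha> \<gamma> m * indicator D \<omega>)
        \<longlonglongrightarrow> jump_number (\<lambda>t. X t \<omega>) ?R {\<alpha><..\<gamma>} * indicator D \<omega>"
    proof (rule AE_I2)
      fix \<omega> assume "\<omega> \<in> space M"
      from increment_rate_eventually[where R = ?R, OF X_path[OF this] irr ag]
      show "(\<lambda>m. increment_rate (\<lambda>t. X t \<omega>) ?R \<alpha> \<gamma> m * indicator D \<omega>)
        \<longlonglongrightarrow> jump_number (\<lambda>t. X t \<omega>) ?R {\<alpha><..\<gamma>} * indicator D \<omega>"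
        by (intro tendsto_eventually) (auto elim: eventually_mono)
    qed
  qed
  moreover have "(\<lambda>m. \<integral>\<^sup>+v. \<phi> m v \<partial>lborel) \<longlonglongrightarrow>
      (\<integral>\<^sup>+v. indicator {\<alpha><..\<gamma>} v * (ennreal (occ a v * A $ a $ b) * G v) \<partial>lborel)"
  proof (rule nn_integral_dominated_convergence)
    let ?w = "\<lambda>v. ennreal (CARD('s) * L) * indicator {\<alpha><..\<gamma> + 1} v"
    show "\<phi> m \<in> borel_measurable lborel" for m by (rule \<phi>_meas)
    have "continuous_on {0..} (occ a)"
    proof (rule lipschitz_on_continuous_on[of change_rate])
      show "change_rate-lipschitz_on {0..} (occ a)"
      proof (rule lipschitz_onI)
        fix u v :: real assume "u \<in> {0..}" "v \<in> {0..}"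
        then show "dist (occ a u) (occ a v) \<le> change_rate * dist u v"
          using occ_lipschitz[of u v a] occ_lipschitz[of v u a]
          by (cases "u \<le> v") (auto simp: dist_real_def abs_minus_commute)
      qed (rule change_rate_nonneg)
    qed
    then have "continuous_on {\<alpha><..\<gamma>} (occ a)" by (rule continuous_on_subset) (use ag in auto)
    from borel_measurable_continuous_on_indicator[OF _ this]
    have "(\<lambda>v. indicator {\<alpha><..\<gamma>} v *\<^sub>R occ a v) \<in> borel_measurable borel" by simp
    then have "(\<lambda>v. ennreal ((indicator {\<alpha><..\<gamma>} v *\<^sub>R occ a v) * A $ a $ b) * G v) \<in> borel_measurable lborel"
      using G(1) by measurable
    then show "(\<lambda>v. indicator {\<alpha><..\<gamma>} v * (ennreal (occ a v * A $ a $ b) * G v)) \<in> borel_measurable lborel"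
      by (rule subst[OF measurable_cong, rotated]) (auto simp: indicator_def)
    show "?w \<in> borel_measurable lborel" by measurable
    show "(\<integral>\<^sup>+v. ?w v \<partial>lborel) < \<infinity>"
      using ag by (simp add: nn_integral_cmult ennreal_mult_less_top)
    show "AE v in lborel. \<phi> m v \<le> ?w v" for m
    proof (rule AE_I2)
      fix v :: real
      show "\<phi> m v \<le> ?w v"
      proof (cases "v - h m \<in> {\<alpha><..\<gamma>}")
        case True
        then have v: "0 \<le> v - h m" "v \<in> {\<alpha><..\<gamma> + 1}" using ag h(1,2)[of m] by auto
        have "\<phi> m v = of_nat (Suc m) * (ennreal (joint a b (v - h m) v) * G v)"
          using True v by (simp add: \<phi>_def K_def max_def del: of_nat_Suc)
        also have "\<dots> \<le> of_nat (Suc m) * (ennreal (CARD('s) * L * h m) * 1)"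
          using joint_le[of "v - h m" v a b] v(1) h(1)[of m] ab G(2)
          by (intro mult_left_mono mult_mono ennreal_leI) auto
        also have "\<dots> = ennreal ((real (Suc m) * h m) * (CARD('s) * L))"
          unfolding ennreal_of_nat_eq_real_of_nat using h(1)[of m] rate_bound_nonneg
          by (simp add: ennreal_mult[symmetric] mult_ac del: of_nat_Suc)
        finally show ?thesis unfolding h(3) using v by simp
      qed (simp add: \<phi>_def K_def)
    qed
    have "AE v in lborel. v \<notin> {\<alpha>, \<gamma>}" by (rule AE_not_in) (auto intro: finite_imp_null_set_lborel)
    then show "AE v in lborel. (\<lambda>m. \<phi> m v) \<longlonglongrightarrow> indicator {\<alpha><..\<gamma>} v * (ennreal (occ a v * A $ a $ b) * G v)"
    proof eventually_elim
      fix v assume v: "v \<notin> {\<alpha>, \<gamma>}"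
      consider "\<alpha> < v" "v < \<gamma>" | "v < \<alpha>" | "\<gamma> < v" using v by force
      then show "(\<lambda>m. \<phi> m v) \<longlonglongrightarrow> indicator {\<alpha><..\<gamma>} v * (ennreal (occ a v * A $ a $ b) * G v)"
      proof cases
        case 1
        have "G v < top" using G(2)[of v] by (simp add: le_less_trans)
        have "(\<lambda>m. real (Suc m) * joint a b (v - h m) v) \<longlonglongrightarrow> occ a v * A $ a $ b"
          unfolding h_def using 1 ag ab A by (intro joint_rate_tendsto) auto
        then have "(\<lambda>m. G v * ennreal (real (Suc m) * joint a b (v - h m) v)) \<longlonglongrightarrow> G v * ennreal (occ a v * A $ a $ b)"
          using \<open>G v < top\<close> by (intro ennreal_tendsto_cmult tendsto_ennrealI)
        moreover have "eventually (\<lambda>m. G v * ennreal (real (Suc m) * joint a b (v - h m) v) = \<phi> m v) sequentially"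
        proof -
          have "eventually (\<lambda>m. h m < v - \<alpha>) sequentially" using h0 1 by (simp add: order_tendstoD(2))
          then show ?thesis
          proof eventually_elim
            case (elim m)
            then have "v - h m \<in> {\<alpha><..\<gamma>}" "0 \<le> v - h m" using 1 h(1)[of m] ag by auto
            then show ?case
              by (simp add: \<phi>_def K_def max_def ennreal_mult joint_nonneg ennreal_of_nat_eq_real_of_nat mult_ac
                  del: of_nat_Suc)
          qed
        qed
        ultimately have "(\<lambda>m. \<phi> m v) \<longlonglongrightarrow> G v * ennreal (occ a v * A $ a $ b)"
          by (rule Lim_transform_eventually)
        then show ?thesis using 1 by (simp add: mult.commute)
      next
        case 2
        then have "\<phi> m v = 0" for m using h(1)[of m] by (simp add: \<phi>_def K_def)
        then show ?thesis using 2 by simp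
      next
        case 3
        have "eventually (\<lambda>m. h m < v - \<gamma>) sequentially" using h0 3 by (simp add: order_tendstoD(2))
        then have "eventually (\<lambda>m. \<phi> m v = 0) sequentially"
          by eventually_elim (auto simp: \<phi>_def K_def)
        then show ?thesis using 3 by (simp add: tendsto_eventually)
      qed
    qed
  qed
  ultimately show ?thesis unfolding expect by (rule LIMSEQ_unique)
qed

end

section \<open>The absorption time\<close>

lemma sum_option: "(\<Sum>a\<in>(UNIV :: 'p::finite option set). f a) = f None + (\<Sum>i\<in>UNIV. f (Some i))"
  unfolding UNIV_option_conv by (simp add: sum.reindex)

text \<open>By right-continuity, a path that is absorbed before time \<open>c\<close> is also in the absorbing state at some rational
  time before \<open>c\<close>. For the paths that are never absorbed the time is the constant \<open>Inf {}\<close>.\<close>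

lemma absorption_time_measurable:
  fixes X :: "real \<Rightarrow> 'w \<Rightarrow> 'p::finite option"
  assumes "path_process F X"
  shows "(\<lambda>\<omega>. absorption_time (\<lambda>t. X t \<omega>)) \<in> borel_measurable F"
proof -
  interpret path_process F X by fact
  have ev: "{\<omega> \<in> space F. X (real_of_rat q) \<omega> = None} \<in> sets F" if "0 \<le> q" for q
    using measurable_sets[OF X_measurable[of "real_of_rat q"], of "{None}"] that
    by (simp add: vimage_def Int_def conj_commute)
  have rat: "\<exists>q. 0 \<le> q \<and> real_of_rat q < c \<and> X (real_of_rat q) \<omega> = None"
    if \<omega>: "\<omega> \<in> space F" and t: "0 \<le> t" "X t \<omega> = None" "t < c" for \<omega> t c
  proof -
    obtain e where e: "0 < e" "\<And>u. t \<le> u \<Longrightarrow> u < t + e \<Longrightarrow> X u \<omega> = X t \<omega>"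
      using jump_path_rightE[OF X_path[OF \<omega>] t(1)] by metis
    obtain q where q: "t < real_of_rat q" "real_of_rat q < min (t + e) c"
      using of_rat_dense[of t "min (t + e) c"] e(1) t(3) by auto
    then have "0 \<le> real_of_rat q" using t(1) by linarith
    then have "0 \<le> q" by simp
    moreover have "X (real_of_rat q) \<omega> = None" using e(2)[of "real_of_rat q"] q t(2) by simp
    ultimately show ?thesis using q by auto
  qed
  define Q :: "rat set" where "Q = {q. 0 \<le> q}"
  define E where "E = (\<Union>q\<in>Q. {\<omega> \<in> space F. X (real_of_rat q) \<omega> = None})"
  have E: "E \<in> sets F" unfolding E_def Q_def by (intro sets.countable_UN') (auto intro: ev)
  have hit: "\<omega> \<in> E \<longleftrightarrow> (\<exists>t\<ge>0. X t \<omega> = None)" if \<omega>: "\<omega> \<in> space F" for \<omega>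
  proof
    assume "\<omega> \<in> E"
    then obtain q where "0 \<le> q" "X (real_of_rat q) \<omega> = None" by (auto simp: E_def Q_def)
    then show "\<exists>t\<ge>0. X t \<omega> = None" by (intro exI[of _ "real_of_rat q"]) simp
  next
    assume "\<exists>t\<ge>0. X t \<omega> = None"
    then obtain t where "0 \<le> t" "X t \<omega> = None" by auto
    from rat[OF \<omega> this, of "t + 1"] show "\<omega> \<in> E" using \<omega> by (auto simp: E_def Q_def)
  qed
  have "{\<omega> \<in> space F. absorption_time (\<lambda>t. X t \<omega>) < c} \<in> sets F" for c
  proof -
    let ?U = "\<Union>q\<in>{q \<in> Q. real_of_rat q < c}. {\<omega> \<in> space F. X (real_of_rat q) \<omega> = None}"
    let ?V = "if Inf {} < c then space F - E else {}"
    have "{\<omega> \<in> space F. absorption_time (\<lambda>t. X t \<omega>) < c} = ?U \<union> ?V"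
    proof (rule set_eqI)
      fix \<omega>
      show "\<omega> \<in> {\<omega> \<in> space F. absorption_time (\<lambda>t. X t \<omega>) < c} \<longleftrightarrow> \<omega> \<in> ?U \<union> ?V"
      proof (cases "\<omega> \<in> space F")
        case \<omega>: True
        show ?thesis
        proof (cases "\<omega> \<in> E")
          case True
          then have ne: "{t. 0 \<le> t \<and> X t \<omega> = None} \<noteq> {}" using hit[OF \<omega>] by auto
          have "absorption_time (\<lambda>t. X t \<omega>) < c \<longleftrightarrow> (\<exists>t. 0 \<le> t \<and> X t \<omega> = None \<and> t < c)"
            unfolding absorption_time_def
            by (subst cInf_less_iff[OF ne]) (auto intro: bdd_belowI[of _ 0])
          also have "\<dots> \<longleftrightarrow> \<omega> \<in> ?U"
          proof
            assume "\<exists>t. 0 \<le> t \<and> X t \<omega> = None \<and> t < c"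
            then show "\<omega> \<in> ?U" using rat[OF \<omega>] \<omega> by (auto simp: Q_def)
          next
            assume "\<omega> \<in> ?U"
            then obtain q where "0 \<le> q" "real_of_rat q < c" "X (real_of_rat q) \<omega> = None" by (auto simp: Q_def)
            then show "\<exists>t. 0 \<le> t \<and> X t \<omega> = None \<and> t < c" by (intro exI[of _ "real_of_rat q"]) simp
          qed
          finally show ?thesis using \<omega> True by auto
        next
          case False
          then have "{t. 0 \<le> t \<and> X t \<omega> = None} = {}" using hit[OF \<omega>] by auto
          then have "absorption_time (\<lambda>t. X t \<omega>) = Inf {}" by (simp only: absorption_time_def)
          moreover have "\<omega> \<notin> ?U" using False by (auto simp: E_def)
          ultimately show ?thesis using \<omega> False by auto
        qed
      qed auto
    qed
    moreover have "?U \<in> sets F" by (intro sets.countable_UN') (auto intro: ev simp: Q_def)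
    moreover have "?V \<in> sets F" using E by auto
    ultimately show ?thesis by simp
  qed
  then show ?thesis by (simp add: borel_measurable_iff_less)
qed

lemma borel_measure_eqI_atMost:
  fixes M1 M2 :: "real measure"
  assumes sets: "sets M1 = sets borel" "sets M2 = sets borel"
    and eq: "\<And>t. emeasure M1 {..t} = emeasure M2 {..t}" and fin: "\<And>t. emeasure M1 {..t} < \<infinity>"
  shows "M1 = M2"
proof (rule measure_eqI_generator_eq)
  let ?E = "range (\<lambda>t::real. {..t})"
  show "Int_stable ?E"
    unfolding Int_stable_def by (auto simp: Int_atMost)
  show "sets M1 = sigma_sets UNIV ?E" "sets M2 = sigma_sets UNIV ?E"
    using sets unfolding borel_eq_atMost by auto
  show "range (\<lambda>n. {..real n}) \<subseteq> ?E" by auto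
  show "(\<Union>n. {..real n}) = UNIV" using real_arch_simple by auto
  show "emeasure M1 {..real n} \<noteq> \<infinity>" for n using fin[of "real n"] by auto
  show "emeasure M1 Y = emeasure M2 Y" if "Y \<in> ?E" for Y using eq that by auto
qed auto

context time_grid
begin

lemma cell_cut:
  assumes "k \<in> {1..K}"
  obtains \<gamma> where "pt (k - 1) \<le> \<gamma>" "cell s k \<inter> {..t} = {pt (k - 1)<..\<gamma>}"
proof (rule that)
  let ?\<gamma> = "max (pt (k - 1)) (if k < K then min (pt k) t else t)"
  show "pt (k - 1) \<le> ?\<gamma>" by simp
  show "cell s k \<inter> {..t} = {pt (k - 1)<..?\<gamma>}"
    using assms by (auto simp: cell_iff max_def min_def split: if_splits)
qed

lemma jump_number_cell_SUP:
  "jump_number x R (cell s k) = (SUP n::nat. jump_number x R (cell s k \<inter> {..real n}))"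
proof (rule jump_number_SUP)
  show "incseq (\<lambda>n. cell s k \<inter> {..real n})" by (auto simp: incseq_def)
  show "(\<Union>n::nat. cell s k \<inter> {..real n}) = cell s k" using real_arch_simple by auto
qed

lemma jump_number_cut_measurable:
  fixes X :: "real \<Rightarrow> 'w \<Rightarrow> 's::finite"
  assumes X: "path_process F X" and k: "k \<in> {1..K}" and R: "irreflp R"
  shows "(\<lambda>\<omega>. jump_number (\<lambda>t. X t \<omega>) R (cell s k \<inter> {..c})) \<in> borel_measurable F"
proof -
  obtain \<gamma> where \<gamma>: "pt (k - 1) \<le> \<gamma>" "cell s k \<inter> {..c} = {pt (k - 1)<..\<gamma>}" by (rule cell_cut[OF k])
  have "0 \<le> pt (k - 1)" using k by (intro pt_nonneg) auto
  then show ?thesis unfolding \<gamma>(2) by (rule path_process.jump_number_measurable[OF X R _ \<gamma>(1)])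
qed

lemma jump_number_cell_measurable:
  fixes X :: "real \<Rightarrow> 'w \<Rightarrow> 's::finite"
  assumes "path_process F X" "k \<in> {1..K}" "irreflp R"
  shows "(\<lambda>\<omega>. jump_number (\<lambda>t. X t \<omega>) R (cell s k)) \<in> borel_measurable F"
  unfolding jump_number_cell_SUP[of _ R]
  by (intro borel_measurable_SUP jump_number_cut_measurable assms) auto

end

lemma (in time_grid) sub_intensity_on_cell:
  assumes T: "\<And>t. 0 \<le> t \<Longrightarrow> sub_intensity_matrix (T t)"
    and Tk: "\<And>k t. k \<in> {1..K} \<Longrightarrow> t \<in> cell s k \<Longrightarrow> T t = Tk k" and k: "k \<in> {1..K}"
  shows "sub_intensity_matrix (Tk k)"
proof -
  have "\<exists>x. x \<in> cell s k"
  proof (cases "k = K")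
    case True
    then show ?thesis using k by (intro exI[of _ "pt (k - 1) + 1"]) (auto simp: cell_iff)
  next
    case False
    then show ?thesis using k pt_mem_cell[of k] by auto
  qed
  then obtain x where x: "x \<in> cell s k" by auto
  then show ?thesis using T[of x] Tk[OF k x] cell_pos[OF k x] by simp
qed

text \<open>The quantities in this locale depend on the parameters, but on no process: they are shared by the
  \<open>N\<close> copies.\<close>

locale rate_data = time_grid K s for K :: nat and s :: "nat \<Rightarrow> ereal" +
  fixes Tk :: "nat \<Rightarrow> real ^ 'p::finite ^ 'p" and \<pi> :: "real ^ 'p"
  assumes sub_intensity_Tk: "\<And>k. k \<in> {1..K} \<Longrightarrow> sub_intensity_matrix (Tk k)"
    and prob_vec: "probability_vector \<pi>"
begin

abbreviation Q :: "real \<Rightarrow> real \<Rightarrow> real ^ 'p ^ 'p" where "Q \<equiv> P_bar K s Tk"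

definition ex :: "real \<Rightarrow> real ^ 'p" where "ex x = exit_rates (Tk (cell_index K s x))"

text \<open>The density at \<open>x\<close> of the absorption time of a path that is in state \<open>j\<close> at time \<open>v\<close>.\<close>

definition exit_density :: "'p \<Rightarrow> real \<Rightarrow> real \<Rightarrow> real" where
  "exit_density j v x = (Q v x *v ex x) $ j"

lemma ex_nonneg: "0 \<le> x \<Longrightarrow> 0 \<le> ex x $ i"
proof -
  assume "0 \<le> x"
  from sub_intensity_Tk[OF cell_index_mem[OF this]]
  show ?thesis by (simp add: ex_def exit_rates_def sub_intensity_matrix_def matrix_vector_mult_def)
qed

lemma Q_nonneg: "0 \<le> u \<Longrightarrow> u \<le> t \<Longrightarrow> 0 \<le> Q u t $ i $ j"
  by (rule P_bar_nonneg[OF sub_intensity_Tk])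

lemma exit_density_nonneg: "0 \<le> v \<Longrightarrow> v \<le> x \<Longrightarrow> 0 \<le> exit_density j v x"
  unfolding exit_density_def matrix_vector_mult_def
  by (auto intro!: sum_nonneg mult_nonneg_nonneg Q_nonneg ex_nonneg)

lemma exit_density_measurable [measurable (raw)]:
  assumes "f \<in> borel_measurable N" "g \<in> borel_measurable N"
  shows "(\<lambda>z. exit_density j (f z) (g z)) \<in> borel_measurable N"
  unfolding exit_density_def matrix_vector_mult_def ex_def vec_lambda_beta
  by (intro borel_measurable_sum borel_measurable_times P_bar_measurable exit_rates_measurable assms)

lemma exit_density_pair_measurable:
  "(\<lambda>z. indicator {fst z<..} (snd z) * ennreal (exit_density j (fst z) (snd z)))
    \<in> borel_measurable (lborel \<Otimes>\<^sub>M (lborel :: real measure))"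
proof -
  have [measurable]: "(\<lambda>z. exit_density j (fst z) (snd z)) \<in> borel_measurable (lborel \<Otimes>\<^sub>M lborel)"
    by (rule exit_density_measurable) simp_all
  have "(\<lambda>z. if fst z < snd z then ennreal (exit_density j (fst z) (snd z)) else 0)
      \<in> borel_measurable (lborel \<Otimes>\<^sub>M (lborel :: real measure))"
    by measurable
  moreover have "(if fst z < snd z then ennreal (exit_density j (fst z) (snd z)) else 0) =
      indicator {fst z<..} (snd z) * ennreal (exit_density j (fst z) (snd z))" for z :: "real \<times> real"
    by (simp add: indicator_def)
  ultimately show ?thesis by simp
qed

text \<open>The conditional probability of \<open>\<tau> \<in> A\<close> given that the state at time \<open>v\<close> is \<open>j\<close>.\<close>

definition exit_prob :: "'p \<Rightarrow> real set \<Rightarrow> real \<Rightarrow> ennreal" where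
  "exit_prob j A v = (\<integral>\<^sup>+x. indicator A x * (indicator {v<..} x * ennreal (exit_density j v x)) \<partial>lborel)"

lemma exit_prob_measurable: "A \<in> sets borel \<Longrightarrow> exit_prob j A \<in> borel_measurable borel"
proof -
  assume A: "A \<in> sets borel"
  have "(\<lambda>(v, x). indicator A x * (indicator {v<..} x * ennreal (exit_density j v x))) \<in>
      borel_measurable (lborel \<Otimes>\<^sub>M lborel)"
    using exit_density_pair_measurable[of j] A by (simp add: case_prod_beta')
  from lborel.borel_measurable_nn_integral[OF this] show ?thesis
    unfolding exit_prob_def by simp
qed

definition abs_density :: "real \<Rightarrow> real" where
  "abs_density x = (\<Sum>i\<in>UNIV. \<pi> $ i * exit_density i 0 x)"

lemma abs_density_nonneg: "0 \<le> x \<Longrightarrow> 0 \<le> abs_density x"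
  using prob_vec unfolding abs_density_def probability_vector_def
  by (intro sum_nonneg mult_nonneg_nonneg exit_density_nonneg) auto

lemma abs_density_measurable: "abs_density \<in> borel_measurable borel"
  unfolding abs_density_def by (intro borel_measurable_sum borel_measurable_times exit_density_measurable) simp_all

text \<open>The numerators for sojourn times (\<open>i = j\<close> and \<open>c = 1\<close>) and for transitions from \<open>i\<close> to \<open>j\<close>
  (\<open>c\<close> the intensity), where \<open>S\<close> is a cell.\<close>

definition visit_density :: "'p \<Rightarrow> 'p \<Rightarrow> real \<Rightarrow> real set \<Rightarrow> real \<Rightarrow> ennreal" where
  "visit_density i j c S x =
     (\<integral>\<^sup>+u. indicator S u * (indicator {u<..} x * ennreal ((\<pi> v* Q 0 u) $ i * c * exit_density j u x)) \<partial>lborel)"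

lemma visit_density_measurable:
  assumes [measurable]: "S \<in> sets borel"
  shows "visit_density i j c S \<in> borel_measurable borel"
proof -
  have [measurable]: "(\<lambda>z. exit_density j (snd z) (fst z)) \<in> borel_measurable (lborel \<Otimes>\<^sub>M lborel)"
    by (rule exit_density_measurable) simp_all
  have [measurable]: "(\<lambda>z. (\<pi> v* Q 0 (snd z)) $ i) \<in> borel_measurable (lborel \<Otimes>\<^sub>M (lborel :: real measure))"
    unfolding vector_matrix_mult_def vec_lambda_beta
    by (intro borel_measurable_sum borel_measurable_times P_bar_measurable borel_measurable_const) simp_all
  have "(\<lambda>z. indicator S (snd z) * (if snd z < fst z then ennreal ((\<pi> v* Q 0 (snd z)) $ i * c * exit_density j (snd z) (fst z)) else 0))
      \<in> borel_measurable (lborel \<Otimes>\<^sub>M (lborel :: real measure))"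
    by measurable
  moreover have "(if snd z < fst z then ennreal ((\<pi> v* Q 0 (snd z)) $ i * c * exit_density j (snd z) (fst z)) else 0) =
      indicator {snd z<..} (fst z) * ennreal ((\<pi> v* Q 0 (snd z)) $ i * c * exit_density j (snd z) (fst z))" for z :: "real \<times> real"
    by (simp add: indicator_def)
  ultimately have "(\<lambda>(x, u). indicator S u * (indicator {u<..} x * ennreal ((\<pi> v* Q 0 u) $ i * c * exit_density j u x)))
      \<in> borel_measurable (lborel \<Otimes>\<^sub>M lborel)" by (simp add: case_prod_beta')
  from lborel.borel_measurable_nn_integral[OF this] show ?thesis
    unfolding visit_density_def by simp
qed

end

locale phase_type = rate_data K s Tk \<pi> + markov_rates M X "\<lambda>t. intensity_matrix (Tf t)" P L
  for K :: nat and s :: "nat \<Rightarrow> ereal" and Tk :: "nat \<Rightarrow> real ^ 'p::finite ^ 'p" and \<pi> :: "real ^ 'p"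
    and M :: "'w measure" and X :: "real \<Rightarrow> 'w \<Rightarrow> 'p option"
    and Tf :: "real \<Rightarrow> real ^ 'p ^ 'p" and P :: "real \<Rightarrow> real \<Rightarrow> real ^ 'p option ^ 'p option" and L :: real +
  assumes Tf_cell: "\<And>k t. k \<in> {1..K} \<Longrightarrow> t \<in> cell s k \<Longrightarrow> Tf t = Tk k"
    and initial: "\<And>a. \<P>(\<omega> in M. X 0 \<omega> = a) = initial_vector \<pi> $ a"
    and hits: "AE \<omega> in M. \<exists>t\<ge>0. X t \<omega> = None"
begin

abbreviation \<tau> :: "'w \<Rightarrow> real" where "\<tau> \<omega> \<equiv> absorption_time (\<lambda>t. X t \<omega>)"

lemma \<tau>_measurable [measurable]: "\<tau> \<in> borel_measurable M"
  by (rule absorption_time_measurable) (rule path_process_axioms)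

lemma Tf_eq: "0 < t \<Longrightarrow> Tf t = Tk (cell_index K s t)"
  using Tf_cell[of "cell_index K s t" t] cell_index_mem[of t] cell_index_cell[of t] by simp

lemma intensity_entry:
  "intensity_matrix A $ None $ b = 0" "intensity_matrix A $ Some i $ None = exit_rates A $ i"
  "intensity_matrix A $ Some i $ Some j = A $ i $ j"
  by (simp_all add: intensity_matrix_def)

lemma intensity_row_sum: "(\<Sum>b\<in>UNIV. intensity_matrix A $ a $ b) = 0"
  by (cases a) (simp_all add: sum_option intensity_entry exit_rates_def matrix_vector_mult_def)

lemma P_entry_integral:
  assumes "0 \<le> u" "u \<le> t"
  shows "((\<lambda>w. \<Sum>c\<in>UNIV. P u w $ a $ c * intensity_matrix (Tf w) $ c $ b) has_integral
    (P u t $ a $ b - (if a = b then 1 else 0))) {u..t}"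
proof -
  have "((\<lambda>w. P u w ** intensity_matrix (Tf w)) has_integral (P u t - mat 1)) {u..t}"
    using forward assms by (simp add: forward_solution_def)
  from has_integral_linear[OF this bounded_linear_compose[OF bounded_linear_vec_nth bounded_linear_vec_nth], of a b]
  show ?thesis by (simp add: o_def mat_def matrix_matrix_mult_def)
qed

lemma P_refl: "0 \<le> u \<Longrightarrow> P u u $ a $ b = (if a = b then 1 else 0)"
  using integral_unique[OF P_entry_integral[of u u a b]] by simp

text \<open>The absorbing state has intensity \<open>0\<close>, so the columns of the transient states satisfy an equation of
  their own. For the row of the absorbing state its initial value is zero.\<close>

lemma P_Some:
  assumes "0 \<le> u" "u \<le> t"
  shows "P u t $ a $ Some j = (\<Sum>i\<in>UNIV. P u u $ a $ Some i * Q u t $ i $ j)"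
proof (rule forward_equation_unique[OF assms Tf_cell])
  fix t j assume t: "u \<le> t"
  have "(\<Sum>c\<in>UNIV. P u w $ a $ c * intensity_matrix (Tf w) $ c $ Some j) =
      (\<Sum>k\<in>UNIV. P u w $ a $ Some k * Tf w $ k $ j)" for w
    by (simp add: sum_option intensity_entry)
  with P_entry_integral[OF assms(1) t, of a "Some j"]
  show "((\<lambda>w. \<Sum>k\<in>UNIV. P u w $ a $ Some k * Tf w $ k $ j) has_integral
      (P u t $ a $ Some j - P u u $ a $ Some j)) {u..t}"
    by (simp add: P_refl[OF assms(1)])
qed auto

lemma P_Some_Some:
  assumes "0 \<le> u" "u \<le> t"
  shows "P u t $ Some i $ Some j = Q u t $ i $ j"
proof -
  have "P u t $ Some i $ Some j = (\<Sum>l\<in>UNIV. if i = l then Q u t $ l $ j else 0)"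
    unfolding P_Some[OF assms] by (intro sum.cong) (auto simp: P_refl assms(1))
  then show ?thesis by simp
qed

lemma P_None_Some: "0 \<le> u \<Longrightarrow> u \<le> t \<Longrightarrow> P u t $ None $ Some j = 0"
  by (simp add: P_Some P_refl)

lemma P_row_sum:
  assumes "0 \<le> u" "u \<le> t"
  shows "(\<Sum>b\<in>UNIV. P u t $ a $ b) = 1"
proof -
  have "((\<lambda>w. \<Sum>b\<in>UNIV. \<Sum>c\<in>UNIV. P u w $ a $ c * intensity_matrix (Tf w) $ c $ b) has_integral
      (\<Sum>b\<in>UNIV. P u t $ a $ b - (if a = b then 1 else 0))) {u..t}"
    by (intro has_integral_sum P_entry_integral assms) auto
  moreover have "(\<Sum>b\<in>UNIV. \<Sum>c\<in>UNIV. P u w $ a $ c * intensity_matrix (Tf w) $ c $ b) = 0" for w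
    by (subst sum.swap) (simp add: sum_distrib_left[symmetric] intensity_row_sum)
  ultimately have "((\<lambda>w. 0) has_integral (\<Sum>b\<in>UNIV. P u t $ a $ b - (if a = b then 1 else 0))) {u..t}"
    by simp
  then have "(\<Sum>b\<in>UNIV. P u t $ a $ b - (if a = b then 1 else 0)) = 0"
    using has_integral_unique has_integral_0 by blast
  then show ?thesis by (simp add: sum_subtractf)
qed

text \<open>The forward equation for the column of the absorbing state. It involves the rates at time \<open>0\<close>, which
  lies in no cell, hence the exceptional point.\<close>

lemma exit_density_has_integral:
  assumes "0 \<le> v" "v \<le> t"
  shows "(exit_density j v has_integral P v t $ Some j $ None) {v..t}"
proof (rule has_integral_spike_finite[of "{0}"])
  show "((\<lambda>w. \<Sum>c\<in>UNIV. P v w $ Some j $ c * intensity_matrix (Tf w) $ c $ None) has_integral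
      P v t $ Some j $ None) {v..t}"
    using P_entry_integral[OF assms, of "Some j" None] by simp
  show "exit_density j v w = (\<Sum>c\<in>UNIV. P v w $ Some j $ c * intensity_matrix (Tf w) $ c $ None)"
    if "w \<in> {v..t} - {0}" for w
    using that assms Tf_eq[of w]
    by (simp add: sum_option intensity_entry P_Some_Some exit_density_def ex_def matrix_vector_mult_def)
qed simp

lemma P_None_nonneg: "0 \<le> v \<Longrightarrow> v \<le> t \<Longrightarrow> 0 \<le> P v t $ Some i $ None"
  by (rule has_integral_nonneg[OF exit_density_has_integral]) (auto intro: exit_density_nonneg)

lemma P_None_le_1:
  assumes "0 \<le> u" "u \<le> t"
  shows "P u t $ Some i $ None \<le> 1"
proof -
  have "0 \<le> (\<Sum>j\<in>UNIV. Q u t $ i $ j)" by (intro sum_nonneg Q_nonneg assms)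
  then show ?thesis using P_row_sum[OF assms, of "Some i"] by (simp add: sum_option P_Some_Some assms)
qed

lemma exit_density_integral:
  assumes "0 \<le> v" "v \<le> t"
  shows "(\<integral>\<^sup>+x. indicator {v<..t} x * ennreal (exit_density j v x) \<partial>lborel) = ennreal (P v t $ Some j $ None)"
proof -
  note exit_density_has_integral[OF assms, of j]
  from this have "(\<integral>\<^sup>+x. ennreal (exit_density j v x) * indicator {v..t} x \<partial>lborel) = ennreal (P v t $ Some j $ None)"
    using assms by (intro nn_integral_has_integral_lebesgue' exit_density_nonneg) auto
  moreover have "(\<integral>\<^sup>+x. ennreal (exit_density j v x) * indicator {v..t} x \<partial>lborel) =
      (\<integral>\<^sup>+x. indicator {v<..t} x * ennreal (exit_density j v x) \<partial>lborel)"
  proof (rule nn_integral_cong_AE)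
    have "AE x in lborel. x \<noteq> v" by (rule AE_lborel_singleton)
    then show "AE x in lborel. ennreal (exit_density j v x) * indicator {v..t} x =
        indicator {v<..t} x * ennreal (exit_density j v x)"
      by eventually_elim (auto simp: indicator_def)
  qed
  ultimately show ?thesis by simp
qed

text \<open>Absorption is only almost surely permanent; right-continuity reduces this to rational times.\<close>

lemma AE_absorbed: "AE \<omega> in M. \<forall>u t. 0 \<le> u \<and> u \<le> t \<and> X u \<omega> = None \<longrightarrow> X t \<omega> = None"
proof -
  have null: "AE \<omega> in M. \<not> (X u \<omega> = None \<and> X t \<omega> = Some j)" if "0 \<le> u" "u \<le> t" for u t j
  proof (rule AE_I'[of "{\<omega> \<in> space M. X u \<omega> = None \<and> X t \<omega> = Some j}"])
    have "joint None (Some j) u t = 0" using that by (simp add: joint_eq P_None_Some)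
    then show "{\<omega> \<in> space M. X u \<omega> = None \<and> X t \<omega> = Some j} \<in> null_sets M"
      using that state_event2[of u t "\<lambda>x y. x = None \<and> y = Some j"]
      by (auto simp: joint_def emeasure_eq_measure null_sets_def)
  qed auto
  have "AE \<omega> in M. \<forall>q r :: rat. \<forall>j. 0 \<le> q \<longrightarrow> q \<le> r \<longrightarrow>
      \<not> (X (real_of_rat q) \<omega> = None \<and> X (real_of_rat r) \<omega> = Some j)"
    unfolding AE_all_countable
  proof (intro allI)
    fix q r :: rat and j
    show "AE \<omega> in M. 0 \<le> q \<longrightarrow> q \<le> r \<longrightarrow> \<not> (X (real_of_rat q) \<omega> = None \<and> X (real_of_rat r) \<omega> = Some j)"
    proof (cases "0 \<le> q \<and> q \<le> r")
      case True
      then show ?thesis using null[of "real_of_rat q" "real_of_rat r" j] by (simp add: of_rat_less_eq)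
    qed auto
  qed
  with AE_space show ?thesis
  proof eventually_elim
    case (elim \<omega>)
    show ?case
    proof (intro allI impI, elim conjE)
      fix u t assume ut: "0 \<le> u" "u \<le> t" "X u \<omega> = None"
      show "X t \<omega> = None"
      proof (rule ccontr)
        assume "X t \<omega> \<noteq> None"
        then obtain j where j: "X t \<omega> = Some j" by auto
        then have "u < t" using ut by (cases "u = t") auto
        obtain e1 where e1: "0 < e1" "\<And>w. u \<le> w \<Longrightarrow> w < u + e1 \<Longrightarrow> X w \<omega> = X u \<omega>"
          using jump_path_rightE[OF X_path[OF elim(1)] ut(1)] by metis
        obtain e2 where e2: "0 < e2" "\<And>w. t \<le> w \<Longrightarrow> w < t + e2 \<Longrightarrow> X w \<omega> = X t \<omega>"
          using jump_path_rightE[OF X_path[OF elim(1)], of t] ut by (metis order_trans)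
        obtain q where q: "u < real_of_rat q" "real_of_rat q < min t (u + e1)"
          using of_rat_dense[of u "min t (u + e1)"] \<open>u < t\<close> e1(1) by auto
        obtain r where r: "t < real_of_rat r" "real_of_rat r < t + e2"
          using of_rat_dense[of t "t + e2"] e2(1) by auto
        have "0 \<le> real_of_rat q" "real_of_rat q \<le> real_of_rat r" using q r ut by linarith+
        then have "0 \<le> q" "q \<le> r" by (simp_all add: of_rat_less_eq)
        moreover have "X (real_of_rat q) \<omega> = None" using e1(2)[of "real_of_rat q"] q ut by simp
        moreover have "X (real_of_rat r) \<omega> = Some j" using e2(2)[of "real_of_rat r"] r j by simp
        ultimately show False using elim(2) by blast
      qed
    qed
  qed
qed

text \<open>The pathwise arguments below are restricted to these paths, which have probability one.\<close>

definition regular :: "'w \<Rightarrow> bool" where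
  "regular \<omega> \<longleftrightarrow> \<omega> \<in> space M \<and> 0 < \<tau> \<omega> \<and> (\<forall>t\<ge>0. X t \<omega> = None \<longleftrightarrow> \<tau> \<omega> \<le> t)"

lemma AE_regular: "AE \<omega> in M. regular \<omega>"
proof -
  have "AE \<omega> in M. X 0 \<omega> \<noteq> None"
  proof (rule AE_I'[of "{\<omega> \<in> space M. X 0 \<omega> = None}"])
    show "{\<omega> \<in> space M. X 0 \<omega> = None} \<in> null_sets M"
      using initial[of None] state_event[of 0 None]
      by (simp add: null_sets_def emeasure_eq_measure initial_vector_def)
  qed auto
  with AE_space AE_absorbed hits show ?thesis
  proof eventually_elim
    case (elim \<omega>)
    let ?S = "{t. 0 \<le> t \<and> X t \<omega> = None}"
    have ne: "?S \<noteq> {}" and bdd: "bdd_below ?S" using elim by (auto intro: bdd_belowI[of _ 0])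
    have \<tau>0: "0 \<le> \<tau> \<omega>" unfolding absorption_time_def using ne by (intro cInf_greatest) auto
    have "X (\<tau> \<omega>) \<omega> = None"
    proof -
      obtain e where e: "0 < e" "\<And>u. \<tau> \<omega> \<le> u \<Longrightarrow> u < \<tau> \<omega> + e \<Longrightarrow> X u \<omega> = X (\<tau> \<omega>) \<omega>"
        using jump_path_rightE[OF X_path[OF elim(1)] \<tau>0] by metis
      have "Inf ?S < \<tau> \<omega> + e" using e(1) by (simp add: absorption_time_def)
      then obtain t where t: "t \<in> ?S" "t < \<tau> \<omega> + e" unfolding cInf_less_iff[OF ne bdd] by auto
      have "\<tau> \<omega> \<le> t" unfolding absorption_time_def by (rule cInf_lower[OF t(1) bdd])
      then show ?thesis using e(2)[of t] t by auto
    qed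
    moreover have "\<tau> \<omega> \<le> t" if "0 \<le> t" "X t \<omega> = None" for t
      unfolding absorption_time_def using that by (intro cInf_lower bdd) auto
    ultimately have "X t \<omega> = None \<longleftrightarrow> \<tau> \<omega> \<le> t" if "0 \<le> t" for t
      using elim(2) that \<tau>0 by blast
    moreover have "\<tau> \<omega> \<noteq> 0" using \<open>X (\<tau> \<omega>) \<omega> = None\<close> elim(4) by auto
    ultimately show ?case using \<tau>0 elim(1) by (auto simp: regular_def)
  qed
qed

text \<open>The Markov property for the absorption time. It suffices to compare both sides for \<open>A = {..t}\<close>, where
  \<open>\<tau> \<le> t\<close> means almost surely that the state at time \<open>t\<close> is the absorbing one.\<close>

lemma cylinder_absorption:
  assumes v: "0 \<le> v" and F: "finite F" "F \<subseteq> {0..<v}" and y: "y v = Some j" and A: "A \<in> sets borel"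
  shows "emeasure M {\<omega> \<in> space M. (\<forall>r\<in>insert v F. X r \<omega> = y r) \<and> \<tau> \<omega> \<in> A} =
    emeasure M {\<omega> \<in> space M. \<forall>r\<in>insert v F. X r \<omega> = y r} * exit_prob j A v"
proof -
  define H where "H = {\<omega> \<in> space M. \<forall>r\<in>insert v F. X r \<omega> = y r}"
  have H: "H \<in> sets M" unfolding H_def by (rule cylinder_event) (use F v in force)+
  define N1 where "N1 = distr (density M (indicator H)) borel \<tau>"
  define N2 where "N2 = density lborel (\<lambda>x. emeasure M H * (indicator {v<..} x * ennreal (exit_density j v x)))"
  have dens: "(\<lambda>x. emeasure M H * (indicator {v<..} x * ennreal (exit_density j v x))) \<in> borel_measurable lborel"
    using exit_density_measurable[of "\<lambda>_. v" lborel "\<lambda>x. x" j] by simp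
  have \<tau>_dens: "\<tau> \<in> measurable (density M (indicator H)) borel" using \<tau>_measurable by simp
  have N1: "emeasure N1 B = emeasure M {\<omega> \<in> space M. \<omega> \<in> H \<and> \<tau> \<omega> \<in> B}" if B: "B \<in> sets borel" for B
  proof -
    have ev: "\<tau> -` B \<inter> space M \<in> sets M" using B \<tau>_measurable by (rule measurable_sets[rotated])
    have "emeasure N1 B = (\<integral>\<^sup>+\<omega>. indicator H \<omega> * indicator (\<tau> -` B \<inter> space M) \<omega> \<partial>M)"
      unfolding N1_def using B H ev by (simp add: emeasure_distr[OF \<tau>_dens] emeasure_density)
    also have "\<dots> = (\<integral>\<^sup>+\<omega>. indicator (H \<inter> (\<tau> -` B \<inter> space M)) \<omega> \<partial>M)"
      by (intro nn_integral_cong) (simp add: indicator_inter_arith)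
    also have "\<dots> = emeasure M (H \<inter> (\<tau> -` B \<inter> space M))" using H ev by (intro nn_integral_indicator) auto
    also have "H \<inter> (\<tau> -` B \<inter> space M) = {\<omega> \<in> space M. \<omega> \<in> H \<and> \<tau> \<omega> \<in> B}" by auto
    finally show ?thesis .
  qed
  have N2: "emeasure N2 B = emeasure M H * exit_prob j B v" if B: "B \<in> sets borel" for B
  proof -
    have "emeasure N2 B = (\<integral>\<^sup>+x. emeasure M H * (indicator B x * (indicator {v<..} x * ennreal (exit_density j v x))) \<partial>lborel)"
      unfolding N2_def using B dens by (simp add: emeasure_density mult_ac)
    also have "\<dots> = emeasure M H * exit_prob j B v"
      unfolding exit_prob_def using exit_density_measurable[of "\<lambda>_. v" lborel "\<lambda>x. x" j] B
      by (intro nn_integral_cmult) simp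
    finally show ?thesis .
  qed
  have "N1 = N2"
  proof (rule borel_measure_eqI_atMost)
    fix t
    show "emeasure N1 {..t} < \<infinity>" unfolding N1[OF atMost_borel] by (simp add: emeasure_eq_measure)
    show "emeasure N1 {..t} = emeasure N2 {..t}"
    proof (cases "v \<le> t")
      case True
      have "emeasure N1 {..t} = emeasure M {\<omega> \<in> space M. (\<forall>r\<in>insert v F. X r \<omega> = y r) \<and> X t \<omega> = None}"
        unfolding N1[OF atMost_borel]
      proof (rule emeasure_eq_AE)
        show "AE \<omega> in M. \<omega> \<in> {\<omega> \<in> space M. \<omega> \<in> H \<and> \<tau> \<omega> \<in> {..t}} \<longleftrightarrow>
            \<omega> \<in> {\<omega> \<in> space M. (\<forall>r\<in>insert v F. X r \<omega> = y r) \<and> X t \<omega> = None}"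
          using AE_regular
        proof eventually_elim
          case (elim \<omega>)
          then have "X t \<omega> = None \<longleftrightarrow> \<tau> \<omega> \<le> t" using True v by (simp add: regular_def)
          then show ?case by (simp add: H_def)
        qed
        show "{\<omega> \<in> space M. \<omega> \<in> H \<and> \<tau> \<omega> \<in> {..t}} \<in> sets M"
        proof -
          have "{\<omega> \<in> space M. \<omega> \<in> H \<and> \<tau> \<omega> \<in> {..t}} = H \<inter> (\<tau> -` {..t} \<inter> space M)"
            using sets.sets_into_space[OF H] by auto
          then show ?thesis using H measurable_sets[OF \<tau>_measurable, of "{..t}"] by auto
        qed
        show "{\<omega> \<in> space M. (\<forall>r\<in>insert v F. X r \<omega> = y r) \<and> X t \<omega> = None} \<in> sets M"
        proof -
          have "{\<omega> \<in> space M. (\<forall>r\<in>insert v F. X r \<omega> = y r) \<and> X t \<omega> = None} = H \<inter> {\<omega> \<in> space M. X t \<omega> = None}"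
            unfolding H_def by blast
          then show ?thesis using H state_event[of t None] True v by (auto intro: sets.Int)
        qed
      qed
      also have "\<dots> = emeasure M H * ennreal (P v t $ Some j $ None)"
        unfolding H_def emeasure_eq_measure cylinder_transition[OF v True F] y
        by (rule ennreal_mult'') (rule P_None_nonneg[OF v True])
      also have "ennreal (P v t $ Some j $ None) = exit_prob j {..t} v"
        unfolding exit_density_integral[OF v True, symmetric] exit_prob_def
        by (intro nn_integral_cong) (auto simp: indicator_def)
      finally show ?thesis by (simp only: N2[OF atMost_borel])
    next
      case False
      have "emeasure N1 {..t} = emeasure M {}"
        unfolding N1[OF atMost_borel]
      proof (rule emeasure_eq_AE)
        show "AE \<omega> in M. \<omega> \<in> {\<omega> \<in> space M. \<omega> \<in> H \<and> \<tau> \<omega> \<in> {..t}} \<longleftrightarrow> \<omega> \<in> {}"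
          using AE_regular
        proof eventually_elim
          case (elim \<omega>)
          then have "X v \<omega> = None \<longleftrightarrow> \<tau> \<omega> \<le> v" using v by (simp add: regular_def)
          then show ?case using False y by (auto simp: H_def)
        qed
        show "{\<omega> \<in> space M. \<omega> \<in> H \<and> \<tau> \<omega> \<in> {..t}} \<in> sets M"
        proof -
          have "{\<omega> \<in> space M. \<omega> \<in> H \<and> \<tau> \<omega> \<in> {..t}} = H \<inter> (\<tau> -` {..t} \<inter> space M)"
            using sets.sets_into_space[OF H] by auto
          then show ?thesis using H measurable_sets[OF \<tau>_measurable, of "{..t}"] by auto
        qed
      qed simp
      moreover have "exit_prob j {..t} v = 0"
      proof -
        have "exit_prob j {..t} v = (\<integral>\<^sup>+x. 0 \<partial>(lborel :: real measure))"
          unfolding exit_prob_def using False by (intro nn_integral_cong) (auto simp: indicator_def)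
        then show ?thesis by simp
      qed
      ultimately show ?thesis by (simp add: N2[OF atMost_borel])
    qed
  qed (simp_all add: N1_def N2_def)
  then have "emeasure M {\<omega> \<in> space M. \<omega> \<in> H \<and> \<tau> \<omega> \<in> A} = emeasure M H * exit_prob j A v"
    using N1[OF A] N2[OF A] by simp
  moreover have "{\<omega> \<in> space M. \<omega> \<in> H \<and> \<tau> \<omega> \<in> A} = {\<omega> \<in> space M. (\<forall>r\<in>insert v F. X r \<omega> = y r) \<and> \<tau> \<omega> \<in> A}"
    by (auto simp: H_def)
  ultimately show ?thesis by (simp only: H_def)
qed

end

section \<open>Statistics of one path, restricted to events of the absorption time\<close>

context phase_type
begin

lemma exit_prob_le_1:
  assumes v: "0 \<le> v"
  shows "exit_prob j A v \<le> 1"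
proof -
  have "exit_prob j A v \<le> (\<integral>\<^sup>+x. (SUP n::nat. indicator {v<..v + real n} x * ennreal (exit_density j v x)) \<partial>lborel)"
    unfolding exit_prob_def
  proof (rule nn_integral_mono)
    fix x
    show "indicator A x * (indicator {v<..} x * ennreal (exit_density j v x))
        \<le> (SUP n::nat. indicator {v<..v + real n} x * ennreal (exit_density j v x))"
    proof (cases "v < x")
      case True
      obtain n :: nat where "x - v \<le> real n" using real_arch_simple by blast
      then have "indicator A x * (indicator {v<..} x * ennreal (exit_density j v x))
          \<le> indicator {v<..v + real n} x * ennreal (exit_density j v x)"
        using True by (auto simp: indicator_def)
      also have "\<dots> \<le> (SUP n::nat. indicator {v<..v + real n} x * ennreal (exit_density j v x))"
        by (rule SUP_upper) simp
      finally show ?thesis .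
    qed (simp add: indicator_def)
  qed
  also have "\<dots> = (SUP n::nat. \<integral>\<^sup>+x. indicator {v<..v + real n} x * ennreal (exit_density j v x) \<partial>lborel)"
  proof (rule nn_integral_monotone_convergence_SUP)
    show "incseq (\<lambda>n x. indicator {v<..v + real n} x * ennreal (exit_density j v x))"
      by (auto simp: incseq_def le_fun_def indicator_def)
    show "(\<lambda>x. indicator {v<..v + real n} x * ennreal (exit_density j v x)) \<in> borel_measurable lborel" for n
      using exit_density_measurable[of "\<lambda>_. v" lborel "\<lambda>x. x" j] by simp
  qed
  also have "\<dots> \<le> 1"
    using v by (intro SUP_least) (simp add: exit_density_integral P_None_le_1 ennreal_le_1)
  finally show ?thesis .
qed

lemma occ_eq:
  assumes u: "0 \<le> u"
  shows "occ (Some i) u = (\<pi> v* Q 0 u) $ i"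
proof -
  let ?B = "\<lambda>a. {\<omega> \<in> space M. X 0 \<omega> = a \<and> X u \<omega> = Some i}"
  have "{\<omega> \<in> space M. X u \<omega> = Some i} = \<Union> (?B ` UNIV)" by blast
  then have "occ (Some i) u = prob (\<Union> (?B ` UNIV))" by (simp only: occ_def)
  also have "\<dots> = (\<Sum>a\<in>UNIV. prob (?B a))"
  proof (rule finite_measure_finite_Union)
    show "?B ` UNIV \<subseteq> sets M" using u by (auto intro!: state_event2)
    show "disjoint_family_on ?B UNIV" by (auto simp: disjoint_family_on_def)
  qed simp
  also have "\<dots> = (\<Sum>a\<in>UNIV. occ a 0 * P 0 u $ a $ Some i)"
    using joint_eq[of 0 u _ "Some i"] u by (simp only: joint_def order_refl)
  also have "\<dots> = (\<Sum>l\<in>UNIV. \<pi> $ l * Q 0 u $ l $ i)"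
    using u by (simp add: sum_option P_None_Some P_Some_Some) (simp add: occ_def initial initial_vector_def)
  also have "\<dots> = (\<pi> v* Q 0 u) $ i" by (simp add: vector_matrix_mult_def mult.commute)
  finally show ?thesis .
qed

lemma occ_nonneg: "0 \<le> occ a u" and occ_le_1: "occ a u \<le> 1"
  by (simp_all add: occ_def)

lemma occ_measurable: "(\<lambda>u. indicator {0..} u * occ (Some i) u) \<in> borel_measurable borel"
proof -
  have "(\<lambda>u. indicator {0..} u * (\<Sum>l\<in>UNIV. \<pi> $ l * Q 0 u $ l $ i)) \<in> borel_measurable borel"
    by (intro borel_measurable_times borel_measurable_sum P_bar_measurable borel_measurable_const) auto
  moreover have "indicator {0..} u * (\<Sum>l\<in>UNIV. \<pi> $ l * Q 0 u $ l $ i) = indicator {0..} u * occ (Some i) u" for u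
    by (auto simp: indicator_def occ_eq vector_matrix_mult_def mult.commute)
  ultimately show ?thesis by simp
qed

lemma \<tau>_event: "A \<in> sets borel \<Longrightarrow> {\<omega> \<in> space M. \<tau> \<omega> \<in> A} \<in> sets M"
  using measurable_sets[OF \<tau>_measurable, of A] by (simp add: vimage_def Int_def conj_commute)

lemma state_absorption:
  assumes "0 \<le> u" "A \<in> sets borel"
  shows "emeasure M {\<omega> \<in> space M. X u \<omega> = Some i \<and> \<tau> \<omega> \<in> A} = ennreal (occ (Some i) u) * exit_prob i A u"
  using cylinder_absorption[of u "{}" "\<lambda>_. Some i" i A] assms by (simp add: occ_def emeasure_eq_measure)

lemma joint_absorption:
  assumes uv: "0 \<le> u" "u < v" and A: "A \<in> sets borel"
  shows "emeasure M {\<omega> \<in> space M. X u \<omega> = a \<and> X v \<omega> = Some j \<and> \<tau> \<omega> \<in> A} =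
    ennreal (joint a (Some j) u v) * exit_prob j A v"
proof -
  let ?y = "\<lambda>r. if r = u then a else Some j"
  have iff: "(\<forall>r\<in>insert v {u}. X r \<omega> = ?y r) \<longleftrightarrow> X u \<omega> = a \<and> X v \<omega> = Some j" for \<omega> using uv by auto
  show ?thesis
    using cylinder_absorption[of v "{u}" ?y j A] uv A
    unfolding iff joint_def by (simp add: emeasure_eq_measure conj_assoc)
qed

lemma exit_prob_tonelli:
  assumes W: "W \<in> borel_measurable borel" and A: "A \<in> sets borel"
  shows "(\<integral>\<^sup>+u. W u * exit_prob j A u \<partial>lborel) =
    (\<integral>\<^sup>+x. indicator A x * (\<integral>\<^sup>+u. W u * (indicator {u<..} x * ennreal (exit_density j u x)) \<partial>lborel) \<partial>lborel)"
proof -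
  let ?k = "\<lambda>u x. W u * (indicator A x * (indicator {u<..} x * ennreal (exit_density j u x)))"
  have meas: "(\<lambda>(u, x). ?k u x) \<in> borel_measurable (lborel \<Otimes>\<^sub>M lborel)"
    using exit_density_pair_measurable[of j] W A unfolding case_prod_beta' by simp
  have "(\<integral>\<^sup>+u. W u * exit_prob j A u \<partial>lborel) = (\<integral>\<^sup>+u. \<integral>\<^sup>+x. ?k u x \<partial>lborel \<partial>lborel)"
  proof (intro nn_integral_cong)
    fix u
    have "(\<lambda>x. indicator A x * (indicator {u<..} x * ennreal (exit_density j u x))) \<in> borel_measurable lborel"
      using exit_density_measurable[of "\<lambda>_. u" lborel "\<lambda>x. x" j] A by simp
    then show "W u * exit_prob j A u = (\<integral>\<^sup>+x. ?k u x \<partial>lborel)"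
      unfolding exit_prob_def by (rule nn_integral_cmult[symmetric])
  qed
  also have "\<dots> = (\<integral>\<^sup>+x. \<integral>\<^sup>+u. ?k u x \<partial>lborel \<partial>lborel)"
    by (rule lborel_pair.Fubini'[OF meas, symmetric])
  also have "\<dots> = (\<integral>\<^sup>+x. indicator A x * (\<integral>\<^sup>+u. W u * (indicator {u<..} x * ennreal (exit_density j u x)) \<partial>lborel) \<partial>lborel)"
    by (intro nn_integral_cong) (auto simp: indicator_def)
  finally show ?thesis .
qed

lemma visit_weight_measurable:
  assumes "S \<in> sets borel" "S \<subseteq> {0..}"
  shows "(\<lambda>u. indicator S u * ennreal (occ (Some i) u * c)) \<in> borel_measurable borel"
proof -
  have "(\<lambda>u. indicator S u * ennreal ((indicator {0..} u * occ (Some i) u) * c)) \<in> borel_measurable borel"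
    using occ_measurable[of i] assms(1) by simp
  moreover have "indicator S u * ennreal ((indicator {0..} u * occ (Some i) u) * c) =
      indicator S u * ennreal (occ (Some i) u * c)" for u
    using assms(2) by (auto simp: indicator_def)
  ultimately show ?thesis by simp
qed

lemma visit_tonelli:
  assumes S: "S \<in> sets borel" "S \<subseteq> {0..}" and c: "0 \<le> c" and A: "A \<in> sets borel"
  shows "(\<integral>\<^sup>+u. indicator S u * (ennreal (occ (Some i) u * c) * exit_prob j A u) \<partial>lborel) =
    (\<integral>\<^sup>+x. indicator A x * visit_density i j c S x \<partial>lborel)"
proof -
  have "(\<integral>\<^sup>+u. indicator S u * (ennreal (occ (Some i) u * c) * exit_prob j A u) \<partial>lborel) =
      (\<integral>\<^sup>+x. indicator A x * (\<integral>\<^sup>+u. (indicator S u * ennreal (occ (Some i) u * c)) *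
        (indicator {u<..} x * ennreal (exit_density j u x)) \<partial>lborel) \<partial>lborel)"
    using exit_prob_tonelli[OF visit_weight_measurable[OF S] A] by (simp only: mult.assoc)
  also have "\<dots> = (\<integral>\<^sup>+x. indicator A x * visit_density i j c S x \<partial>lborel)"
    unfolding visit_density_def
  proof (intro nn_integral_cong arg_cong[where f = "(*) _"])
    fix x u
    show "(indicator S u * ennreal (occ (Some i) u * c)) * (indicator {u<..} x * ennreal (exit_density j u x)) =
      indicator S u * (indicator {u<..} x * ennreal ((\<pi> v* Q 0 u) $ i * c * exit_density j u x))"
    proof (cases "u \<in> S \<and> u < x")
      case True
      then have "0 \<le> exit_density j u x" "0 \<le> u" using S(2) by (auto intro!: exit_density_nonneg)
      then show ?thesis using True c occ_nonneg by (simp add: ennreal_mult occ_eq[symmetric])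
    qed (auto simp: indicator_def)
  qed
  finally show ?thesis .
qed

lemma absorption_law_from:
  assumes A: "A \<in> sets borel"
  shows "(\<integral>\<^sup>+\<omega>. ennreal (of_bool (X 0 \<omega> = Some i)) * indicator A (\<tau> \<omega>) \<partial>M) =
    (\<integral>\<^sup>+x. indicator A x * (indicator {0<..} x * ennreal (\<pi> $ i * exit_density i 0 x)) \<partial>lborel)"
proof -
  let ?E = "{\<omega> \<in> space M. X 0 \<omega> = Some i \<and> \<tau> \<omega> \<in> A}"
  have E: "?E \<in> sets M"
  proof -
    have "?E = {\<omega> \<in> space M. X 0 \<omega> = Some i} \<inter> {\<omega> \<in> space M. \<tau> \<omega> \<in> A}" by auto
    then show ?thesis using state_event[of 0 "Some i"] \<tau>_event[OF A] by auto
  qed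
  have pi: "0 \<le> \<pi> $ i" using prob_vec by (simp add: probability_vector_def)
  have "(\<integral>\<^sup>+\<omega>. ennreal (of_bool (X 0 \<omega> = Some i)) * indicator A (\<tau> \<omega>) \<partial>M) = (\<integral>\<^sup>+\<omega>. indicator ?E \<omega> \<partial>M)"
    by (intro nn_integral_cong) (auto simp: indicator_def)
  also have "\<dots> = ennreal (\<pi> $ i) * exit_prob i A 0"
    using E state_absorption[OF order_refl A, of i] by (simp add: occ_def initial initial_vector_def)
  also have "\<dots> = (\<integral>\<^sup>+x. ennreal (\<pi> $ i) * (indicator A x * (indicator {0<..} x * ennreal (exit_density i 0 x))) \<partial>lborel)"
    unfolding exit_prob_def using exit_density_measurable[of "\<lambda>_. 0" lborel "\<lambda>x. x" i] A
    by (intro nn_integral_cmult[symmetric]) simp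
  also have "\<dots> = (\<integral>\<^sup>+x. indicator A x * (indicator {0<..} x * ennreal (\<pi> $ i * exit_density i 0 x)) \<partial>lborel)"
    using pi by (intro nn_integral_cong) (auto simp: indicator_def ennreal_mult exit_density_nonneg)
  finally show ?thesis .
qed

lemma absorption_law:
  assumes A: "A \<in> sets borel"
  shows "emeasure M {\<omega> \<in> space M. \<tau> \<omega> \<in> A} =
    (\<integral>\<^sup>+x. indicator A x * (indicator {0<..} x * ennreal (abs_density x)) \<partial>lborel)"
proof -
  have "emeasure M {\<omega> \<in> space M. \<tau> \<omega> \<in> A} = (\<integral>\<^sup>+\<omega>. indicator {\<omega> \<in> space M. \<tau> \<omega> \<in> A} \<omega> \<partial>M)"
    using \<tau>_event[OF A] by simp
  also have "\<dots> = (\<integral>\<^sup>+\<omega>. (\<Sum>i\<in>UNIV. ennreal (of_bool (X 0 \<omega> = Some i)) * indicator A (\<tau> \<omega>)) \<partial>M)"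
  proof (rule nn_integral_cong_AE)
    show "AE \<omega> in M. indicator {\<omega> \<in> space M. \<tau> \<omega> \<in> A} \<omega> =
        (\<Sum>i\<in>UNIV. ennreal (of_bool (X 0 \<omega> = Some i)) * indicator A (\<tau> \<omega>))"
      using AE_regular
    proof eventually_elim
      case (elim \<omega>)
      then have "X 0 \<omega> \<noteq> None" by (auto simp: regular_def)
      then obtain l where l: "X 0 \<omega> = Some l" by auto
      have "(\<Sum>i\<in>UNIV. ennreal (of_bool (X 0 \<omega> = Some i)) * indicator A (\<tau> \<omega>)) =
          (\<Sum>i\<in>UNIV. if l = i then indicator A (\<tau> \<omega>) else 0)"
        by (intro sum.cong) (auto simp: l)
      then show ?case using elim by (simp add: regular_def indicator_def)
    qed
  qed
  also have "\<dots> = (\<Sum>i\<in>UNIV. \<integral>\<^sup>+\<omega>. ennreal (of_bool (X 0 \<omega> = Some i)) * indicator A (\<tau> \<omega>) \<partial>M)"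
  proof (rule nn_integral_sum)
    fix i
    have 1: "(\<lambda>\<omega>. indicator {\<omega> \<in> space M. X 0 \<omega> = Some i} \<omega> * indicator {\<omega> \<in> space M. \<tau> \<omega> \<in> A} \<omega> :: ennreal) \<in> borel_measurable M"
      using state_event[of 0 "Some i"] \<tau>_event[OF A] by simp
    show "(\<lambda>\<omega>. ennreal (of_bool (X 0 \<omega> = Some i)) * indicator A (\<tau> \<omega>)) \<in> borel_measurable M"
      using 1 by (rule measurable_cong[THEN iffD1, rotated]) (auto simp: indicator_def)
  qed
  also have "\<dots> = (\<Sum>i\<in>UNIV. \<integral>\<^sup>+x. indicator A x * (indicator {0<..} x * ennreal (\<pi> $ i * exit_density i 0 x)) \<partial>lborel)"
    by (simp only: absorption_law_from[OF A])
  also have "\<dots> = (\<integral>\<^sup>+x. (\<Sum>i\<in>UNIV. indicator A x * (indicator {0<..} x * ennreal (\<pi> $ i * exit_density i 0 x))) \<partial>lborel)"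
  proof (rule nn_integral_sum[symmetric])
    fix i
    show "(\<lambda>x. indicator A x * (indicator {0<..} x * ennreal (\<pi> $ i * exit_density i 0 x))) \<in> borel_measurable lborel"
      using exit_density_measurable[of "\<lambda>_. 0" lborel "\<lambda>x. x" i] A by simp
  qed
  also have "\<dots> = (\<integral>\<^sup>+x. indicator A x * (indicator {0<..} x * ennreal (abs_density x)) \<partial>lborel)"
  proof (intro nn_integral_cong)
    fix x :: real
    show "(\<Sum>i\<in>UNIV. indicator A x * (indicator {0<..} x * ennreal (\<pi> $ i * exit_density i 0 x))) =
        indicator A x * (indicator {0<..} x * ennreal (abs_density x))"
    proof (cases "0 < x")
      case True
      have "0 \<le> \<pi> $ i * exit_density i 0 x" for i
        using True prob_vec by (auto simp: probability_vector_def intro!: mult_nonneg_nonneg exit_density_nonneg)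
      then show ?thesis
        unfolding sum_distrib_left[symmetric] abs_density_def by (simp add: sum_ennreal)
    qed simp
  qed
  finally show ?thesis .
qed

lemma sojourn_ennreal:
  assumes \<omega>: "regular \<omega>" and S: "S \<in> sets borel" "S \<subseteq> {0..}"
  shows "ennreal (sojourn_time (\<lambda>t. X t \<omega>) (Some i) S) =
    (\<integral>\<^sup>+u. indicator S u * of_bool (X (max 0 u) \<omega> = Some i) \<partial>lborel)"
proof -
  let ?f = "\<lambda>u. indicator S u * of_bool (X (max 0 u) \<omega> = Some i) :: real"
  have sp: "\<omega> \<in> space M" using \<omega> by (simp add: regular_def)
  have f: "indicator S u *\<^sub>R of_bool (X u \<omega> = Some i) = ?f u" for u
    using S(2) by (auto simp: indicator_def max_def)
  have "(\<lambda>u. X (max 0 u) \<omega>) \<in> measurable lborel (count_space UNIV)"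
    using measurable_Pair2[OF X_pair_measurable[of "\<lambda>u. max 0 u"] sp] by simp
  from measurable_compose[OF this, of "\<lambda>b. of_bool (b = Some i) :: real" borel]
  have meas: "?f \<in> borel_measurable lborel" using S(1) by simp
  have "sojourn_time (\<lambda>t. X t \<omega>) (Some i) S = (LINT u|lborel. ?f u)"
    by (simp only: sojourn_time_def set_lebesgue_integral_def f)
  also have "\<dots> = enn2real (\<integral>\<^sup>+u. ennreal (?f u) \<partial>lborel)"
    using meas by (intro integral_eq_nn_integral) auto
  finally have *: "sojourn_time (\<lambda>t. X t \<omega>) (Some i) S = enn2real (\<integral>\<^sup>+u. ennreal (?f u) \<partial>lborel)" .
  have "(\<integral>\<^sup>+u. ennreal (?f u) \<partial>lborel) \<le> (\<integral>\<^sup>+u. indicator {0..\<tau> \<omega>} u \<partial>lborel)"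
  proof (rule nn_integral_mono)
    fix u
    show "ennreal (?f u) \<le> indicator {0..\<tau> \<omega>} u"
    proof (cases "u \<in> S \<and> X (max 0 u) \<omega> = Some i")
      case True
      then have "0 \<le> u" "X u \<omega> \<noteq> None" using S(2) by (auto simp: max_def split: if_splits)
      then have "u \<in> {0..\<tau> \<omega>}" using \<omega> by (auto simp: regular_def)
      then show ?thesis by (simp add: indicator_def)
    qed auto
  qed
  also have "\<dots> < \<infinity>" by (simp add: emeasure_lborel_Icc_eq)
  finally have "ennreal (enn2real (\<integral>\<^sup>+u. ennreal (?f u) \<partial>lborel)) = (\<integral>\<^sup>+u. ennreal (?f u) \<partial>lborel)"
    by simp
  also have "\<dots> = (\<integral>\<^sup>+u. indicator S u * of_bool (X (max 0 u) \<omega> = Some i) \<partial>lborel)"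
    by (intro nn_integral_cong) (auto simp: indicator_def)
  finally show ?thesis unfolding * .
qed

lemma expected_sojourn:
  assumes S: "S \<in> sets borel" "S \<subseteq> {0..}" and A: "A \<in> sets borel"
  shows "(\<integral>\<^sup>+\<omega>. ennreal (sojourn_time (\<lambda>t. X t \<omega>) (Some i) S) * indicator A (\<tau> \<omega>) \<partial>M) =
    (\<integral>\<^sup>+x. indicator A x * visit_density i i 1 S x \<partial>lborel)"
proof -
  interpret pair_sigma_finite M lborel ..
  let ?f = "\<lambda>\<omega> u. indicator S u * of_bool (X (max 0 u) \<omega> = Some i) :: ennreal"
  let ?D = "{\<omega> \<in> space M. \<tau> \<omega> \<in> A}"
  have "(\<lambda>(\<omega>, u). X (max 0 u) \<omega>) \<in> measurable (M \<Otimes>\<^sub>M lborel) (count_space UNIV)"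
    by (rule X_pair_measurable) auto
  from measurable_compose[OF this, of "\<lambda>b. of_bool (b = Some i) :: ennreal" borel]
  have [measurable]: "(\<lambda>z. of_bool (X (max 0 (snd z)) (fst z) = Some i) :: ennreal) \<in> borel_measurable (M \<Otimes>\<^sub>M lborel)"
    by (simp add: case_prod_beta')
  have meas: "(\<lambda>(\<omega>, u). ?f \<omega> u * indicator ?D \<omega>) \<in> borel_measurable (M \<Otimes>\<^sub>M lborel)"
    using S(1) \<tau>_event[OF A] by (simp add: case_prod_beta')
  have f: "?f \<omega> \<in> borel_measurable lborel" if "\<omega> \<in> space M" for \<omega>
  proof -
    have "(\<lambda>(\<omega>, u). ?f \<omega> u) \<in> borel_measurable (M \<Otimes>\<^sub>M lborel)" using S(1) by (simp add: case_prod_beta')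
    from measurable_Pair2[OF this that] show ?thesis by simp
  qed
  have "(\<integral>\<^sup>+\<omega>. ennreal (sojourn_time (\<lambda>t. X t \<omega>) (Some i) S) * indicator A (\<tau> \<omega>) \<partial>M) =
      (\<integral>\<^sup>+\<omega>. \<integral>\<^sup>+u. ?f \<omega> u * indicator ?D \<omega> \<partial>lborel \<partial>M)"
  proof (rule nn_integral_cong_AE)
    show "AE \<omega> in M. ennreal (sojourn_time (\<lambda>t. X t \<omega>) (Some i) S) * indicator A (\<tau> \<omega>) =
        (\<integral>\<^sup>+u. ?f \<omega> u * indicator ?D \<omega> \<partial>lborel)"
      using AE_regular
    proof eventually_elim
      case (elim \<omega>)
      then have sp: "\<omega> \<in> space M" by (simp add: regular_def)
      then have "indicator A (\<tau> \<omega>) = (indicator ?D \<omega> :: ennreal)" by (simp add: indicator_def)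
      then show ?case
        by (simp only: sojourn_ennreal[OF elim S] nn_integral_multc[OF f[OF sp]])
    qed
  qed
  also have "\<dots> = (\<integral>\<^sup>+u. \<integral>\<^sup>+\<omega>. ?f \<omega> u * indicator ?D \<omega> \<partial>M \<partial>lborel)"
    by (rule Fubini'[OF meas, symmetric])
  also have "\<dots> = (\<integral>\<^sup>+u. indicator S u * (ennreal (occ (Some i) u * 1) * exit_prob i A u) \<partial>lborel)"
  proof (intro nn_integral_cong)
    fix u
    show "(\<integral>\<^sup>+\<omega>. ?f \<omega> u * indicator ?D \<omega> \<partial>M) = indicator S u * (ennreal (occ (Some i) u * 1) * exit_prob i A u)"
    proof (cases "u \<in> S")
      case True
      then have u: "0 \<le> u" using S(2) by auto
      let ?E = "{\<omega> \<in> space M. X u \<omega> = Some i \<and> \<tau> \<omega> \<in> A}"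
      have "?E = {\<omega> \<in> space M. X u \<omega> = Some i} \<inter> ?D" by auto
      then have E: "?E \<in> sets M" using state_event[OF u, of "Some i"] \<tau>_event[OF A] by auto
      have "(\<integral>\<^sup>+\<omega>. ?f \<omega> u * indicator ?D \<omega> \<partial>M) = (\<integral>\<^sup>+\<omega>. indicator ?E \<omega> \<partial>M)"
        using True u by (intro nn_integral_cong) (auto simp: indicator_def max_def)
      then show ?thesis using E True state_absorption[OF u A, of i] by simp
    qed simp
  qed
  also have "\<dots> = (\<integral>\<^sup>+x. indicator A x * visit_density i i 1 S x \<partial>lborel)"
    by (rule visit_tonelli[OF S _ A]) simp
  finally show ?thesis .
qed

text \<open>Given state \<open>i\<close> at time \<open>u\<close> and state \<open>j\<close> at time \<open>v\<close>, the event \<open>\<tau> \<in> A\<close> has probability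
  \<open>exit_prob j A v\<close>. The last cell is unbounded and is exhausted by bounded intervals.\<close>

lemma expected_transitions:
  assumes k: "k \<in> {1..K}" and ij: "i \<noteq> j" and A: "A \<in> sets borel"
  shows "(\<integral>\<^sup>+\<omega>. jump_number (\<lambda>t. X t \<omega>) (\<lambda>l y. l = Some i \<and> y = Some j) (cell s k) * indicator A (\<tau> \<omega>) \<partial>M) =
    (\<integral>\<^sup>+x. indicator A x * visit_density i j (Tk k $ i $ j) (cell s k) x \<partial>lborel)"
proof -
  let ?R = "\<lambda>l y. l = Some i \<and> y = Some j"
  let ?D = "{\<omega> \<in> space M. \<tau> \<omega> \<in> A}"
  let ?C = "\<lambda>n::nat. cell s k \<inter> {..real n}"
  \<comment> \<open>Negative times are cut off because only for \<open>0 \<le> v\<close> is \<open>exit_prob j A v\<close> a probability.\<close>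
  let ?G = "\<lambda>v. indicator {0..} v * exit_prob j A v"
  have irr: "irreflp ?R" using ij by (auto intro: irreflpI)
  have pt0: "0 \<le> pt (k - 1)" using k by (intro pt_nonneg) auto
  have cell_pos': "cell s k \<subseteq> {0..}" using cell_pos[OF k] by force
  have c: "0 \<le> Tk k $ i $ j" using sub_intensity_Tk[OF k] ij by (simp add: sub_intensity_matrix_def)
  have G: "?G \<in> borel_measurable borel" using exit_prob_measurable[OF A, of j] by simp
  have G1: "?G v \<le> 1" for v using exit_prob_le_1[of v j A] by (simp add: indicator_def)
  have W: "(\<lambda>u. indicator (?C n) u * (ennreal (occ (Some i) u * Tk k $ i $ j) * exit_prob j A u)) \<in> borel_measurable lborel" for n
  proof -
    have "(\<lambda>u. indicator (?C n) u * ennreal (occ (Some i) u * Tk k $ i $ j)) \<in> borel_measurable borel"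
      using cell_pos' by (intro visit_weight_measurable sets.Int cell_measurable) auto
    from borel_measurable_times_ennreal[OF this exit_prob_measurable[OF A, of j]]
    have "(\<lambda>u. (indicator (?C n) u * ennreal (occ (Some i) u * Tk k $ i $ j)) * exit_prob j A u) \<in> borel_measurable lborel"
      by (simp only: measurable_lborel2)
    then show ?thesis by (simp only: mult.assoc)
  qed
  have step: "(\<integral>\<^sup>+\<omega>. jump_number (\<lambda>t. X t \<omega>) ?R (?C n) * indicator ?D \<omega> \<partial>M) =
      (\<integral>\<^sup>+u. indicator (?C n) u * (ennreal (occ (Some i) u * Tk k $ i $ j) * exit_prob j A u) \<partial>lborel)" for n
  proof -
    obtain \<gamma> where \<gamma>: "pt (k - 1) \<le> \<gamma>" "?C n = {pt (k - 1)<..\<gamma>}" by (rule cell_cut[OF k])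
    have "(\<integral>\<^sup>+\<omega>. jump_number (\<lambda>t. X t \<omega>) ?R {pt (k - 1)<..\<gamma>} * indicator ?D \<omega> \<partial>M) =
      (\<integral>\<^sup>+v. indicator {pt (k - 1)<..\<gamma>} v *
        (ennreal (occ (Some i) v * intensity_matrix (Tk k) $ Some i $ Some j) * ?G v) \<partial>lborel)"
    proof (rule expected_jump_number[OF _ pt0 \<gamma>(1) _ \<tau>_event[OF A] G G1])
      show "Some i \<noteq> Some j" using ij by simp
      show "intensity_matrix (Tf w) = intensity_matrix (Tk k)" if "pt (k - 1) < w" "w \<le> \<gamma>" for w
      proof -
        have "w \<in> ?C n" unfolding \<gamma>(2) using that by simp
        then show ?thesis using Tf_cell[OF k] by simp
      qed
      show "emeasure M {\<omega> \<in> space M. X u \<omega> = Some i \<and> X v \<omega> = Some j \<and> \<omega> \<in> ?D} =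
          ennreal (joint (Some i) (Some j) u v) * ?G v" if "0 \<le> u" "u < v" for u v
      proof -
        have "{\<omega> \<in> space M. X u \<omega> = Some i \<and> X v \<omega> = Some j \<and> \<omega> \<in> ?D} =
            {\<omega> \<in> space M. X u \<omega> = Some i \<and> X v \<omega> = Some j \<and> \<tau> \<omega> \<in> A}" by auto
        then show ?thesis using joint_absorption[OF that A, of "Some i" j] that by simp
      qed
    qed
    also have "\<dots> = (\<integral>\<^sup>+u. indicator {pt (k - 1)<..\<gamma>} u * (ennreal (occ (Some i) u * Tk k $ i $ j) * exit_prob j A u) \<partial>lborel)"
      using pt0 by (intro nn_integral_cong) (auto simp: indicator_def intensity_entry)
    finally show ?thesis unfolding \<gamma>(2) .
  qed
  have "(\<integral>\<^sup>+\<omega>. jump_number (\<lambda>t. X t \<omega>) ?R (cell s k) * indicator A (\<tau> \<omega>) \<partial>M) =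
      (\<integral>\<^sup>+\<omega>. (SUP n. jump_number (\<lambda>t. X t \<omega>) ?R (?C n) * indicator ?D \<omega>) \<partial>M)"
    by (intro nn_integral_cong) (simp add: jump_number_cell_SUP[of _ ?R] SUP_mult_right_ennreal[symmetric] indicator_def)
  also have "\<dots> = (SUP n. \<integral>\<^sup>+\<omega>. jump_number (\<lambda>t. X t \<omega>) ?R (?C n) * indicator ?D \<omega> \<partial>M)"
  proof (rule nn_integral_monotone_convergence_SUP)
    have "jump_number x ?R (?C m) \<le> jump_number x ?R (?C n)" if "m \<le> n" for m n x
      unfolding jump_number_def using that by (intro emeasure_mono jumps_mono) auto
    then show "incseq (\<lambda>n \<omega>. jump_number (\<lambda>t. X t \<omega>) ?R (?C n) * indicator ?D \<omega>)"
      by (auto simp: incseq_def le_fun_def intro!: mult_right_mono)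
    show "(\<lambda>\<omega>. jump_number (\<lambda>t. X t \<omega>) ?R (?C n) * indicator ?D \<omega>) \<in> borel_measurable M" for n
      using jump_number_cut_measurable[OF path_process_axioms k irr] \<tau>_event[OF A] by simp
  qed
  also have "\<dots> = (SUP n. \<integral>\<^sup>+u. indicator (?C n) u * (ennreal (occ (Some i) u * Tk k $ i $ j) * exit_prob j A u) \<partial>lborel)"
    by (simp only: step)
  also have "\<dots> = (\<integral>\<^sup>+u. (SUP n. indicator (?C n) u * (ennreal (occ (Some i) u * Tk k $ i $ j) * exit_prob j A u)) \<partial>lborel)"
    using W by (intro nn_integral_monotone_convergence_SUP[symmetric])
      (auto simp: incseq_def le_fun_def indicator_def)
  also have "\<dots> = (\<integral>\<^sup>+u. indicator (cell s k) u * (ennreal (occ (Some i) u * Tk k $ i $ j) * exit_prob j A u) \<partial>lborel)"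
  proof (intro nn_integral_cong)
    fix u
    have "(SUP n. indicator (?C n) u :: ennreal) = indicator (cell s k) u"
    proof (rule antisym)
      show "(SUP n. indicator (?C n) u :: ennreal) \<le> indicator (cell s k) u"
        by (intro SUP_least) (auto simp: indicator_def)
      obtain n :: nat where "u \<le> real n" using real_arch_simple by blast
      then have "indicator (cell s k) u \<le> (indicator (?C n) u :: ennreal)" by (auto simp: indicator_def)
      also have "\<dots> \<le> (SUP n. indicator (?C n) u)" by (rule SUP_upper) simp
      finally show "indicator (cell s k) u \<le> (SUP n. indicator (?C n) u :: ennreal)" .
    qed
    then show "(SUP n. indicator (?C n) u * (ennreal (occ (Some i) u * Tk k $ i $ j) * exit_prob j A u)) =
        indicator (cell s k) u * (ennreal (occ (Some i) u * Tk k $ i $ j) * exit_prob j A u)"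
      by (simp only: SUP_mult_right_ennreal[symmetric])
  qed
  also have "\<dots> = (\<integral>\<^sup>+x. indicator A x * visit_density i j (Tk k $ i $ j) (cell s k) x \<partial>lborel)"
    by (rule visit_tonelli[OF cell_measurable cell_pos' c A])
  finally show ?thesis .
qed

lemma jumps_regular:
  assumes \<omega>: "regular \<omega>" and k: "k \<in> {1..K}" and r: "r \<in> jumps (\<lambda>t. X t \<omega>) (\<lambda>l y. l = Some i \<and> y = b) (cell s k)"
  shows "r \<le> \<tau> \<omega>" "b = None \<Longrightarrow> r = \<tau> \<omega>"
proof -
  have r': "r \<in> cell s k" "eventually (\<lambda>u. X u \<omega> = Some i) (at_left r)" "X r \<omega> = b"
    using r by (auto simp: jumps_def)
  have r0: "0 < r" using cell_pos[OF k r'(1)] .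
  obtain a where a: "a < r" "\<And>u. a < u \<Longrightarrow> u < r \<Longrightarrow> X u \<omega> = Some i"
    using r'(2) unfolding eventually_at_left_field by auto
  show le: "r \<le> \<tau> \<omega>"
  proof (rule ccontr)
    assume "\<not> r \<le> \<tau> \<omega>"
    then obtain u where u: "max a (max 0 (\<tau> \<omega>)) < u" "u < r" using dense[of "max a (max 0 (\<tau> \<omega>))" r] a(1) r0 by auto
    then have "X u \<omega> = None" using \<omega> by (auto simp: regular_def)
    then show False using a(2)[of u] u by auto
  qed
  show "r = \<tau> \<omega>" if "b = None"
    using le r'(3) that \<omega> r0 by (auto simp: regular_def)
qed

lemma jump_number_regular_finite:
  assumes \<omega>: "regular \<omega>" and k: "k \<in> {1..K}" and b: "b \<noteq> Some i"
  shows "jump_number (\<lambda>t. X t \<omega>) (\<lambda>l y. l = Some i \<and> y = b) (cell s k) < \<infinity>"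
proof -
  let ?R = "\<lambda>l y. l = Some i \<and> y = b"
  have "jump_path (\<lambda>t. X t \<omega>)" using \<omega> X_path by (simp add: regular_def)
  then have "finite (jumps (\<lambda>t. X t \<omega>) ?R {0<..\<tau> \<omega>})"
    by (rule finite_jumps) (use b in \<open>auto intro: irreflpI\<close>)
  moreover have "jumps (\<lambda>t. X t \<omega>) ?R (cell s k) \<subseteq> jumps (\<lambda>t. X t \<omega>) ?R {0<..\<tau> \<omega>}"
    using jumps_regular(1)[OF \<omega> k] cell_pos[OF k] by (auto simp: jumps_def)
  ultimately have "finite (jumps (\<lambda>t. X t \<omega>) ?R (cell s k))" by (rule finite_subset[rotated])
  then show ?thesis by (simp add: jump_number_def emeasure_count_space ennreal_of_nat_eq_real_of_nat)
qed

text \<open>A regular path enters the absorbing state only at its absorption time, so that restricting to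
  \<open>\<tau> \<le> t\<close> amounts to counting these jumps up to time \<open>t\<close>.\<close>

lemma expected_exits:
  assumes k: "k \<in> {1..K}" and A: "A \<in> sets borel"
  shows "(\<integral>\<^sup>+\<omega>. jump_number (\<lambda>t. X t \<omega>) (\<lambda>l y. l = Some i \<and> y = None) (cell s k) * indicator A (\<tau> \<omega>) \<partial>M) =
    (\<integral>\<^sup>+x. indicator A x * (indicator (cell s k) x * ennreal (occ (Some i) x * ex x $ i)) \<partial>lborel)"
proof -
  let ?R = "\<lambda>l y. l = Some i \<and> y = None"
  let ?J = "\<lambda>\<omega>. jump_number (\<lambda>t. X t \<omega>) ?R (cell s k)"
  let ?d = "\<lambda>x. indicator (cell s k) x * ennreal (occ (Some i) x * ex x $ i)"
  have irr: "irreflp ?R" by (auto intro: irreflpI)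
  have pt0: "0 \<le> pt (k - 1)" using k by (intro pt_nonneg) auto
  have cell_pos': "cell s k \<subseteq> {0..}" using cell_pos[OF k] by force
  have ex_cell: "ex x = exit_rates (Tk k)" if "x \<in> cell s k" for x
    using cell_index_eq[OF k that] by (simp add: ex_def)
  have J: "?J \<in> borel_measurable M"
    by (rule jump_number_cell_measurable[OF path_process_axioms k irr])
  have d: "?d \<in> borel_measurable lborel"
  proof -
    have "?d = (\<lambda>x. indicator (cell s k) x * ennreal (occ (Some i) x * exit_rates (Tk k) $ i))"
      by (auto simp: fun_eq_iff indicator_def ex_cell)
    then show ?thesis using visit_weight_measurable[OF cell_measurable cell_pos', of i] by simp
  qed
  define N1 where "N1 = distr (density M ?J) borel \<tau>"
  define N2 where "N2 = density lborel ?d"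
  have N1: "emeasure N1 B = (\<integral>\<^sup>+\<omega>. ?J \<omega> * indicator B (\<tau> \<omega>) \<partial>M)" if B: "B \<in> sets borel" for B
  proof -
    have ev: "\<tau> -` B \<inter> space M \<in> sets M" using B \<tau>_measurable by (rule measurable_sets[rotated])
    have "\<tau> \<in> measurable (density M ?J) borel" using \<tau>_measurable by simp
    then have "emeasure N1 B = (\<integral>\<^sup>+\<omega>. ?J \<omega> * indicator (\<tau> -` B \<inter> space M) \<omega> \<partial>M)"
      unfolding N1_def using B J ev by (simp add: emeasure_distr emeasure_density)
    also have "\<dots> = (\<integral>\<^sup>+\<omega>. ?J \<omega> * indicator B (\<tau> \<omega>) \<partial>M)"
      by (intro nn_integral_cong) (auto simp: indicator_def)
    finally show ?thesis .
  qed
  have N2: "emeasure N2 B = (\<integral>\<^sup>+x. indicator B x * ?d x \<partial>lborel)" if B: "B \<in> sets borel" for B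
    unfolding N2_def using B d by (simp add: emeasure_density mult.commute)
  have "N1 = N2"
  proof (rule borel_measure_eqI_atMost)
    fix t
    have "(\<integral>\<^sup>+\<omega>. ?J \<omega> * indicator {..t} (\<tau> \<omega>) \<partial>M) \<le> (\<integral>\<^sup>+\<omega>. 1 \<partial>M)"
    proof (rule nn_integral_mono_AE)
      show "AE \<omega> in M. ?J \<omega> * indicator {..t} (\<tau> \<omega>) \<le> 1"
        using AE_regular
      proof eventually_elim
        case (elim \<omega>)
        have "jumps (\<lambda>t. X t \<omega>) ?R (cell s k) \<subseteq> {\<tau> \<omega>}"
          using jumps_regular(2)[OF elim k] by auto
        then have "?J \<omega> \<le> emeasure (count_space UNIV) {\<tau> \<omega>}"
          unfolding jump_number_def by (intro emeasure_mono) auto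
        then show ?case by (auto simp: indicator_def)
      qed
    qed
    also have "\<dots> < \<infinity>" by (simp add: emeasure_space_1)
    finally show "emeasure N1 {..t} < \<infinity>" by (simp only: N1[OF atMost_borel])
    obtain \<gamma> where \<gamma>: "pt (k - 1) \<le> \<gamma>" "cell s k \<inter> {..t} = {pt (k - 1)<..\<gamma>}" by (rule cell_cut[OF k])
    have "emeasure N1 {..t} = (\<integral>\<^sup>+\<omega>. jump_number (\<lambda>t. X t \<omega>) ?R {pt (k - 1)<..\<gamma>} * indicator (space M) \<omega> \<partial>M)"
      unfolding N1[OF atMost_borel]
    proof (rule nn_integral_cong_AE)
      show "AE \<omega> in M. ?J \<omega> * indicator {..t} (\<tau> \<omega>) =
          jump_number (\<lambda>t. X t \<omega>) ?R {pt (k - 1)<..\<gamma>} * indicator (space M) \<omega>"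
        using AE_regular
      proof eventually_elim
        case (elim \<omega>)
        have "jumps (\<lambda>t. X t \<omega>) ?R (cell s k \<inter> {..t}) =
            (if \<tau> \<omega> \<le> t then jumps (\<lambda>t. X t \<omega>) ?R (cell s k) else {})"
        proof (intro set_eqI iffI)
          fix r assume r: "r \<in> jumps (\<lambda>t. X t \<omega>) ?R (cell s k \<inter> {..t})"
          then have "r \<in> jumps (\<lambda>t. X t \<omega>) ?R (cell s k)" "r \<le> t" by (auto simp: jumps_def)
          then show "r \<in> (if \<tau> \<omega> \<le> t then jumps (\<lambda>t. X t \<omega>) ?R (cell s k) else {})"
            using jumps_regular(2)[OF elim k, of r i None] by simp
        next
          fix r assume r: "r \<in> (if \<tau> \<omega> \<le> t then jumps (\<lambda>t. X t \<omega>) ?R (cell s k) else {})"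
          then have "r \<in> jumps (\<lambda>t. X t \<omega>) ?R (cell s k)" "\<tau> \<omega> \<le> t" by (auto split: if_splits)
          then show "r \<in> jumps (\<lambda>t. X t \<omega>) ?R (cell s k \<inter> {..t})"
            using jumps_regular(2)[OF elim k, of r i None] by (auto simp: jumps_def)
        qed
        then show ?case using elim unfolding \<gamma>(2) by (simp add: jump_number_def regular_def)
      qed
    qed
    also have "\<dots> = (\<integral>\<^sup>+v. indicator {pt (k - 1)<..\<gamma>} v *
        (ennreal (occ (Some i) v * intensity_matrix (Tk k) $ Some i $ None) * 1) \<partial>lborel)"
    proof (rule expected_jump_number[OF _ pt0 \<gamma>(1)])
      show "intensity_matrix (Tf w) = intensity_matrix (Tk k)" if "pt (k - 1) < w" "w \<le> \<gamma>" for w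
      proof -
        have "w \<in> cell s k \<inter> {..t}" unfolding \<gamma>(2) using that by simp
        then show ?thesis using Tf_cell[OF k] by simp
      qed
      show "emeasure M {\<omega> \<in> space M. X u \<omega> = Some i \<and> X v \<omega> = None \<and> \<omega> \<in> space M} =
          ennreal (joint (Some i) None u v) * 1" for u v
        by (auto simp: joint_def emeasure_eq_measure intro!: arg_cong[where f = prob])
    qed auto
    also have "\<dots> = emeasure N2 {..t}"
      unfolding N2[OF atMost_borel] \<gamma>(2)[symmetric]
      by (intro nn_integral_cong) (auto simp: indicator_def intensity_entry ex_cell)
    finally show "emeasure N1 {..t} = emeasure N2 {..t}" .
  qed (simp_all add: N1_def N2_def)
  then show ?thesis using N1[OF A] N2[OF A] by simp
qed

end

section \<open>Conditioning on independent absorption times\<close>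

text \<open>The statistic \<open>S n\<close> and the time \<open>\<tau> n\<close> depend on the \<open>n\<close>-th path only, so integrating out
  the other times first reduces conditioning on all times to conditioning on \<open>\<tau> n\<close>.\<close>

lemma nn_cond_exp_sum_indep:
  fixes M :: "'w measure" and N :: nat and Z :: "'z measure" and Y :: "nat \<Rightarrow> 'w \<Rightarrow> 'z"
    and S :: "nat \<Rightarrow> 'w \<Rightarrow> ennreal" and \<tau> :: "nat \<Rightarrow> 'w \<Rightarrow> real" and g :: "real \<Rightarrow> ennreal"
  defines "I \<equiv> {1..N}" and "\<Sigma> \<equiv> \<lambda>n. vimage_algebra (space M) (Y n) Z"
  defines "G \<equiv> vimage_algebra (space M) (\<lambda>\<omega>. \<lambda>n\<in>I. \<tau> n \<omega>) (\<Pi>\<^sub>M n\<in>I. borel)"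
  assumes M: "prob_space M"
    and indep: "prob_space.indep_vars M (\<lambda>_. Z) Y I"
    and S: "\<And>n. n \<in> I \<Longrightarrow> S n \<in> borel_measurable (\<Sigma> n)"
    and \<tau>: "\<And>n. n \<in> I \<Longrightarrow> \<tau> n \<in> borel_measurable (\<Sigma> n)"
    and g: "g \<in> borel_measurable borel"
    and eq: "\<And>n A. n \<in> I \<Longrightarrow> A \<in> sets borel \<Longrightarrow>
      (\<integral>\<^sup>+\<omega>. S n \<omega> * indicator A (\<tau> n \<omega>) \<partial>M) = (\<integral>\<^sup>+\<omega>. g (\<tau> n \<omega>) * indicator A (\<tau> n \<omega>) \<partial>M)"
  shows "sigma_finite_subalgebra M G"
    and "AE \<omega> in M. nn_cond_exp M G (\<lambda>\<omega>. \<Sum>n\<in>I. S n \<omega>) \<omega> = (\<Sum>n\<in>I. g (\<tau> n \<omega>))"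
proof -
  interpret prob_space M by fact
  have Y: "Y n \<in> measurable M Z" if "n \<in> I" for n
    using indep that by (simp add: indep_vars_def)
  have \<Sigma>_sets: "sets (\<Sigma> n) = {Y n -` A \<inter> space M | A. A \<in> sets Z}" if "n \<in> I" for n
    unfolding \<Sigma>_def using measurable_space[OF Y[OF that]] by (intro sets_vimage_algebra2) auto
  have \<Sigma>_M: "measurable (\<Sigma> n) B \<subseteq> measurable M B" if "n \<in> I" for n and B :: "'b measure"
  proof (rule measurable_mono)
    show "sets (\<Sigma> n) \<le> sets M" unfolding \<Sigma>_sets[OF that] using measurable_sets[OF Y[OF that]] by auto
  qed (simp_all add: \<Sigma>_def)
  have \<tau>M: "\<tau> n \<in> borel_measurable M" and SM: "S n \<in> borel_measurable M" if "n \<in> I" for n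
    using \<Sigma>_M[OF that] \<tau>[OF that] S[OF that] by blast+
  \<comment> \<open>Independence of the paths is independence of the sigma-algebras that they generate.\<close>
  have id_indep: "indep_vars \<Sigma> (\<lambda>n \<omega>. \<omega>) I"
    unfolding indep_vars_def2
  proof (intro conjI ballI)
    fix n assume n: "n \<in> I"
    show "(\<lambda>\<omega>. \<omega>) \<in> measurable M (\<Sigma> n)"
      using \<Sigma>_M[OF n, of "\<Sigma> n"] measurable_ident_sets[of "\<Sigma> n" "\<Sigma> n"] by (auto simp: id_def)
  next
    have "indep_sets (\<lambda>n. {Y n -` A \<inter> space M | A. A \<in> sets Z}) I"
      using indep by (simp add: indep_vars_def2)
    then show "indep_sets (\<lambda>n. {(\<lambda>\<omega>. \<omega>) -` A \<inter> space M | A. A \<in> sets (\<Sigma> n)}) I"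
    proof (rule indep_sets_mono_sets)
      fix n assume n: "n \<in> I"
      show "{(\<lambda>\<omega>. \<omega>) -` A \<inter> space M | A. A \<in> sets (\<Sigma> n)} \<subseteq> {Y n -` A \<inter> space M | A. A \<in> sets Z}"
        unfolding \<Sigma>_sets[OF n] by blast
    qed
  qed
  have "(\<lambda>\<omega>. (S n \<omega>, \<tau> n \<omega>)) \<in> measurable (\<Sigma> n) (borel \<Otimes>\<^sub>M borel)" if "n \<in> I" for n
    using S[OF that] \<tau>[OF that] by (rule measurable_Pair)
  from indep_vars_compose2[OF id_indep this]
  have indep_pairs: "indep_vars (\<lambda>_. borel \<Otimes>\<^sub>M borel) (\<lambda>n \<omega>. (S n \<omega>, \<tau> n \<omega>)) I" by simp
  let ?B = "borel \<Otimes>\<^sub>M borel :: (ennreal \<times> real) measure"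
  let ?p = "\<lambda>n \<omega>. \<lambda>i\<in>{n}. (S i \<omega>, \<tau> i \<omega>)" and ?r = "\<lambda>n \<omega>. \<lambda>i\<in>I - {n}. (S i \<omega>, \<tau> i \<omega>)"
  let ?P = "\<lambda>n. \<Pi>\<^sub>M i\<in>{n}. ?B" and ?R = "\<lambda>n. \<Pi>\<^sub>M i\<in>I - {n}. ?B"
  have split: "(\<integral>\<^sup>+\<omega>. h (?p n \<omega>) (?r n \<omega>) \<partial>M) = (\<integral>\<^sup>+r. \<integral>\<^sup>+\<omega>. h (?p n \<omega>) r \<partial>M \<partial>distr M (?R n) (?r n))"
    if n: "n \<in> I" and h: "(\<lambda>(p, r). h p r) \<in> borel_measurable (?P n \<Otimes>\<^sub>M ?R n)" for n h
  proof -
    have "indep_var (?P n) (?p n) (?R n) (?r n)"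
      by (rule indep_var_restrict[OF indep_pairs]) (use n in auto)
    then have p: "?p n \<in> measurable M (?P n)" and r: "?r n \<in> measurable M (?R n)"
      and prod: "distr M (?P n) (?p n) \<Otimes>\<^sub>M distr M (?R n) (?r n) = distr M (?P n \<Otimes>\<^sub>M ?R n) (\<lambda>\<omega>. (?p n \<omega>, ?r n \<omega>))"
      unfolding indep_var_distribution_eq by auto
    interpret p: prob_space "distr M (?P n) (?p n)" by (rule prob_space_distr[OF p])
    interpret r: prob_space "distr M (?R n) (?r n)" by (rule prob_space_distr[OF r])
    interpret pair_sigma_finite "distr M (?P n) (?p n)" "distr M (?R n) (?r n)" ..
    have h': "(\<lambda>(p, r). h p r) \<in> borel_measurable (distr M (?P n) (?p n) \<Otimes>\<^sub>M distr M (?R n) (?r n))"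
      using h by (simp add: measurable_def space_pair_measure cong: sets_pair_measure_cong)
    have "(\<integral>\<^sup>+\<omega>. h (?p n \<omega>) (?r n \<omega>) \<partial>M) =
        (\<integral>\<^sup>+z. (\<lambda>(p, r). h p r) z \<partial>distr M (?P n \<Otimes>\<^sub>M ?R n) (\<lambda>\<omega>. (?p n \<omega>, ?r n \<omega>)))"
      using h by (subst nn_integral_distr[OF measurable_Pair[OF p r]]) auto
    also have "\<dots> = (\<integral>\<^sup>+r. \<integral>\<^sup>+p. h p r \<partial>distr M (?P n) (?p n) \<partial>distr M (?R n) (?r n))"
      unfolding prod[symmetric] using nn_integral_snd[OF h'] by simp
    also have "\<dots> = (\<integral>\<^sup>+r. \<integral>\<^sup>+\<omega>. h (?p n \<omega>) r \<partial>M \<partial>distr M (?R n) (?r n))"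
    proof (rule nn_integral_cong)
      fix r assume "r \<in> space (distr M (?R n) (?r n))"
      then have "r \<in> space (?R n)" by simp
      from measurable_Pair1[OF h this]
      show "(\<integral>\<^sup>+p. h p r \<partial>distr M (?P n) (?p n)) = (\<integral>\<^sup>+\<omega>. h (?p n \<omega>) r \<partial>M)"
        by (intro nn_integral_distr p) simp
    qed
    finally show ?thesis .
  qed
  have tuple: "(\<lambda>\<omega>. \<lambda>n\<in>I. \<tau> n \<omega>) \<in> measurable M (\<Pi>\<^sub>M n\<in>I. borel)"
    by (rule measurable_restrict) (rule \<tau>M)
  have G_sets: "sets G = {(\<lambda>\<omega>. \<lambda>n\<in>I. \<tau> n \<omega>) -` C \<inter> space M | C. C \<in> sets (\<Pi>\<^sub>M n\<in>I. borel)}"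
    unfolding G_def using measurable_space[OF tuple] by (intro sets_vimage_algebra2) auto
  have sub: "subalgebra M G"
    unfolding subalgebra_def G_sets using measurable_sets[OF tuple] by (auto simp: G_def)
  interpret finite_measure_subalgebra M G
    by (intro finite_measure_subalgebra.intro finite_measure_subalgebra_axioms.intro sub) unfold_locales
  show "sigma_finite_subalgebra M G" ..
  have "AE \<omega> in M. (\<Sum>n\<in>I. g (\<tau> n \<omega>)) = nn_cond_exp M G (\<lambda>\<omega>. \<Sum>n\<in>I. S n \<omega>) \<omega>"
  proof (rule nn_cond_exp_charact)
    show "(\<lambda>\<omega>. \<Sum>n\<in>I. S n \<omega>) \<in> borel_measurable M" by (intro borel_measurable_sum SM)
    have "(\<lambda>\<omega>. (\<lambda>n\<in>I. \<tau> n \<omega>) n) \<in> borel_measurable G" if "n \<in> I" for n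
    proof (rule measurable_compose[OF _ measurable_component_singleton[OF that]])
      show "(\<lambda>\<omega>. \<lambda>n\<in>I. \<tau> n \<omega>) \<in> measurable G (\<Pi>\<^sub>M n\<in>I. borel)"
        unfolding G_def using measurable_space[OF tuple] by (intro measurable_vimage_algebra1) auto
    qed
    then have "\<tau> n \<in> borel_measurable G" if "n \<in> I" for n using that by simp
    then show "(\<lambda>\<omega>. \<Sum>n\<in>I. g (\<tau> n \<omega>)) \<in> borel_measurable G"
      by (intro borel_measurable_sum measurable_compose[OF _ g])
    fix A assume "A \<in> sets G"
    then obtain C where C: "C \<in> sets (\<Pi>\<^sub>M n\<in>I. borel)" "A = (\<lambda>\<omega>. \<lambda>n\<in>I. \<tau> n \<omega>) -` C \<inter> space M"
      unfolding G_sets by auto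
    have A: "A \<in> sets M" using measurable_sets[OF tuple C(1)] C(2) by simp
    have each: "(\<integral>\<^sup>+\<omega>. S n \<omega> * indicator A \<omega> \<partial>M) = (\<integral>\<^sup>+\<omega>. g (\<tau> n \<omega>) * indicator A \<omega> \<partial>M)" if n: "n \<in> I" for n
    proof -
      define U where "U t r = (\<lambda>i\<in>I. if i = n then t else snd (r i))" for t :: real and r :: "nat \<Rightarrow> ennreal \<times> real"
      have indA: "indicator A \<omega> = (indicator C (U (\<tau> n \<omega>) (?r n \<omega>)) :: ennreal)" if "\<omega> \<in> space M" for \<omega>
      proof -
        have "U (\<tau> n \<omega>) (?r n \<omega>) = (\<lambda>i\<in>I. \<tau> i \<omega>)" by (auto simp: U_def fun_eq_iff)
        then show ?thesis using that C(2) by (simp add: indicator_def)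
      qed
      have pn: "(\<lambda>z. fst z n) \<in> measurable (?P n \<Otimes>\<^sub>M ?R n) ?B"
        by (rule measurable_compose[OF measurable_fst measurable_component_singleton]) simp
      have "(\<lambda>z. U (snd (fst z n)) (snd z)) \<in> measurable (?P n \<Otimes>\<^sub>M ?R n) (\<Pi>\<^sub>M i\<in>I. borel)"
        unfolding U_def
      proof (rule measurable_restrict)
        fix i assume i: "i \<in> I"
        show "(\<lambda>z. if i = n then snd (fst z n) else snd (snd z i)) \<in> borel_measurable (?P n \<Otimes>\<^sub>M ?R n)"
        proof (cases "i = n")
          case True
          then show ?thesis using measurable_compose[OF pn measurable_snd] by simp
        next
          case False
          have "(\<lambda>z. snd z i) \<in> measurable (?P n \<Otimes>\<^sub>M ?R n) ?B"
            by (rule measurable_compose[OF measurable_snd measurable_component_singleton]) (use i False in simp)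
          then show ?thesis using False measurable_compose[OF _ measurable_snd] by simp
        qed
      qed
      from measurable_compose[OF this borel_measurable_indicator[OF C(1)]]
      have indC: "(\<lambda>z. indicator C (U (snd (fst z n)) (snd z)) :: ennreal) \<in> borel_measurable (?P n \<Otimes>\<^sub>M ?R n)" .
      have g': "(\<lambda>z. g (snd (fst z n))) \<in> borel_measurable (?P n \<Otimes>\<^sub>M ?R n)"
        by (rule measurable_compose[OF measurable_compose[OF pn measurable_snd] g])
      have s': "(\<lambda>z. fst (fst z n)) \<in> borel_measurable (?P n \<Otimes>\<^sub>M ?R n)"
        by (rule measurable_compose[OF pn measurable_fst])
      have hS: "(\<lambda>(p, r). fst (p n) * indicator C (U (snd (p n)) r)) \<in> borel_measurable (?P n \<Otimes>\<^sub>M ?R n)"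
        using s' indC by (simp add: case_prod_beta')
      have hg: "(\<lambda>(p, r). g (snd (p n)) * indicator C (U (snd (p n)) r)) \<in> borel_measurable (?P n \<Otimes>\<^sub>M ?R n)"
        using g' indC by (simp add: case_prod_beta')
      have "(\<integral>\<^sup>+\<omega>. S n \<omega> * indicator A \<omega> \<partial>M) = (\<integral>\<^sup>+\<omega>. S n \<omega> * indicator C (U (\<tau> n \<omega>) (?r n \<omega>)) \<partial>M)"
        by (intro nn_integral_cong) (simp add: indA)
      also have "\<dots> = (\<integral>\<^sup>+r. \<integral>\<^sup>+\<omega>. S n \<omega> * indicator C (U (\<tau> n \<omega>) r) \<partial>M \<partial>distr M (?R n) (?r n))"
        using split[OF n hS] by simp
      also have "\<dots> = (\<integral>\<^sup>+r. \<integral>\<^sup>+\<omega>. g (\<tau> n \<omega>) * indicator C (U (\<tau> n \<omega>) r) \<partial>M \<partial>distr M (?R n) (?r n))"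
      proof (rule nn_integral_cong)
        fix r
        have "(\<lambda>t. U t r) \<in> measurable borel (\<Pi>\<^sub>M i\<in>I. borel)"
          unfolding U_def by (rule measurable_restrict) simp
        from measurable_sets[OF this C(1)] have "{t. U t r \<in> C} \<in> sets borel" by (simp add: vimage_def)
        from eq[OF n this] show "(\<integral>\<^sup>+\<omega>. S n \<omega> * indicator C (U (\<tau> n \<omega>) r) \<partial>M) =
            (\<integral>\<^sup>+\<omega>. g (\<tau> n \<omega>) * indicator C (U (\<tau> n \<omega>) r) \<partial>M)"
          by (simp add: indicator_def)
      qed
      also have "\<dots> = (\<integral>\<^sup>+\<omega>. g (\<tau> n \<omega>) * indicator C (U (\<tau> n \<omega>) (?r n \<omega>)) \<partial>M)"
        using split[OF n hg] by simp
      also have "\<dots> = (\<integral>\<^sup>+\<omega>. g (\<tau> n \<omega>) * indicator A \<omega> \<partial>M)"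
        by (intro nn_integral_cong) (simp add: indA)
      finally show ?thesis .
    qed
    have "(\<integral>\<^sup>+\<omega>. (\<Sum>n\<in>I. S n \<omega>) * indicator A \<omega> \<partial>M) = (\<Sum>n\<in>I. \<integral>\<^sup>+\<omega>. S n \<omega> * indicator A \<omega> \<partial>M)"
      unfolding sum_distrib_right using SM A by (intro nn_integral_sum) auto
    also have "\<dots> = (\<Sum>n\<in>I. \<integral>\<^sup>+\<omega>. g (\<tau> n \<omega>) * indicator A \<omega> \<partial>M)"
      by (intro sum.cong refl each)
    also have "\<dots> = (\<integral>\<^sup>+\<omega>. (\<Sum>n\<in>I. g (\<tau> n \<omega>)) * indicator A \<omega> \<partial>M)"
      unfolding sum_distrib_right
    proof (intro nn_integral_sum[symmetric])
      fix n assume "n \<in> I"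
      then show "(\<lambda>\<omega>. g (\<tau> n \<omega>) * indicator A \<omega>) \<in> borel_measurable M"
        using A measurable_compose[OF \<tau>M g] by simp
    qed
    finally show "(\<integral>\<^sup>+\<omega>\<in>A. (\<Sum>n\<in>I. S n \<omega>) \<partial>M) = (\<integral>\<^sup>+\<omega>\<in>A. (\<Sum>n\<in>I. g (\<tau> n \<omega>)) \<partial>M)" .
  qed
  then show "AE \<omega> in M. nn_cond_exp M G (\<lambda>\<omega>. \<Sum>n\<in>I. S n \<omega>) \<omega> = (\<Sum>n\<in>I. g (\<tau> n \<omega>))"
    by eventually_elim simp
qed

text \<open>From time \<open>0\<close> on, the first factor of \<open>P_bar\<close> covers the whole first cell and is the first factor of
  the product over all cells before \<open>x\<close>.\<close>

lemma (in rate_data) abs_density_eq: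
  assumes x: "0 \<le> x"
  shows "abs_density x = absorption_density K s Tk \<pi> x"
proof -
  define k where "k = cell_index K s x"
  have k: "k \<in> {1..K}" using cell_index_mem[OF x] by (simp add: k_def)
  have "Q 0 x = A_prod s Tk 1 (k - 1) ** mat_exp ((x - pt (k - 1)) *\<^sub>R Tk k)"
  proof (cases "k = 1")
    case True
    then show ?thesis by (simp add: P_bar_def k_def[symmetric] A_prod_empty)
  next
    case False
    then have "1 < k" using k by simp
    have "A_prod s Tk 1 (k - 1) = mat_exp (pt 1 *\<^sub>R Tk 1) ** A_prod s Tk 2 (k - 1)"
      unfolding A_prod_def using \<open>1 < k\<close> by (subst upt_conv_Cons) (auto simp: numeral_2_eq_2)
    then show ?thesis using \<open>1 < k\<close> by (simp add: P_bar_def Let_def k_def[symmetric] numeral_2_eq_2)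
  qed
  moreover have "(\<pi> v* B) \<bullet> t = (\<Sum>i\<in>UNIV. \<pi> $ i * (B *v t) $ i)" for B :: "real ^ 'p ^ 'p" and t
  proof -
    have "(\<pi> v* B) \<bullet> t = (\<Sum>j\<in>UNIV. \<Sum>i\<in>UNIV. \<pi> $ i * B $ i $ j * t $ j)"
      by (simp only: inner_vec_def vector_matrix_mult_def vec_lambda_beta inner_real_def sum_distrib_left
          sum_distrib_right mult_ac)
    also have "\<dots> = (\<Sum>i\<in>UNIV. \<Sum>j\<in>UNIV. \<pi> $ i * B $ i $ j * t $ j)" by (rule sum.swap)
    finally show ?thesis by (simp add: matrix_vector_mult_def sum_distrib_left mult.assoc)
  qed
  ultimately show ?thesis
    unfolding abs_density_def exit_density_def absorption_density_def Let_def k_def[symmetric]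
    by (simp add: ex_def k_def[symmetric])
qed

context phase_type
begin

text \<open>Dividing by the density of \<open>\<tau>\<close> is harmless where it vanishes: the set of these points has
  probability zero, hence so does the restriction of \<open>S\<close> to it, and the numerator vanishes there.\<close>

lemma absorption_ratio:
  fixes num :: "real \<Rightarrow> real"
  assumes num: "num \<in> borel_measurable borel" "\<And>x. 0 < x \<Longrightarrow> 0 \<le> num x"
    and S: "S \<in> borel_measurable M"
    and eq: "\<And>A. A \<in> sets borel \<Longrightarrow> (\<integral>\<^sup>+\<omega>. S \<omega> * indicator A (\<tau> \<omega>) \<partial>M) =
      (\<integral>\<^sup>+x. indicator A x * (indicator {0<..} x * ennreal (num x)) \<partial>lborel)"
    and A: "A \<in> sets borel"
  shows "(\<integral>\<^sup>+\<omega>. S \<omega> * indicator A (\<tau> \<omega>) \<partial>M) =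
    (\<integral>\<^sup>+\<omega>. ennreal (num (\<tau> \<omega>) / abs_density (\<tau> \<omega>)) * indicator A (\<tau> \<omega>) \<partial>M)"
proof -
  let ?f = "\<lambda>x. indicator {0<..} x * ennreal (abs_density x) :: ennreal"
  have f: "?f \<in> borel_measurable lborel" using abs_density_measurable by simp
  have law: "distr M borel \<tau> = density lborel ?f"
  proof (rule measure_eqI)
    fix B assume "B \<in> sets (distr M borel \<tau>)"
    then have B: "B \<in> sets borel" by simp
    have "emeasure (distr M borel \<tau>) B = emeasure M {\<omega> \<in> space M. \<tau> \<omega> \<in> B}"
      using B by (simp add: emeasure_distr vimage_def Int_def conj_commute)
    then show "emeasure (distr M borel \<tau>) B = emeasure (density lborel ?f) B"
      using B f absorption_law[OF B] by (simp add: emeasure_density mult.commute)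
  qed simp
  define Z where "Z = {x. 0 < x \<and> abs_density x = 0}"
  have Z: "Z \<in> sets borel" unfolding Z_def using abs_density_measurable by measurable
  have "emeasure M {\<omega> \<in> space M. \<tau> \<omega> \<in> Z} = (\<integral>\<^sup>+x. 0 \<partial>(lborel :: real measure))"
    unfolding absorption_law[OF Z] by (intro nn_integral_cong) (auto simp: Z_def indicator_def)
  then have "{\<omega> \<in> space M. \<tau> \<omega> \<in> Z} \<in> null_sets M" using \<tau>_event[OF Z] by (simp add: null_sets_def)
  then have "AE \<omega> in M. \<tau> \<omega> \<notin> Z" by (rule AE_I') auto
  then have "(\<integral>\<^sup>+\<omega>. S \<omega> * indicator Z (\<tau> \<omega>) \<partial>M) = (\<integral>\<^sup>+\<omega>. 0 \<partial>M)"
    by (intro nn_integral_cong_AE) (auto simp: indicator_def)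
  then have "(\<integral>\<^sup>+x. indicator Z x * (indicator {0<..} x * ennreal (num x)) \<partial>lborel) = 0"
    using eq[OF Z] by simp
  then have null: "AE x in lborel. indicator Z x * (indicator {0<..} x * ennreal (num x)) = 0"
    using Z num(1) by (subst (asm) nn_integral_0_iff_AE) auto
  have q: "(\<lambda>x. ennreal (num x / abs_density x) * indicator A x) \<in> borel_measurable borel"
    using num(1) abs_density_measurable A by simp
  have "(\<integral>\<^sup>+\<omega>. ennreal (num (\<tau> \<omega>) / abs_density (\<tau> \<omega>)) * indicator A (\<tau> \<omega>) \<partial>M) =
      (\<integral>\<^sup>+x. ennreal (num x / abs_density x) * indicator A x \<partial>distr M borel \<tau>)"
    by (rule nn_integral_distr[symmetric]) (use \<tau>_measurable q in simp_all)
  also have "\<dots> = (\<integral>\<^sup>+x. ?f x * (ennreal (num x / abs_density x) * indicator A x) \<partial>lborel)"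
    unfolding law using f q by (intro nn_integral_density) simp_all
  also have "\<dots> = (\<integral>\<^sup>+x. indicator A x * (indicator {0<..} x * ennreal (num x)) \<partial>lborel)"
  proof (rule nn_integral_cong_AE)
    show "AE x in lborel. ?f x * (ennreal (num x / abs_density x) * indicator A x) =
        indicator A x * (indicator {0<..} x * ennreal (num x))"
      using null
    proof eventually_elim
      case (elim x)
      show ?case
      proof (cases "0 < x \<and> x \<in> A")
        case True
        show ?thesis
        proof (cases "abs_density x = 0")
          case True
          then show ?thesis using elim \<open>0 < x \<and> x \<in> A\<close> by (simp add: Z_def indicator_def)
        next
          case False
          then have "0 < abs_density x" using True abs_density_nonneg[of x] by simp
          then have "ennreal (abs_density x) * ennreal (num x / abs_density x) = ennreal (num x)"
            using True num(2)[of x] by (simp add: ennreal_mult[symmetric])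
          then show ?thesis using True by simp
        qed
      qed (auto simp: indicator_def)
    qed
  qed
  finally show ?thesis using eq[OF A] by simp
qed

lemma Q_le_1: "0 \<le> u \<Longrightarrow> u \<le> t \<Longrightarrow> Q u t $ i $ j \<le> 1"
proof -
  assume ut: "0 \<le> u" "u \<le> t"
  have "Q u t $ i $ j \<le> (\<Sum>l\<in>UNIV. Q u t $ i $ l)"
    using Q_nonneg[OF ut] by (intro member_le_sum) auto
  also have "\<dots> \<le> 1"
    using P_row_sum[OF ut, of "Some i"] P_None_nonneg[OF ut, of i] by (simp add: sum_option P_Some_Some ut)
  finally show ?thesis .
qed

lemma visit_density_finite:
  assumes "0 < x" "S \<subseteq> {0..}" "0 \<le> c"
  shows "visit_density i j c S x < \<infinity>"
proof -
  let ?b = "c * (\<Sum>l\<in>UNIV. ex x $ l)"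
  have "visit_density i j c S x \<le> (\<integral>\<^sup>+u. ennreal ?b * indicator {0..x} u \<partial>lborel)"
    unfolding visit_density_def
  proof (rule nn_integral_mono)
    fix u
    show "indicator S u * (indicator {u<..} x * ennreal ((\<pi> v* Q 0 u) $ i * c * exit_density j u x))
        \<le> ennreal ?b * indicator {0..x} u"
    proof (cases "u \<in> S \<and> u < x")
      case True
      then have u: "0 \<le> u" "u \<le> x" using assms by auto
      have "exit_density j u x \<le> (\<Sum>l\<in>UNIV. 1 * ex x $ l)"
        unfolding exit_density_def matrix_vector_mult_def vec_lambda_beta
        using u assms by (intro sum_mono mult_right_mono Q_le_1 ex_nonneg) auto
      then have "(occ (Some i) u * c) * exit_density j u x \<le> (1 * c) * (\<Sum>l\<in>UNIV. ex x $ l)"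
        using u assms occ_le_1 occ_nonneg
        by (intro mult_mono mult_right_mono exit_density_nonneg mult_nonneg_nonneg sum_nonneg ex_nonneg) auto
      then show ?thesis using True u by (simp add: occ_eq[symmetric] ennreal_leI)
    qed (auto simp: indicator_def)
  qed
  also have "\<dots> < \<infinity>" using assms by (simp add: nn_integral_cmult ennreal_mult_less_top)
  finally show ?thesis .
qed

text \<open>The open interval of integration and the part of the cell before \<open>x\<close> differ at most at the right end
  point of the cell; both are empty if \<open>x\<close> does not exceed the left end point.\<close>

lemma visit_density_interval_integral:
  assumes x: "0 < x" and k: "k \<in> {1..K}" and c: "0 \<le> c"
  shows "(LBINT u=min (s (k - 1)) (ereal x)..min (s k) (ereal x). (\<pi> v* Q 0 u) $ i * c * exit_density j u x) =
    enn2real (visit_density i j c (cell s k) x)"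
proof -
  let ?a = "min (s (k - 1)) (ereal x)" and ?b = "min (s k) (ereal x)"
  let ?h = "\<lambda>u. (\<pi> v* Q 0 u) $ i * c * exit_density j u x"
  have ab: "?a \<le> ?b" using s_le[of "k - 1" k] k by (intro min.mono) auto
  have ein: "u \<in> einterval ?a ?b \<longleftrightarrow> s (k - 1) < ereal u \<and> ereal u < s k \<and> u < x" for u
    by (auto simp: einterval_def min_less_iff_disj)
  have h_nonneg: "0 \<le> ?h u" if "u \<in> einterval ?a ?b" for u
  proof -
    have "u \<in> cell s k" using that unfolding ein by (auto simp: cell_def)
    then have "0 \<le> u" "u \<le> x" using cell_pos[OF k] that unfolding ein by force+
    then show ?thesis using c occ_nonneg by (auto simp: occ_eq[symmetric] intro!: mult_nonneg_nonneg exit_density_nonneg)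
  qed
  have "(\<lambda>u. (\<pi> v* Q 0 u) $ i) \<in> borel_measurable borel"
    unfolding vector_matrix_mult_def vec_lambda_beta
    by (intro borel_measurable_sum borel_measurable_times P_bar_measurable borel_measurable_const) simp_all
  moreover have "(\<lambda>u. exit_density j u x) \<in> borel_measurable borel"
    by (rule exit_density_measurable) simp_all
  ultimately have h_meas: "(\<lambda>u. indicator (einterval ?a ?b) u *\<^sub>R ?h u) \<in> borel_measurable lborel" by simp
  have "(LBINT u=?a..?b. ?h u) = (LINT u|lborel. indicator (einterval ?a ?b) u *\<^sub>R ?h u)"
    using ab by (simp add: interval_lebesgue_integral_def set_lebesgue_integral_def)
  also have "\<dots> = enn2real (\<integral>\<^sup>+u. ennreal (indicator (einterval ?a ?b) u *\<^sub>R ?h u) \<partial>lborel)"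
    using h_meas h_nonneg by (intro integral_eq_nn_integral) (auto simp: indicator_def)
  also have "(\<integral>\<^sup>+u. ennreal (indicator (einterval ?a ?b) u *\<^sub>R ?h u) \<partial>lborel) = visit_density i j c (cell s k) x"
    unfolding visit_density_def
  proof (rule nn_integral_cong_AE)
    have "AE u in lborel. u \<noteq> pt k" by (rule AE_lborel_singleton)
    then show "AE u in lborel. ennreal (indicator (einterval ?a ?b) u *\<^sub>R ?h u) =
        indicator (cell s k) u * (indicator {u<..} x * ennreal (?h u))"
    proof eventually_elim
      case (elim u)
      have "u \<in> einterval ?a ?b \<longleftrightarrow> u \<in> cell s k \<and> u < x"
      proof -
        have "ereal u \<noteq> s k" using elim by (metis real_of_ereal.simps(1))
        then show ?thesis unfolding ein cell_def by auto
      qed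
      then show ?case by (simp add: indicator_def)
    qed
  qed
  finally show ?thesis .
qed

end

section \<open>The conditional expected statistics\<close>

text \<open>For a nonnegative statistic the conditional expectation is characterised by its integrals over events
  of the absorption times, whether or not the statistic is integrable. The positivity of the absorption
  times is part of the conclusion so that formulas valid for positive times only can be inserted.\<close>

lemma conditional_expected_statistic:
  fixes stat :: "(real \<Rightarrow> 'p::finite option) \<Rightarrow> real" and M :: "'w measure"
    and X :: "nat \<Rightarrow> real \<Rightarrow> 'w \<Rightarrow> 'p option"
  assumes M: "prob_space M" and rates: "rate_data K s Tk \<pi>"
    and process: "\<And>n. n \<in> {1..N} \<Longrightarrow> \<exists>P L. phase_type K s Tk \<pi> M (X n) Tf P L"
    and indep: "prob_space.indep_vars M (\<lambda>_. \<Pi>\<^sub>M t\<in>{0..}. count_space UNIV)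
      (\<lambda>n \<omega>. \<lambda>t\<in>{0..}. X n t \<omega>) {1..N}"
    and stat_nonneg: "\<And>x. 0 \<le> stat x"
    and stat_measurable: "\<And>F Y. path_process F Y \<Longrightarrow> (\<lambda>\<omega>::'w. stat (\<lambda>t. Y t \<omega>)) \<in> borel_measurable F"
    and num: "num \<in> borel_measurable borel" "\<And>x. 0 < x \<Longrightarrow> 0 \<le> num x"
    and eq: "\<And>Y P L A. phase_type K s Tk \<pi> M Y Tf P L \<Longrightarrow> A \<in> sets borel \<Longrightarrow>
      (\<integral>\<^sup>+\<omega>. ennreal (stat (\<lambda>t. Y t \<omega>)) * indicator A (absorption_time (\<lambda>t. Y t \<omega>)) \<partial>M) =
      (\<integral>\<^sup>+x. indicator A x * (indicator {0<..} x * ennreal (num x)) \<partial>lborel)"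
  shows "AE \<omega> in M. (\<forall>n\<in>{1..N}. 0 < absorption_time (\<lambda>t. X n t \<omega>)) \<and>
    real_cond_exp M (sigma_absorption M N X) (\<lambda>\<omega>. \<Sum>n=1..N. stat (\<lambda>t. X n t \<omega>)) \<omega> =
    (\<Sum>n=1..N. num (absorption_time (\<lambda>t. X n t \<omega>)) /
      absorption_density K s Tk \<pi> (absorption_time (\<lambda>t. X n t \<omega>)))"
proof -
  interpret prob_space M by fact
  interpret rate_data K s Tk \<pi> by fact
  let ?\<tau> = "\<lambda>n \<omega>. absorption_time (\<lambda>t. X n t \<omega>)"
  let ?Z = "\<Pi>\<^sub>M t\<in>{0..}. count_space UNIV :: 'p option measure"
  let ?Y = "\<lambda>n \<omega>. \<lambda>t\<in>{0::real..}. X n t \<omega>"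
  let ?G = "sigma_absorption M N X"
  define g where "g x = ennreal (num x / abs_density x)" for x
  have path: "path_process (vimage_algebra (space M) (?Y n) ?Z) (X n)" if n: "n \<in> {1..N}" for n
  proof
    obtain P L where "phase_type K s Tk \<pi> M (X n) Tf P L" using process[OF n] by auto
    then interpret phase_type K s Tk \<pi> M "X n" Tf P L .
    show "jump_path (\<lambda>t. X n t \<omega>)" if "\<omega> \<in> space (vimage_algebra (space M) (?Y n) ?Z)" for \<omega>
      using X_path that by simp
    fix t :: real assume t: "0 \<le> t"
    have "?Y n \<in> measurable (vimage_algebra (space M) (?Y n) ?Z) ?Z"
      by (rule measurable_vimage_algebra1) (auto simp: space_PiM)
    from measurable_compose[OF this measurable_component_singleton, of t] t
    show "X n t \<in> measurable (vimage_algebra (space M) (?Y n) ?Z) (count_space UNIV)" by simp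
  qed
  have ratio: "(\<integral>\<^sup>+\<omega>. ennreal (stat (\<lambda>t. X n t \<omega>)) * indicator A (?\<tau> n \<omega>) \<partial>M) =
      (\<integral>\<^sup>+\<omega>. g (?\<tau> n \<omega>) * indicator A (?\<tau> n \<omega>) \<partial>M)" if n: "n \<in> {1..N}" and A: "A \<in> sets borel" for n A
  proof -
    obtain P L where pt: "phase_type K s Tk \<pi> M (X n) Tf P L" using process[OF n] by auto
    then interpret phase_type K s Tk \<pi> M "X n" Tf P L .
    show ?thesis
      unfolding g_def using stat_measurable[OF path_process_axioms]
      by (intro absorption_ratio num A eq[OF pt]) simp_all
  qed
  have g: "g \<in> borel_measurable borel" unfolding g_def using num(1) abs_density_measurable by simp
  have G: "?G = vimage_algebra (space M) (\<lambda>\<omega>. \<lambda>n\<in>{1..N}. ?\<tau> n \<omega>) (\<Pi>\<^sub>M n\<in>{1..N}. borel)"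
    by (simp add: sigma_absorption_def)
  have sub: "sigma_finite_subalgebra M ?G"
    and cond: "AE \<omega> in M. nn_cond_exp M ?G (\<lambda>\<omega>. \<Sum>n\<in>{1..N}. ennreal (stat (\<lambda>t. X n t \<omega>))) \<omega> =
      (\<Sum>n\<in>{1..N}. g (?\<tau> n \<omega>))"
  proof -
    have Sm: "(\<lambda>\<omega>. ennreal (stat (\<lambda>t. X n t \<omega>))) \<in> borel_measurable (vimage_algebra (space M) (?Y n) ?Z)"
      if "n \<in> {1..N}" for n
      by (rule measurable_compose[OF stat_measurable[OF path[OF that]] measurable_ennreal])
    have \<tau>m: "?\<tau> n \<in> borel_measurable (vimage_algebra (space M) (?Y n) ?Z)" if "n \<in> {1..N}" for n
      by (rule absorption_time_measurable[OF path[OF that]])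
    show "sigma_finite_subalgebra M ?G"
      unfolding G by (rule nn_cond_exp_sum_indep(1)[OF M indep Sm \<tau>m g ratio])
    show "AE \<omega> in M. nn_cond_exp M ?G (\<lambda>\<omega>. \<Sum>n\<in>{1..N}. ennreal (stat (\<lambda>t. X n t \<omega>))) \<omega> =
      (\<Sum>n\<in>{1..N}. g (?\<tau> n \<omega>))"
      unfolding G by (rule nn_cond_exp_sum_indep(2)[OF M indep Sm \<tau>m g ratio])
  qed
  interpret sigma_finite_subalgebra M ?G by fact
  have zero: "AE \<omega> in M. 0 = nn_cond_exp M ?G (\<lambda>\<omega>. 0) \<omega>"
    by (rule nn_cond_exp_F_meas) simp
  have pos: "AE \<omega> in M. \<forall>n\<in>{1..N}. 0 < ?\<tau> n \<omega>"
  proof (rule AE_ball_countable[THEN iffD2]; (intro ballI)?)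
    fix n assume n: "n \<in> {1..N}"
    obtain P L where "phase_type K s Tk \<pi> M (X n) Tf P L" using process[OF n] by auto
    then interpret phase_type K s Tk \<pi> M "X n" Tf P L .
    show "AE \<omega> in M. 0 < ?\<tau> n \<omega>" using AE_regular by eventually_elim (simp add: regular_def)
  qed auto
  have sum: "ennreal (\<Sum>n\<in>{1..N}. stat (\<lambda>t. X n t \<omega>)) = (\<Sum>n\<in>{1..N}. ennreal (stat (\<lambda>t. X n t \<omega>)))" for \<omega>
    using stat_nonneg by (simp add: sum_ennreal)
  have neg: "ennreal (- (\<Sum>n\<in>{1..N}. stat (\<lambda>t. X n t \<omega>))) = 0" for \<omega>
    using stat_nonneg by (simp add: ennreal_neg sum_nonneg)
  show ?thesis
    using pos cond zero
  proof eventually_elim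
    case (elim \<omega>)
    have nonneg: "0 \<le> num (?\<tau> n \<omega>) / abs_density (?\<tau> n \<omega>)" if "n \<in> {1..N}" for n
    proof -
      have "0 < ?\<tau> n \<omega>" using elim(1) that by blast
      then show ?thesis by (intro divide_nonneg_nonneg num(2) abs_density_nonneg) simp_all
    qed
    have "real_cond_exp M ?G (\<lambda>\<omega>. \<Sum>n=1..N. stat (\<lambda>t. X n t \<omega>)) \<omega> = enn2real (\<Sum>n\<in>{1..N}. g (?\<tau> n \<omega>))"
      unfolding real_cond_exp_def sum neg using elim(2,3) by simp
    also have "(\<Sum>n\<in>{1..N}. g (?\<tau> n \<omega>)) =
        ennreal (\<Sum>n\<in>{1..N}. num (?\<tau> n \<omega>) / abs_density (?\<tau> n \<omega>))"
      unfolding g_def by (rule sum_ennreal[OF nonneg])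
    also have "enn2real \<dots> = (\<Sum>n\<in>{1..N}. num (?\<tau> n \<omega>) / abs_density (?\<tau> n \<omega>))"
      by (rule enn2real_ennreal[OF sum_nonneg[OF nonneg]])
    also have "\<dots> = (\<Sum>n\<in>{1..N}. num (?\<tau> n \<omega>) / absorption_density K s Tk \<pi> (?\<tau> n \<omega>))"
      using elim(1) by (intro sum.cong refl) (simp add: abs_density_eq less_imp_le)
    finally show ?case using elim(1) by simp
  qed
qed

lemma (in time_grid) bounded_intensity:
  fixes T :: "real \<Rightarrow> real ^ 'p::finite ^ 'p"
  assumes T: "\<And>k t. k \<in> {1..K} \<Longrightarrow> t \<in> cell s k \<Longrightarrow> T t = Tk k"
  shows "\<exists>L. \<forall>t\<ge>0. \<forall>a b. \<bar>intensity_matrix (T t) $ a $ b\<bar> \<le> L"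
proof -
  define V where "V = (\<lambda>(A, a, b). \<bar>intensity_matrix A $ a $ b\<bar>) ` ((insert (T 0) (Tk ` {1..K})) \<times> UNIV)"
  have "finite V" unfolding V_def by (intro finite_imageI finite_cartesian_product) auto
  have mem: "T t \<in> insert (T 0) (Tk ` {1..K})" if "0 \<le> t" for t
  proof (cases "t = 0")
    case False
    then have "0 < t" using that by simp
    then obtain k where "k \<in> {1..K}" "t \<in> cell s k" by (rule cell_exists)
    then show ?thesis using T by auto
  qed simp
  have "\<bar>intensity_matrix (T t) $ a $ b\<bar> \<le> Max V" if "0 \<le> t" for t a b
  proof (rule Max_ge[OF \<open>finite V\<close>])
    show "\<bar>intensity_matrix (T t) $ a $ b\<bar> \<in> V"
      unfolding V_def by (rule image_eqI[of _ _ "(T t, a, b)"]) (use mem[OF that] in auto)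
  qed
  then show ?thesis by blast
qed

lemma phase_type_exists:
  assumes M: "prob_space M" and rates: "rate_data K s Tk \<pi>"
    and Tf: "\<And>k t. k \<in> {1..K} \<Longrightarrow> t \<in> cell s k \<Longrightarrow> Tf t = Tk k"
    and mjp: "markov_jump_process M (initial_vector \<pi>) (\<lambda>t. intensity_matrix (Tf t)) X"
    and hits: "AE \<omega> in M. \<exists>t\<ge>0. X t \<omega> = None"
  shows "\<exists>P L. phase_type K s Tk \<pi> M X Tf P L"
proof -
  interpret prob_space M by fact
  interpret rate_data K s Tk \<pi> by fact
  obtain L where L: "\<And>t a b. 0 \<le> t \<Longrightarrow> \<bar>intensity_matrix (Tf t) $ a $ b\<bar> \<le> L"
    using bounded_intensity[of Tf Tk] Tf by blast
  obtain P where P: "forward_solution (\<lambda>t. intensity_matrix (Tf t)) P"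
    "\<And>s t F y b. 0 \<le> s \<Longrightarrow> s \<le> t \<Longrightarrow> finite F \<Longrightarrow> F \<subseteq> {0..<s} \<Longrightarrow>
       0 < \<P>(\<omega> in M. \<forall>r\<in>insert s F. X r \<omega> = y r) \<Longrightarrow>
       \<P>(\<omega> in M. X t \<omega> = b \<bar> \<forall>r\<in>insert s F. X r \<omega> = y r) = P s t $ y s $ b"
    using mjp unfolding markov_jump_process_def by blast
  have "phase_type K s Tk \<pi> M X Tf P L"
  proof unfold_locales
    show "X t \<in> measurable M (count_space UNIV)" if "0 \<le> t" for t
      using mjp that by (simp add: markov_jump_process_def)
    show "jump_path (\<lambda>t. X t \<omega>)" if "\<omega> \<in> space M" for \<omega>
      using mjp that by (simp add: markov_jump_process_def)
    show "prob {\<omega> \<in> space M. X 0 \<omega> = a} = initial_vector \<pi> $ a" for a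
      using mjp by (simp add: markov_jump_process_def)
    show "forward_solution (\<lambda>t. intensity_matrix (Tf t)) P" by (rule P(1))
    show "\<P>(\<omega> in M. X t \<omega> = b \<bar> \<forall>r\<in>insert s F. X r \<omega> = y r) = P s t $ y s $ b"
      if "0 \<le> s" "s \<le> t" "finite F" "F \<subseteq> {0..<s}" "0 < \<P>(\<omega> in M. \<forall>r\<in>insert s F. X r \<omega> = y r)" for s t F y b
      by (rule P(2)[OF that])
    show "\<bar>intensity_matrix (Tf t) $ a $ b\<bar> \<le> L" if "0 \<le> t" for t a b by (rule L[OF that])
    show "Tf t = Tk k" if "k \<in> {1..K}" "t \<in> cell s k" for k t by (rule Tf[OF that])
    show "AE \<omega> in M. \<exists>t\<ge>0. X t \<omega> = None" by (rule hits)
  qed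
  then show ?thesis by blast
qed

theorem corollary3p5:
  fixes \<Theta> :: "'q::euclidean_space set"
    and T :: "'q \<Rightarrow> real \<Rightarrow> real ^ 'p::finite ^ 'p"
    and Tk :: "'q \<Rightarrow> nat \<Rightarrow> real ^ 'p ^ 'p"
    and K N :: nat
    and s :: "nat \<Rightarrow> ereal"
    and \<pi> :: "real ^ 'p"
    and \<theta> :: 'q
    and M :: "'w measure"
    and X :: "nat \<Rightarrow> real \<Rightarrow> 'w \<Rightarrow> 'p option"
  assumes "interior \<Theta> \<noteq> {}"
    and "grid K s"
    and "\<And>\<eta> t. \<eta> \<in> \<Theta> \<Longrightarrow> 0 \<le> t \<Longrightarrow> sub_intensity_matrix (T \<eta> t)"
    and "\<And>\<eta> k t. \<eta> \<in> \<Theta> \<Longrightarrow> k \<in> {1..K} \<Longrightarrow> t \<in> cell s k \<Longrightarrow> T \<eta> t = Tk \<eta> k"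
    and "\<theta> \<in> \<Theta>"
    and "probability_vector \<pi>"
    and "prob_space M"
    and "\<And>n. n \<in> {1..N} \<Longrightarrow>
           markov_jump_process M (initial_vector \<pi>) (\<lambda>t. intensity_matrix (T \<theta> t)) (X n)"
    and "prob_space.indep_vars M (\<lambda>_. \<Pi>\<^sub>M t\<in>{0..}. count_space UNIV)
           (\<lambda>n \<omega>. \<lambda>t\<in>{0..}. X n t \<omega>) {1..N}"
    and "\<And>n. n \<in> {1..N} \<Longrightarrow> AE \<omega> in M. \<exists>t\<ge>0. X n t \<omega> = None"
  shows
    "let G = sigma_absorption M N X;
         \<tau> = (\<lambda>n \<omega>. absorption_time (\<lambda>t. X n t \<omega>));
         P = P_bar K s (Tk \<theta>);
         f = absorption_density K s (Tk \<theta>) \<pi>;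
         ex = (\<lambda>x. exit_rates (Tk \<theta> (cell_index K s x)))
     in
       (\<forall>i. AE \<omega> in M. real_cond_exp M G (stat_B N X i) \<omega> =
          (\<Sum>n=1..N. \<pi> $ i * (axis i 1 \<bullet> (P 0 (\<tau> n \<omega>) *v ex (\<tau> n \<omega>))) / f (\<tau> n \<omega>))) \<and>
       (\<forall>i. \<forall>k\<in>{1..K}. AE \<omega> in M. real_cond_exp M G (stat_E N X s i k) \<omega> =
          (\<Sum>n=1..N.
             (LBINT u=min (s (k - 1)) (ereal (\<tau> n \<omega>))..min (s k) (ereal (\<tau> n \<omega>)).
                ((\<pi> v* P 0 u) \<bullet> axis i 1) *
                (axis i 1 \<bullet> (P u (\<tau> n \<omega>) *v ex (\<tau> n \<omega>))))
             / f (\<tau> n \<omega>))) \<and>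
       (\<forall>i j. \<forall>k\<in>{1..K}. j \<noteq> i \<longrightarrow>
          (AE \<omega> in M. real_cond_exp M G (stat_O N X s i (Some j) k) \<omega> =
            (\<Sum>n=1..N.
               (LBINT u=min (s (k - 1)) (ereal (\<tau> n \<omega>))..min (s k) (ereal (\<tau> n \<omega>)).
                  ((\<pi> v* P 0 u) \<bullet> axis i 1) * Tk \<theta> k $ i $ j *
                  (axis j 1 \<bullet> (P u (\<tau> n \<omega>) *v ex (\<tau> n \<omega>))))
               / f (\<tau> n \<omega>)))) \<and>
       (\<forall>i. \<forall>k\<in>{1..K}. AE \<omega> in M. real_cond_exp M G (stat_O N X s i None k) \<omega> =
          (\<Sum>n=1..N. of_bool (\<tau> n \<omega> \<in> cell s k) *
             (((\<pi> v* P 0 (\<tau> n \<omega>)) \<bullet> axis i 1) * (axis i 1 \<bullet> ex (\<tau> n \<omega>)))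
             / f (\<tau> n \<omega>)))"
proof -
  let ?Tk = "Tk \<theta>" and ?Tf = "T \<theta>"
  let ?\<tau> = "\<lambda>n \<omega>. absorption_time (\<lambda>t. X n t \<omega>)"
  let ?G = "sigma_absorption M N X" and ?f = "absorption_density K s (Tk \<theta>) \<pi>"
  interpret time_grid K s by unfold_locales fact
  have rates: "rate_data K s ?Tk \<pi>"
  proof unfold_locales
    show "sub_intensity_matrix (Tk \<theta> k)" if "k \<in> {1..K}" for k
      using assms(3)[OF assms(5)] assms(4)[OF assms(5)] that by (rule sub_intensity_on_cell)
  qed fact
  interpret rate_data K s ?Tk \<pi> by fact
  have process: "\<exists>P L. phase_type K s ?Tk \<pi> M (X n) ?Tf P L" if "n \<in> {1..N}" for n
    by (rule phase_type_exists[OF assms(7) rates assms(4)[OF assms(5)] assms(8)[OF that] assms(10)[OF that]])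
  note cond = conditional_expected_statistic[OF assms(7) rates process assms(9)]
  have ax: "axis i 1 \<bullet> v = v $ i" "v \<bullet> axis i 1 = v $ i" for i and v :: "real ^ 'p"
    by (simp_all add: inner_axis inner_axis')
  have ed: "(Q u x *v exit_rates (Tk \<theta> (cell_index K s x))) $ j = exit_density j u x" for j u x
    by (simp add: exit_density_def ex_def)
  have cell_pos': "cell s k \<subseteq> {0..}" if "k \<in> {1..K}" for k using cell_pos[OF that] by force
  have pi: "0 \<le> \<pi> $ i" for i using assms(6) by (simp add: probability_vector_def)
  have B: "AE \<omega> in M. real_cond_exp M ?G (stat_B N X i) \<omega> =
      (\<Sum>n=1..N. \<pi> $ i * exit_density i 0 (?\<tau> n \<omega>) / ?f (?\<tau> n \<omega>))" for i
  proof -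
    have stat: "stat_B N X i = (\<lambda>\<omega>. \<Sum>n=1..N. of_bool (X n 0 \<omega> = Some i))"
      by (simp add: stat_B_def fun_eq_iff)
    have "AE \<omega> in M. (\<forall>n\<in>{1..N}. 0 < ?\<tau> n \<omega>) \<and> real_cond_exp M ?G (\<lambda>\<omega>. \<Sum>n=1..N. of_bool (X n 0 \<omega> = Some i)) \<omega> =
        (\<Sum>n=1..N. \<pi> $ i * exit_density i 0 (?\<tau> n \<omega>) / ?f (?\<tau> n \<omega>))"
    proof (rule cond[where stat = "\<lambda>x. of_bool (x 0 = Some i)" and num = "\<lambda>x. \<pi> $ i * exit_density i 0 x"])
      show "(\<lambda>\<omega>. of_bool (Y 0 \<omega> = Some i) :: real) \<in> borel_measurable F" if "path_process F Y" for F Y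
        using measurable_compose[OF path_process.X_measurable[OF that order_refl], of "\<lambda>b. of_bool (b = Some i)" borel]
        by simp
      show "(\<lambda>x. \<pi> $ i * exit_density i 0 x) \<in> borel_measurable borel"
        by (intro borel_measurable_times exit_density_measurable) simp_all
      show "0 \<le> \<pi> $ i * exit_density i 0 x" if "0 < x" for x
        using that pi by (intro mult_nonneg_nonneg exit_density_nonneg) auto
    qed (auto intro: phase_type.absorption_law_from)
    then show ?thesis unfolding stat by eventually_elim simp
  qed
  \<comment> \<open>Sojourn times and transitions between transient states differ only in the target \<open>j\<close> and the weight \<open>c\<close>.\<close>
  have visits: "AE \<omega> in M. real_cond_exp M ?G (\<lambda>\<omega>. \<Sum>n=1..N. stat (\<lambda>t. X n t \<omega>)) \<omega> =
      (\<Sum>n=1..N. (LBINT u=min (s (k - 1)) (ereal (?\<tau> n \<omega>))..min (s k) (ereal (?\<tau> n \<omega>)).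
        (\<pi> v* Q 0 u) $ i * c * exit_density j u (?\<tau> n \<omega>)) / ?f (?\<tau> n \<omega>))"
    if k: "k \<in> {1..K}" and c: "0 \<le> c" and nonneg: "\<And>x. 0 \<le> stat x"
      and meas: "\<And>F Y. path_process F Y \<Longrightarrow> (\<lambda>\<omega>::'w. stat (\<lambda>t. Y t \<omega>)) \<in> borel_measurable F"
      and eq: "\<And>Y P L A. phase_type K s ?Tk \<pi> M Y ?Tf P L \<Longrightarrow> A \<in> sets borel \<Longrightarrow>
        (\<integral>\<^sup>+\<omega>. ennreal (stat (\<lambda>t. Y t \<omega>)) * indicator A (absorption_time (\<lambda>t. Y t \<omega>)) \<partial>M) =
        (\<integral>\<^sup>+x. indicator A x * visit_density i j c (cell s k) x \<partial>lborel)"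
    for stat :: "(real \<Rightarrow> 'p option) \<Rightarrow> real" and i j c k
  proof -
    have "AE \<omega> in M. (\<forall>n\<in>{1..N}. 0 < ?\<tau> n \<omega>) \<and> real_cond_exp M ?G (\<lambda>\<omega>. \<Sum>n=1..N. stat (\<lambda>t. X n t \<omega>)) \<omega> =
        (\<Sum>n=1..N. enn2real (visit_density i j c (cell s k) (?\<tau> n \<omega>)) / ?f (?\<tau> n \<omega>))"
    proof (rule cond[OF _ nonneg meas])
      show "(\<lambda>x. enn2real (visit_density i j c (cell s k) x)) \<in> borel_measurable borel"
        using visit_density_measurable[OF cell_measurable] by simp
      fix Y P L and A :: "real set"
      assume pt: "phase_type K s ?Tk \<pi> M Y ?Tf P L" and A: "A \<in> sets borel"
      have "indicator A x * visit_density i j c (cell s k) x =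
          indicator A x * (indicator {0<..} x * ennreal (enn2real (visit_density i j c (cell s k) x)))" for x :: real
      proof (cases "0 < x")
        case True
        then show ?thesis using phase_type.visit_density_finite[OF pt True cell_pos'[OF k] c, of i j] by simp
      next
        case False
        then have "visit_density i j c (cell s k) x = (\<integral>\<^sup>+u. 0 \<partial>(lborel :: real measure))"
          unfolding visit_density_def using cell_pos[OF k]
          by (intro nn_integral_cong) (force simp: indicator_def)
        then show ?thesis using False by simp
      qed
      then show "(\<integral>\<^sup>+\<omega>. ennreal (stat (\<lambda>t. Y t \<omega>)) * indicator A (absorption_time (\<lambda>t. Y t \<omega>)) \<partial>M) =
          (\<integral>\<^sup>+x. indicator A x * (indicator {0<..} x * ennreal (enn2real (visit_density i j c (cell s k) x))) \<partial>lborel)"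
        using eq[OF pt A] by simp
    qed auto
    then show ?thesis
    proof eventually_elim
      case (elim \<omega>)
      have "enn2real (visit_density i j c (cell s k) (?\<tau> n \<omega>)) =
          (LBINT u=min (s (k - 1)) (ereal (?\<tau> n \<omega>))..min (s k) (ereal (?\<tau> n \<omega>)).
            (\<pi> v* Q 0 u) $ i * c * exit_density j u (?\<tau> n \<omega>))" if n: "n \<in> {1..N}" for n
      proof -
        obtain P L where pt: "phase_type K s ?Tk \<pi> M (X n) ?Tf P L" using process[OF n] by auto
        from phase_type.visit_density_interval_integral[OF pt _ k c] elim n show ?thesis by simp
      qed
      then show ?case using elim by simp
    qed
  qed
  have E: "AE \<omega> in M. real_cond_exp M ?G (stat_E N X s i k) \<omega> =
      (\<Sum>n=1..N. (LBINT u=min (s (k - 1)) (ereal (?\<tau> n \<omega>))..min (s k) (ereal (?\<tau> n \<omega>)).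
        (\<pi> v* Q 0 u) $ i * 1 * exit_density i u (?\<tau> n \<omega>)) / ?f (?\<tau> n \<omega>))" if k: "k \<in> {1..K}" for i k
  proof -
    have stat: "stat_E N X s i k = (\<lambda>\<omega>. \<Sum>n=1..N. sojourn_time (\<lambda>t. X n t \<omega>) (Some i) (cell s k))"
      by (simp add: stat_E_def fun_eq_iff)
    show ?thesis
      unfolding stat
    proof (rule visits[OF k, where stat = "\<lambda>x. sojourn_time x (Some i) (cell s k)"])
      show "0 \<le> sojourn_time x (Some i) (cell s k)" for x
        unfolding sojourn_time_def set_lebesgue_integral_def by (rule integral_nonneg_AE) simp
      show "(\<lambda>\<omega>. sojourn_time (\<lambda>t. Y t \<omega>) (Some i) (cell s k)) \<in> borel_measurable F" if "path_process F Y" for F Y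
        by (rule path_process.sojourn_time_measurable[OF that cell_measurable cell_pos'[OF k]])
      show "(\<integral>\<^sup>+\<omega>. ennreal (sojourn_time (\<lambda>t. Y t \<omega>) (Some i) (cell s k)) *
            indicator A (absorption_time (\<lambda>t. Y t \<omega>)) \<partial>M) =
          (\<integral>\<^sup>+x. indicator A x * visit_density i i 1 (cell s k) x \<partial>lborel)"
        if "phase_type K s ?Tk \<pi> M Y ?Tf P L" "A \<in> sets borel" for Y P L A
        by (rule phase_type.expected_sojourn[OF that(1) cell_measurable cell_pos'[OF k] that(2)])
    qed simp
  qed
  have jumps: "(\<lambda>\<omega>. real (jump_count (\<lambda>t. Y t \<omega>) (Some i) b (cell s k))) \<in> borel_measurable F"
    if "path_process F Y" "k \<in> {1..K}" "b \<noteq> Some i" for F and Y :: "real \<Rightarrow> 'w \<Rightarrow> 'p option" and i b k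
  proof -
    have "irreflp (\<lambda>l y. l = Some i \<and> y = b)" using that(3) by (auto intro: irreflpI)
    from jump_number_cell_measurable[OF that(1,2) this] show ?thesis
      unfolding jump_count_conv by simp
  qed
  \<comment> \<open>Regular paths have finitely many jumps in a cell, so both ways of counting agree almost surely.\<close>
  have jump_eq: "(\<integral>\<^sup>+\<omega>. ennreal (real (jump_count (\<lambda>t. Y t \<omega>) (Some i) b (cell s k))) * h \<omega> \<partial>M) =
      (\<integral>\<^sup>+\<omega>. jump_number (\<lambda>t. Y t \<omega>) (\<lambda>l y. l = Some i \<and> y = b) (cell s k) * h \<omega> \<partial>M)"
    if pt: "phase_type K s ?Tk \<pi> M Y ?Tf P L" and k: "k \<in> {1..K}" and b: "b \<noteq> Some i" for Y P L i b k h
  proof (rule nn_integral_cong_AE)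
    show "AE \<omega> in M. ennreal (real (jump_count (\<lambda>t. Y t \<omega>) (Some i) b (cell s k))) * h \<omega> =
        jump_number (\<lambda>t. Y t \<omega>) (\<lambda>l y. l = Some i \<and> y = b) (cell s k) * h \<omega>"
      using phase_type.AE_regular[OF pt]
    proof eventually_elim
      case (elim \<omega>)
      from phase_type.jump_number_regular_finite[OF pt elim k b]
      show ?case unfolding jump_count_conv by simp
    qed
  qed
  have O: "AE \<omega> in M. real_cond_exp M ?G (stat_O N X s i (Some j) k) \<omega> =
      (\<Sum>n=1..N. (LBINT u=min (s (k - 1)) (ereal (?\<tau> n \<omega>))..min (s k) (ereal (?\<tau> n \<omega>)).
        (\<pi> v* Q 0 u) $ i * Tk \<theta> k $ i $ j * exit_density j u (?\<tau> n \<omega>)) / ?f (?\<tau> n \<omega>))"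
    if k: "k \<in> {1..K}" and ij: "j \<noteq> i" for i j k
  proof -
    have stat: "stat_O N X s i (Some j) k =
        (\<lambda>\<omega>. \<Sum>n=1..N. real (jump_count (\<lambda>t. X n t \<omega>) (Some i) (Some j) (cell s k)))"
      by (simp add: stat_O_def fun_eq_iff)
    show ?thesis
      unfolding stat
    proof (rule visits[OF k, where stat = "\<lambda>x. real (jump_count x (Some i) (Some j) (cell s k))"])
      show "0 \<le> Tk \<theta> k $ i $ j" using sub_intensity_Tk[OF k] ij by (auto simp: sub_intensity_matrix_def)
      show "(\<integral>\<^sup>+\<omega>. ennreal (real (jump_count (\<lambda>t. Y t \<omega>) (Some i) (Some j) (cell s k))) *
            indicator A (absorption_time (\<lambda>t. Y t \<omega>)) \<partial>M) =
          (\<integral>\<^sup>+x. indicator A x * visit_density i j (Tk \<theta> k $ i $ j) (cell s k) x \<partial>lborel)"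
        if "phase_type K s ?Tk \<pi> M Y ?Tf P L" "A \<in> sets borel" for Y P L A
        using phase_type.expected_transitions[OF that(1) k _ that(2), of i j] ij
        by (subst jump_eq[OF that(1) k]) auto
    qed (use jumps k ij in auto)
  qed
  have O_exit: "AE \<omega> in M. real_cond_exp M ?G (stat_O N X s i None k) \<omega> =
      (\<Sum>n=1..N. of_bool (?\<tau> n \<omega> \<in> cell s k) * ((\<pi> v* Q 0 (?\<tau> n \<omega>)) $ i * ex (?\<tau> n \<omega>) $ i) / ?f (?\<tau> n \<omega>))"
    if k: "k \<in> {1..K}" for i k
  proof -
    have stat: "stat_O N X s i None k =
        (\<lambda>\<omega>. \<Sum>n=1..N. real (jump_count (\<lambda>t. X n t \<omega>) (Some i) None (cell s k)))"
      by (simp add: stat_O_def fun_eq_iff)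
    let ?num = "\<lambda>x. of_bool (x \<in> cell s k) * ((\<pi> v* Q 0 x) $ i * ex x $ i)"
    have "AE \<omega> in M. (\<forall>n\<in>{1..N}. 0 < ?\<tau> n \<omega>) \<and>
        real_cond_exp M ?G (\<lambda>\<omega>. \<Sum>n=1..N. real (jump_count (\<lambda>t. X n t \<omega>) (Some i) None (cell s k))) \<omega> =
        (\<Sum>n=1..N. ?num (?\<tau> n \<omega>) / ?f (?\<tau> n \<omega>))"
    proof (rule cond[where stat = "\<lambda>x. real (jump_count x (Some i) None (cell s k))" and num = ?num])
      have "(\<lambda>x. (\<pi> v* Q 0 x) $ i) \<in> borel_measurable borel"
        unfolding vector_matrix_mult_def vec_lambda_beta
        by (intro borel_measurable_sum borel_measurable_times P_bar_measurable borel_measurable_const) simp_all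
      moreover have "(\<lambda>x. ex x $ i) \<in> borel_measurable borel"
        unfolding ex_def by (rule exit_rates_measurable) simp
      ultimately show "?num \<in> borel_measurable borel" by simp
      show "0 \<le> ?num x" if "0 < x" for x
      proof -
        have "0 \<le> (\<pi> v* Q 0 x) $ i"
          unfolding vector_matrix_mult_def vec_lambda_beta
          using that pi by (intro sum_nonneg mult_nonneg_nonneg Q_nonneg) auto
        then show ?thesis using ex_nonneg[of x i] that by simp
      qed
      show "(\<integral>\<^sup>+\<omega>. ennreal (real (jump_count (\<lambda>t. Y t \<omega>) (Some i) None (cell s k))) *
            indicator A (absorption_time (\<lambda>t. Y t \<omega>)) \<partial>M) =
          (\<integral>\<^sup>+x. indicator A x * (indicator {0<..} x * ennreal (?num x)) \<partial>lborel)"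
        if pt: "phase_type K s ?Tk \<pi> M Y ?Tf P L" and A: "A \<in> sets borel" for Y P L A
      proof -
        interpret phase_type K s ?Tk \<pi> M Y ?Tf P L by fact
        have "indicator (cell s k) x * ennreal (occ (Some i) x * ex x $ i) =
            indicator {0<..} x * ennreal (?num x)" for x
          using cell_pos[OF k, of x] by (auto simp: indicator_def occ_eq)
        then show ?thesis
          using expected_exits[OF k A, of i] by (subst jump_eq[OF pt k]) auto
      qed
    qed (use jumps k in auto)
    then show ?thesis unfolding stat by eventually_elim simp
  qed
  show ?thesis
    unfolding Let_def ax ed using B E O O_exit by (simp add: ex_def)
qed

end
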